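(* Let $u$ be a weak subsolution of $-\operatorname{div}\mathcal{B}(x,u,\nabla u)+\mathcal{L}(u)=0$ in $\Omega$. Then there exists $c=c(N,p,s,\Lambda,C_1,C_2)>0$ such that $$\operatorname*{ess\,sup}_{B_{r/2}(x_0)}u\le\delta\,\mathrm{Tail}(u^+;x_0,\tfrac r2)+c\,\delta^{-\frac{(p-1)\kappa}{p(\kappa-1)}}\Big(\frac1{|B_r(x_0)|}\int_{B_r(x_0)}(u^+)^p\,dx\Big)^{1/p}$$ whenever $B_r(x_0)\subset\Omega$ with $r\in(0,1]$ and $\delta\in(0,1]$, where $\kappa=\frac N{N-p}$ if $1<p<N$ and $\kappa=2$ if $p\ge N$.
   Context: $\Omega\subset\mathbb{R}^N$ ($N\ge2$) is a bounded smooth domain, $1<p<\infty$, $0<s<1$. $\mathcal{B}:\Omega\times\mathbb{R}\times\mathbb{R}^N\to\mathbb{R}^N$ is measurable in $x$ and continuous in $(u,\zeta)$, and satisfies (H1): $\mathcal{B}(x,u,\zeta)\cdot\zeta\ge C_1|\zeta|^p$ and $|\mathcal{B}(x,u,\zeta)|\le C_2|\zeta|^{p-1}$ for a.e. $x\in\Omega$ and all $(u,\zeta)\in\mathbb{R}^{N+1}$, with constants $C_1,C_2>0$. $K$ is a measurable kernel, symmetric in $x,y$, with $\Lambda^{-1}|x-y|^{-N-ps}\le K(x,y)\le\Lambda|x-y|^{-N-ps}$ for some $\Lambda\ge1$; $d\mu=K(x,y)\,dx\,dy$. $\mathcal{L}(u)(x)=\mathrm{P.V.}\int_{\mathbb{R}^N}|u(x)-u(y)|^{p-2}(u(x)-u(y))K(x,y)\,dy$.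 A function $u\in L^\infty(\mathbb{R}^N)\cap W^{1,p}_{\rm loc}(\Omega)$ is a weak subsolution if for every $\Omega'\Subset\Omega$ and every nonnegative $\phi\in W^{1,p}_0(\Omega')$ (extended by zero), $\int_{\Omega'}\mathcal{B}(x,u,\nabla u)\cdot\nabla\phi\,dx+\int_{\mathbb{R}^N}\int_{\mathbb{R}^N}|u(x)-u(y)|^{p-2}(u(x)-u(y))(\phi(x)-\phi(y))\,d\mu\le0$. The tail is $\mathrm{Tail}(v;x_0,r)=\big(r^p\int_{\mathbb{R}^N\setminus B_r(x_0)}\frac{|v(y)|^{p-1}}{|y-x_0|^{N+ps}}dy\big)^{1/(p-1)}$. $k^+=\max\{k,0\}$. *)

theory Defs
  imports "HOL-Analysis.Analysis" "HOL-Probability.Essential_Supremum"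
begin

definition partial :: "('a::euclidean_space \<Rightarrow> real) \<Rightarrow> 'a \<Rightarrow> 'a \<Rightarrow> real" where
  "partial f i x = deriv (\<lambda>t. f (x + t *\<^sub>R i)) 0"

(* C^\<infinity>(R^N): all partial derivatives of all orders exist and are continuous *)
definition smooth_fun :: "('a::euclidean_space \<Rightarrow> real) \<Rightarrow> bool" where
  "smooth_fun f \<longleftrightarrow> (\<exists>F. f \<in> F \<and> (\<forall>g\<in>F. continuous_on UNIV g \<and>
      (\<forall>i\<in>Basis. (\<forall>x. (\<lambda>t. g (x + t *\<^sub>R i)) differentiable (at 0)) \<and> partial g i \<in> F)))"

definition sgrad :: "('a::euclidean_space \<Rightarrow> real) \<Rightarrow> 'a \<Rightarrow> 'a" where
  "sgrad f x = (\<Sum>i\<in>Basis. partial f i x *\<^sub>R i)"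

definition test_fun :: "'a::euclidean_space set \<Rightarrow> ('a \<Rightarrow> real) \<Rightarrow> bool" where
  "test_fun U \<phi> \<longleftrightarrow> smooth_fun \<phi> \<and> compact (closure {x. \<phi> x \<noteq> 0}) \<and> closure {x. \<phi> x \<noteq> 0} \<subseteq> U"

definition weak_grad :: "'a::euclidean_space set \<Rightarrow> ('a \<Rightarrow> real) \<Rightarrow> ('a \<Rightarrow> 'a) \<Rightarrow> bool" where
  "weak_grad U u G \<longleftrightarrow> (\<forall>\<phi>. test_fun U \<phi> \<longrightarrow> (\<forall>i\<in>Basis.
      set_integrable lebesgue U (\<lambda>x. u x * partial \<phi> i x) \<and>
      set_integrable lebesgue U (\<lambda>x. (G x \<bullet> i) * \<phi> x) \<and>
      (LINT x:U|lebesgue. u x * partial \<phi> i x) = - (LINT x:U|lebesgue. (G x \<bullet> i) * \<phi> x)))"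

definition W1p_loc :: "'a::euclidean_space set \<Rightarrow> real \<Rightarrow> ('a \<Rightarrow> real) \<Rightarrow> ('a \<Rightarrow> 'a) \<Rightarrow> bool" where
  "W1p_loc U p u G \<longleftrightarrow> set_borel_measurable lebesgue U u \<and> set_borel_measurable lebesgue U G \<and>
     (\<forall>C. compact C \<and> C \<subseteq> U \<longrightarrow> set_integrable lebesgue C (\<lambda>x. \<bar>u x\<bar> powr p) \<and>
                                     set_integrable lebesgue C (\<lambda>x. norm (G x) powr p)) \<and>
     weak_grad U u G"

definition W1p :: "'a::euclidean_space set \<Rightarrow> real \<Rightarrow> ('a \<Rightarrow> real) \<Rightarrow> ('a \<Rightarrow> 'a) \<Rightarrow> bool" where
  "W1p U p u G \<longleftrightarrow> set_borel_measurable lebesgue U u \<and> set_borel_measurable lebesgue U G \<and>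
     set_integrable lebesgue U (\<lambda>x. \<bar>u x\<bar> powr p) \<and>
     set_integrable lebesgue U (\<lambda>x. norm (G x) powr p) \<and> weak_grad U u G"

definition W01p :: "'a::euclidean_space set \<Rightarrow> real \<Rightarrow> ('a \<Rightarrow> real) \<Rightarrow> ('a \<Rightarrow> 'a) \<Rightarrow> bool" where
  "W01p U p \<phi> G \<longleftrightarrow> W1p U p \<phi> G \<and> (\<forall>x. x \<notin> U \<longrightarrow> \<phi> x = 0) \<and>
     (\<exists>\<psi>::nat \<Rightarrow> 'a \<Rightarrow> real. (\<forall>k. test_fun U (\<psi> k)) \<and>
        (\<lambda>k. (LINT x:U|lebesgue. \<bar>\<psi> k x - \<phi> x\<bar> powr p + norm (sgrad (\<psi> k) x - G x) powr p))
          \<longlonglongrightarrow> 0)"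

definition ppow :: "real \<Rightarrow> real \<Rightarrow> real" where
  "ppow p t = \<bar>t\<bar> powr (p - 2) * t"

definition weak_subsolution ::
  "'a::euclidean_space set \<Rightarrow> real \<Rightarrow> ('a \<Rightarrow> real \<Rightarrow> 'a \<Rightarrow> 'a) \<Rightarrow> ('a \<Rightarrow> 'a \<Rightarrow> real) \<Rightarrow> ('a \<Rightarrow> real) \<Rightarrow> bool" where
  "weak_subsolution \<Omega> p \<B> K u \<longleftrightarrow>
     u \<in> borel_measurable lebesgue \<and> (\<exists>M. AE x in lebesgue. \<bar>u x\<bar> \<le> M) \<and>
     (\<exists>G. W1p_loc \<Omega> p u G \<and>
       (\<forall>\<Omega>' \<phi> G\<phi>. open \<Omega>' \<and> compact (closure \<Omega>') \<and> closure \<Omega>' \<subseteq> \<Omega> \<and>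
           W01p \<Omega>' p \<phi> G\<phi> \<and> (AE x in lebesgue. 0 \<le> \<phi> x) \<longrightarrow>
          set_integrable lebesgue \<Omega>' (\<lambda>x. \<B> x (u x) (G x) \<bullet> G\<phi> x) \<and>
          integrable lebesgue (\<lambda>(x,y). ppow p (u x - u y) * (\<phi> x - \<phi> y) * K x y) \<and>
          (LINT x:\<Omega>'|lebesgue. \<B> x (u x) (G x) \<bullet> G\<phi> x)
            + (LINT z|lebesgue. (\<lambda>(x,y). ppow p (u x - u y) * (\<phi> x - \<phi> y) * K x y) z) \<le> 0))"

definition Tail :: "real \<Rightarrow> real \<Rightarrow> ('a::euclidean_space \<Rightarrow> real) \<Rightarrow> 'a \<Rightarrow> real \<Rightarrow> real" where
  "Tail p s v x0 r = (r powr p * (LINT y:(UNIV - ball x0 r)|lebesgue.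
       \<bar>v y\<bar> powr (p - 1) / dist y x0 powr (real DIM('a) + p * s))) powr (1 / (p - 1))"

definition smooth_bounded_domain :: "'a::euclidean_space set \<Rightarrow> bool" where
  "smooth_bounded_domain \<Omega> \<longleftrightarrow> open \<Omega> \<and> connected \<Omega> \<and> bounded \<Omega> \<and> \<Omega> \<noteq> {} \<and>
     (\<forall>z\<in>frontier \<Omega>. \<exists>U \<psi>. open U \<and> z \<in> U \<and> smooth_fun \<psi> \<and>
        (\<forall>x\<in>U \<inter> frontier \<Omega>. sgrad \<psi> x \<noteq> 0) \<and> \<Omega> \<inter> U = {x\<in>U. \<psi> x < 0})"

definition kappa :: "nat \<Rightarrow> real \<Rightarrow> real" where
  "kappa N p = (if p < real N then real N / (real N - p) else 2)"

end

theory Submission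
  imports Defs
begin

text \<open>
  De Giorgi iteration on the truncations \<open>(u - k_j)_+\<close> over shrinking balls \<open>B_j\<close>. Testing with
  \<open>(u - k)_+ \<eta>^p\<close> gives a Caccioppoli inequality in which the nonlocal term contributes a
  local energy term (pairs inside the ball) and a tail term (one point outside). The Sobolev
  inequality is replaced by an elementary Faber--Krahn inequality: if \<open>f\<close> vanishes outside \<open>E\<close>
  and \<open>|B_r| \<ge> 2 |E|\<close>, then from every point of \<open>E\<close> at least half of the translates by vectors of
  \<open>B_r\<close> leave \<open>E\<close>, so averaging \<open>\<parallel>f(\<cdot> + v) - f\<parallel>_p \<le> C |v| \<parallel>\<nabla>f\<parallel>_p\<close> over \<open>v \<in> B_r\<close> bounds
  \<open>\<parallel>f\<parallel>_p\<close> by \<open>C r \<parallel>\<nabla>f\<parallel>_p\<close>, i.e. by \<open>C |E|^(1/N) \<parallel>\<nabla>f\<parallel>_p\<close>. Since \<open>1 - 1/\<kappa> \<le> p/N\<close>, this yields the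
  recursion \<open>y_(j+1) \<le> C \<delta>^(1-p) b^j y_j^(2 - 1/\<kappa>)\<close> for the normalised energies.
\<close>


section \<open>Smooth bump functions and mollification\<close>

text \<open>The admissible test functions are limits of \<open>test_fun\<close>s, and
  \<open>smooth_fun\<close> asks for a family closed under all partial derivatives; hence the
  explicit bumps below, and a class \<open>W1p_approx\<close> of W^(1,p) limits of C^1 functions in
  which truncation is done before the result is smoothed into \<open>W01p\<close>. Integrals are
  moved to Borel representatives under \<open>lborel\<close>, where Tonelli is available on the
  product. The exponent of \<delta> comes from the recursion. At a level k with \<delta> \<theta>
  \<le> k, \<theta> being the tail, the tail term carries (\<theta>/k)^(p-1) \<le> \<delta>^(1-p),
  so the recursion constant D is proportional to \<delta>^(1-p). Starting it requires y_0 \<le>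
  D^(-1/\<beta>) times a constant, with \<beta> = 1 - 1/\<kappa>; as y_0 is the mean of (u^+)^p
  divided by k^p, solving for k gives the power (1-p)/(p \<beta>) of \<delta>. The radius
  disappears: r^p from Faber--Krahn cancels r^(-p) from the cutoff gradient and from the tail, while
  r \<le> 1 bounds the near-diagonal kernel integral by its value over the ball of radius 2.\<close>

definition flat_exp :: "nat \<Rightarrow> real \<Rightarrow> real" where
  "flat_exp n t = (if t > 0 then exp (- (1 / t)) / t ^ n else 0)"

lemma flat_exp_tendsto_0: "(flat_exp n \<longlongrightarrow> 0) (at 0)"
proof -
  have "((\<lambda>x. inverse x ^ n / exp (inverse x)) \<longlongrightarrow> (0::real)) (at_right 0)"
    by (rule filterlim_compose[OF tendsto_power_div_exp_0 filterlim_inverse_at_top_right])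
  then have R: "(flat_exp n \<longlongrightarrow> 0) (at_right 0)"
    by (rule Lim_transform_eventually)
       (auto simp: eventually_at_right_field flat_exp_def exp_minus field_simps intro!: exI[of _ 1])
  have L: "(flat_exp n \<longlongrightarrow> 0) (at_left 0)"
    by (rule Lim_transform_eventually[OF tendsto_const])
       (auto simp: eventually_at_left_field flat_exp_def intro!: exI[of _ "-1"])
  show ?thesis using L R by (simp add: filterlim_split_at)
qed

text \<open>Keeping the power of 1/t as an index makes the family closed under differentiation: the
  exponential contributes 1/t^2, the denominator -n/t. At 0 the difference quotient of
  \<open>flat_exp n\<close> is \<open>flat_exp (Suc n)\<close>, whose limit is already
  known.\<close>

lemma flat_exp_has_derivative:
  "(flat_exp n has_real_derivative (flat_exp (n + 2) t - real n * flat_exp (n + 1) t)) (at t)"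
proof -
  consider "t > 0" | "t < 0" | "t = 0" by linarith
  then show ?thesis
  proof cases
    case 1
    have "((\<lambda>t. exp (- (1 / t)) / t ^ n) has_real_derivative
        (flat_exp (n + 2) t - real n * flat_exp (n + 1) t)) (at t)"
      proof (cases n)
      case (Suc m)
      have "t ^ m = t * t ^ (m - Suc 0) \<or> m = 0" by (cases m) auto
      then show ?thesis using 1 Suc
        by (auto intro!: derivative_eq_intros simp: flat_exp_def field_simps power2_eq_square)
    qed (use 1 in \<open>auto intro!: derivative_eq_intros simp: flat_exp_def field_simps power2_eq_square\<close>)
    then show ?thesis
      by (rule has_field_derivative_transform_within_open[of _ _ _ "{0<..}"]) (use 1 in \<open>auto simp: flat_exp_def\<close>)
  next
    case 2
    have "((\<lambda>t. 0) has_real_derivative (flat_exp (n + 2) t - real n * flat_exp (n + 1) t)) (at t)"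
      using 2 by (auto simp: flat_exp_def)
    then show ?thesis
      by (rule has_field_derivative_transform_within_open[of _ _ _ "{..<0}"]) (use 2 in \<open>auto simp: flat_exp_def\<close>)
  next
    case 3
    have "((\<lambda>h. (flat_exp n (0 + h) - flat_exp n 0) / h) \<longlongrightarrow> 0) (at 0)"
      by (rule Lim_transform_eventually[OF flat_exp_tendsto_0[of "Suc n"]])
         (auto simp: flat_exp_def eventually_at intro!: exI[of _ 1])
    then have "(flat_exp n has_real_derivative 0) (at 0)" by (simp add: DERIV_def)
    then show ?thesis using 3 by (simp add: flat_exp_def)
  qed
qed

text \<open>The linear span of products of two one-sided flat functions vanishing off (-a, a).
  Taking the span rather than one function gives closure under d/dt, which is what
  \<open>smooth_fun\<close> demands of a witness family.\<close>

inductive_set bumps :: "real \<Rightarrow> (real \<Rightarrow> real) set" for a where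
  base: "(\<lambda>t. flat_exp m (a - t) * flat_exp n (a + t)) \<in> bumps a"
| add: "f \<in> bumps a \<Longrightarrow> g \<in> bumps a \<Longrightarrow> (\<lambda>t. f t + g t) \<in> bumps a"
| scale: "f \<in> bumps a \<Longrightarrow> (\<lambda>t. c * f t) \<in> bumps a"

lemma bumps_deriv:
  "f \<in> bumps a \<Longrightarrow> \<exists>f'\<in>bumps a. \<forall>t. (f has_real_derivative f' t) (at t)"
proof (induction rule: bumps.induct)
  case (base m n)
  let ?b = "\<lambda>m n t. flat_exp m (a - t) * flat_exp n (a + t)"
  have "(\<lambda>t. ((-1) * ?b (m+2) n t + real m * ?b (m+1) n t) + (?b m (n+2) t + (- real n) * ?b m (n+1) t)) \<in> bumps a"
    (is "?f' \<in> _") by (intro bumps.intros)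
  moreover have "(?b m n has_real_derivative ?f' t) (at t)" for t
  proof -
    have 1: "((\<lambda>t. flat_exp m (a - t)) has_real_derivative
        (flat_exp (m + 2) (a - t) - real m * flat_exp (m + 1) (a - t)) * (0 - 1)) (at t)"
      by (rule DERIV_chain2[OF flat_exp_has_derivative]) (auto intro!: derivative_eq_intros)
    have 2: "((\<lambda>t. flat_exp n (a + t)) has_real_derivative
        (flat_exp (n + 2) (a + t) - real n * flat_exp (n + 1) (a + t)) * (0 + 1)) (at t)"
      by (rule DERIV_chain2[OF flat_exp_has_derivative]) (auto intro!: derivative_eq_intros)
    show ?thesis
      by (rule DERIV_cong[OF DERIV_mult[OF 1 2]]) (simp add: algebra_simps)
  qed
  ultimately show ?case by (intro bexI[of _ ?f']) auto
next
  case (add f g)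
  then obtain f' g' where "f' \<in> bumps a" "g' \<in> bumps a" "\<And>t. (f has_real_derivative f' t) (at t)"
    "\<And>t. (g has_real_derivative g' t) (at t)" by blast
  then show ?case by (intro bexI[of _ "\<lambda>t. f' t + g' t"]) (auto intro!: bumps.add DERIV_add)
next
  case (scale f c)
  then obtain f' where "f' \<in> bumps a" "\<And>t. (f has_real_derivative f' t) (at t)" by blast
  then show ?case by (intro bexI[of _ "\<lambda>t. c * f' t"]) (auto intro!: bumps.scale DERIV_cmult)
qed

lemma bumps_support: "f \<in> bumps a \<Longrightarrow> \<bar>t\<bar> \<ge> a \<Longrightarrow> f t = 0"
  by (induction rule: bumps.induct) (auto simp: flat_exp_def)

text \<open>The parameter is the half-width of the supporting cube, so the support lies in a ball of radius \<open>DIM a\<close>.\<close>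
definition tensor_bumps :: "real \<Rightarrow> ('a::euclidean_space \<Rightarrow> real) set" where
  "tensor_bumps a = {\<lambda>x. c * (\<Prod>i\<in>Basis. g i (x \<bullet> i)) | c g. \<forall>i. g i \<in> bumps a}"

lemma tensor_bumps_cmult: "f \<in> tensor_bumps a \<Longrightarrow> (\<lambda>x. c * f x) \<in> tensor_bumps a"
proof -
  assume "f \<in> tensor_bumps a"
  then obtain k g where "f = (\<lambda>x. k * (\<Prod>i\<in>Basis. g i (x \<bullet> i)))" "\<And>i. g i \<in> bumps a"
    unfolding tensor_bumps_def by blast
  then show ?thesis unfolding tensor_bumps_def
    by (auto intro!: exI[of _ "c * k"] exI[of _ g])
qed

text \<open>Each partial derivative changes a single factor into its derivative, so it is again one
  tensor product and no sums of products arise.\<close>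

lemma tensor_bumps_grad:
  fixes f :: "'a::euclidean_space \<Rightarrow> real"
  assumes "f \<in> tensor_bumps a"
  obtains D where "\<And>i. i \<in> Basis \<Longrightarrow> (\<lambda>x. D x \<bullet> i) \<in> tensor_bumps a"
    "\<And>x. (f has_derivative (\<lambda>h. D x \<bullet> h)) (at x)"
proof -
  obtain c g where f: "f = (\<lambda>x. c * (\<Prod>i\<in>Basis. g i (x \<bullet> i)))" and g: "\<And>i. g i \<in> bumps a"
    using assms unfolding tensor_bumps_def by blast
  obtain g' where g': "\<And>i. g' i \<in> bumps a" "\<And>i t. (g i has_real_derivative g' i t) (at t)"
    using bumps_deriv[OF g] by metis
  define P where "P i x = c * (\<Prod>j\<in>Basis. (g(i := g' i)) j (x \<bullet> j))" for i and x :: 'a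
  define D where "D x = (\<Sum>i\<in>Basis. P i x *\<^sub>R i)" for x
  have DP: "D x \<bullet> i = P i x" if "i \<in> Basis" for x i
    using that by (simp add: D_def inner_sum_left inner_Basis if_distrib cong: if_cong)
  have 1: "(\<lambda>x. D x \<bullet> i) \<in> tensor_bumps a" if "i \<in> Basis" for i
  proof -
    have "P i \<in> tensor_bumps a" unfolding tensor_bumps_def P_def[abs_def]
      using g g' by (auto intro!: exI[of _ c] exI[of _ "g(i := g' i)"])
    then show ?thesis using DP[OF that] by simp
  qed
  have 2: "(f has_derivative (\<lambda>h. D x \<bullet> h)) (at x)" for x
  proof -
    have gd: "((\<lambda>x. g i (x \<bullet> i)) has_derivative (\<lambda>h. g' i (x \<bullet> i) * (h \<bullet> i))) (at x)" for i
    proof -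
      have "((\<lambda>x. x \<bullet> i) has_derivative (\<lambda>h. h \<bullet> i)) (at x)" by (auto intro!: derivative_eq_intros)
      from has_derivative_compose[OF this g'(2)[of i "x \<bullet> i", unfolded has_field_derivative_def]]
      show ?thesis .
    qed
    have "(f has_derivative (\<lambda>h. c * (\<Sum>i\<in>Basis. (g' i (x \<bullet> i) * (h \<bullet> i)) * (\<Prod>j\<in>Basis - {i}. g j (x \<bullet> j))))) (at x)"
      unfolding f by (intro has_derivative_mult_right has_derivative_prod gd)
    moreover have "c * (\<Sum>i\<in>Basis. (g' i (x \<bullet> i) * (h \<bullet> i)) * (\<Prod>j\<in>Basis - {i}. g j (x \<bullet> j))) = D x \<bullet> h" for h
    proof -
      have "(\<Prod>j\<in>Basis. (g(i := g' i)) j (x \<bullet> j)) = g' i (x \<bullet> i) * (\<Prod>j\<in>Basis - {i}. g j (x \<bullet> j))" if "i \<in> Basis" for i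
        using that by (simp add: prod.remove[of Basis i])
      then have "P i x * (h \<bullet> i) = c * ((g' i (x \<bullet> i) * (h \<bullet> i)) * (\<Prod>j\<in>Basis - {i}. g j (x \<bullet> j)))" if "i \<in> Basis" for i
        using that by (simp add: P_def)
      then show ?thesis
        unfolding D_def inner_sum_left sum_distrib_left
        by (intro sum.cong refl) (metis (no_types, lifting) inner_commute inner_scaleR_left)
    qed
    ultimately show ?thesis by simp
  qed
  show ?thesis using that 1 2 by blast
qed

lemma tensor_bumps_continuous: "f \<in> tensor_bumps a \<Longrightarrow> continuous_on S f"
proof -
  assume "f \<in> tensor_bumps a"
  then obtain D where "\<And>x. (f has_derivative (\<lambda>h. D x \<bullet> h)) (at x)" using tensor_bumps_grad by metis
  then show ?thesis by (intro continuous_at_imp_continuous_on ballI has_derivative_continuous)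
qed

text \<open>A point with all coordinates below a in modulus has norm at most its l^1 norm, hence
  below DIM * a; beyond that some factor vanishes.\<close>

lemma tensor_bumps_support:
  fixes f :: "'a::euclidean_space \<Rightarrow> real"
  assumes "f \<in> tensor_bumps a" "norm x \<ge> real DIM('a) * a"
  shows "f x = 0"
proof -
  obtain c g where f: "f = (\<lambda>x. c * (\<Prod>i\<in>Basis. g i (x \<bullet> i)))" and g: "\<And>i. g i \<in> bumps a"
    using assms unfolding tensor_bumps_def by blast
  have "\<exists>i\<in>Basis. \<bar>x \<bullet> i\<bar> \<ge> a"
  proof (rule ccontr)
    assume "\<not> ?thesis"
    then have "(\<Sum>i\<in>Basis. \<bar>x \<bullet> i\<bar>) < (\<Sum>i\<in>(Basis::'a set). a)"
      by (intro sum_strict_mono) auto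
    then show False using norm_le_l1[of x] assms(2) by simp
  qed
  then show ?thesis using g bumps_support unfolding f by force
qed

lemma compact_support_bounded:
  fixes f :: "'a::euclidean_space \<Rightarrow> 'b::real_normed_vector"
  assumes "continuous_on UNIV f" "\<And>x. norm x > R \<Longrightarrow> f x = 0"
  obtains M where "M > 0" "\<And>x. norm (f x) \<le> M"
proof -
  have "bounded (f ` cball 0 R)"
    using assms(1) by (intro compact_imp_bounded compact_continuous_image) (auto intro: continuous_on_subset)
  then obtain M where M: "M > 0" "\<forall>x\<in>cball 0 R. norm (f x) \<le> M" unfolding bounded_pos by auto
  then have "norm (f x) \<le> M" for x using assms(2)[of x] by (cases "norm x \<le> R") auto
  with M(1) show ?thesis using that by blast
qed

lemma tensor_bumps_bounded:
  fixes f :: "'a::euclidean_space \<Rightarrow> real"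
  assumes "f \<in> tensor_bumps a"
  obtains M where "M > 0" "\<And>x. \<bar>f x\<bar> \<le> M"
proof -
  obtain M where "M > 0" "\<And>x. norm (f x) \<le> M"
    by (rule compact_support_bounded[OF tensor_bumps_continuous[OF assms], of "DIM('a) * a"])
       (auto intro!: tensor_bumps_support[OF assms])
  then show ?thesis using that by auto
qed

lemma compact_support_integrable:
  fixes f :: "'a::euclidean_space \<Rightarrow> 'b::euclidean_space"
  assumes "continuous_on UNIV f" "\<And>x. x \<notin> C \<Longrightarrow> f x = 0" "compact C"
  shows "integrable lborel f"
proof -
  have "set_integrable lborel C f"
    unfolding set_integrable_def
    using assms by (intro borel_integrable_compact) (auto intro: continuous_on_subset)
  moreover have "(\<lambda>x. indicator C x *\<^sub>R f x) = f" using assms(2) by (auto simp: indicator_def)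
  ultimately show ?thesis by (simp add: set_integrable_def)
qed

text \<open>The product bump is nonnegative, continuous and nonzero at 0, so the open set where it
  is nonzero is not null and its integral can be normalised to 1.\<close>

lemma mollifier_exists:
  assumes "a > 0"
  obtains \<rho> :: "'a::euclidean_space \<Rightarrow> real" where "\<rho> \<in> tensor_bumps a" "\<And>x. \<rho> x \<ge> 0"
    "integrable lborel \<rho>" "integral\<^sup>L lborel \<rho> = 1"
proof -
  define b where "b t = flat_exp 0 (a - t) * flat_exp 0 (a + t)" for t
  define g where "g x = 1 * (\<Prod>i\<in>Basis. b (x \<bullet> i))" for x :: 'a
  have bb: "b \<in> bumps a" unfolding b_def[abs_def] by (rule bumps.base)
  have g: "g \<in> tensor_bumps a"
    unfolding tensor_bumps_def g_def[abs_def] using bb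
    by (auto intro!: exI[of _ 1] exI[of _ "\<lambda>_. b"])
  have b0: "b t \<ge> 0" for t by (auto simp: b_def flat_exp_def)
  have g0: "g x \<ge> 0" for x by (auto simp: g_def b0 intro!: prod_nonneg)
  have int: "integrable lborel g"
    by (rule compact_support_integrable[OF tensor_bumps_continuous[OF g], of "cball 0 (real DIM('a) * a)"])
       (auto intro!: tensor_bumps_support[OF g])
  have "integral\<^sup>L lborel g \<noteq> 0"
  proof
    assume "integral\<^sup>L lborel g = 0"
    then have ae: "AE x in lborel. g x = 0"
      using integral_nonneg_eq_0_iff_AE[OF int] g0 by auto
    have op: "open {x. g x \<noteq> 0}"
      by (rule open_Collect_neq) (auto intro: tensor_bumps_continuous[OF g])
    have "{x. g x \<noteq> 0} \<in> null_sets lborel"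
      using ae borel_open[OF \<open>open {x. g x \<noteq> 0}\<close>] by (auto simp: AE_iff_null_sets[of "{x. g x \<noteq> 0}"])
    then have "negligible {x. g x \<noteq> 0}"
      by (simp add: negligible_iff_null_sets null_sets_completionI)
    then have "{x. g x \<noteq> 0} = {}" using op open_not_negligible by blast
    moreover have "g 0 \<noteq> 0" using assms by (simp add: g_def b_def flat_exp_def)
    ultimately show False by blast
  qed
  then have pos: "integral\<^sup>L lborel g > 0"
    using integral_nonneg_AE[of g lborel] g0 by (auto simp: less_le)
  show ?thesis
    by (rule that[of "\<lambda>x. inverse (integral\<^sup>L lborel g) * g x"])
       (use g g0 int pos in \<open>auto intro!: tensor_bumps_cmult\<close>)
qed

section \<open>Functions with an explicit continuous gradient\<close>

text \<open>The gradient travels as a separate argument instead of as \<open>sgrad f\<close>, so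
  that product and chain rules deliver it as a formula.\<close>

definition C1_grad :: "('a::euclidean_space \<Rightarrow> real) \<Rightarrow> ('a \<Rightarrow> 'a) \<Rightarrow> bool" where
  "C1_grad f D \<longleftrightarrow> (\<forall>x. (f has_derivative (\<lambda>h. D x \<bullet> h)) (at x)) \<and> continuous_on UNIV D"

lemma C1_gradD: "C1_grad f D \<Longrightarrow> (f has_derivative (\<lambda>h. D x \<bullet> h)) (at x within S)"
  by (simp add: C1_grad_def has_derivative_at_withinI)

lemma C1_grad_line:
  assumes "C1_grad f D"
  shows "((\<lambda>t. f (x + t *\<^sub>R v)) has_real_derivative D (x + t *\<^sub>R v) \<bullet> v) (at t within T)"
proof -
  have "((\<lambda>t. x + t *\<^sub>R v) has_derivative (\<lambda>h. h *\<^sub>R v)) (at t within T)"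
    by (auto intro!: derivative_eq_intros)
  from has_derivative_compose[OF this C1_gradD[OF assms, where S=UNIV]]
  show ?thesis by (simp add: has_field_derivative_def mult_commute_abs)
qed

lemma C1_grad_partial: "C1_grad f D \<Longrightarrow> partial f i x = D x \<bullet> i"
  using C1_grad_line[of f D x i 0 UNIV] by (simp add: partial_def DERIV_imp_deriv)

lemma C1_grad_sgrad: "C1_grad f D \<Longrightarrow> sgrad f x = D x"
  by (simp add: sgrad_def C1_grad_partial euclidean_representation)

lemma C1_grad_continuous: "C1_grad f D \<Longrightarrow> continuous_on S f"
  by (rule has_derivative_continuous_on[OF C1_gradD])

lemma tensor_bumps_C1_grad:
  assumes "f \<in> tensor_bumps a"
  obtains D where "C1_grad f D" "\<And>i. i \<in> Basis \<Longrightarrow> (\<lambda>x. D x \<bullet> i) \<in> tensor_bumps a"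
proof -
  obtain D where D: "\<And>i. i \<in> Basis \<Longrightarrow> (\<lambda>x. D x \<bullet> i) \<in> tensor_bumps a"
    "\<And>x. (f has_derivative (\<lambda>h. D x \<bullet> h)) (at x)" using tensor_bumps_grad[OF assms] by metis
  have "continuous_on UNIV (\<lambda>x. \<Sum>i\<in>Basis. (D x \<bullet> i) *\<^sub>R i)"
    by (intro continuous_intros tensor_bumps_continuous[OF D(1)])
  then have "continuous_on UNIV D" by (simp add: euclidean_representation)
  with D show ?thesis using that by (auto simp: C1_grad_def)
qed

lemma smooth_funI:
  assumes "f \<in> F" "\<And>g. g \<in> F \<Longrightarrow> \<exists>D. C1_grad g D \<and> (\<forall>i\<in>Basis. (\<lambda>x. D x \<bullet> i) \<in> F)"
  shows "smooth_fun f"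
  unfolding smooth_fun_def
proof (intro exI[of _ F] conjI ballI allI)
  fix g and i :: 'a assume "g \<in> F" and i: "i \<in> Basis"
  then obtain D where D: "C1_grad g D" "\<forall>i\<in>Basis. (\<lambda>x. D x \<bullet> i) \<in> F" using assms by blast
  show "(\<lambda>t. g (x + t *\<^sub>R i)) differentiable at 0" for x
    using C1_grad_line[OF D(1), of x i 0 UNIV] real_differentiable_def by blast
  show "partial g i \<in> F" using D i by (simp add: C1_grad_partial[OF D(1), abs_def])
next
  fix g assume "g \<in> F" then show "continuous_on UNIV g" using assms C1_grad_continuous by blast
qed (fact assms)

lemma test_funI:
  assumes "smooth_fun f" "\<And>x. x \<notin> C \<Longrightarrow> f x = 0" "compact C" "C \<subseteq> U"
  shows "test_fun U f"
proof -
  have "closure {x. f x \<noteq> 0} \<subseteq> C"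
    using assms by (intro closure_minimal) (auto simp: compact_imp_closed)
  moreover from this have "compact (closure {x. f x \<noteq> 0})"
    using assms(3) compact_Int_closed[OF assms(3) closed_closure] by (metis inf.absorb_iff2)
  ultimately show ?thesis using assms unfolding test_fun_def by blast
qed

lemma C1_grad_mean_value:
  assumes "C1_grad f D"
  obtains t where "0 < t" "t < 1" "f (x + h) - f x = D (x + t *\<^sub>R h) \<bullet> h"
  using MVT2[of 0 1 "\<lambda>t. f (x + t *\<^sub>R h)" "\<lambda>t. D (x + t *\<^sub>R h) \<bullet> h"] C1_grad_line[OF assms, of x h _ UNIV] by auto

lemma bounded_components:
  fixes D :: "'b \<Rightarrow> 'a::euclidean_space"
  assumes "\<And>i. i \<in> Basis \<Longrightarrow> \<exists>M. \<forall>x. \<bar>D x \<bullet> i\<bar> \<le> M"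
  obtains M where "M > 0" "\<And>x. norm (D x) \<le> M"
proof -
  obtain M where M: "\<And>i x. i \<in> Basis \<Longrightarrow> \<bar>D x \<bullet> i\<bar> \<le> M i" using assms by metis
  have "norm (D x) \<le> (\<Sum>i\<in>Basis. M i)" for x
    using norm_le_l1[of "D x"] sum_mono[of Basis "\<lambda>i. \<bar>D x \<bullet> i\<bar>" M] M by fastforce
  then have "norm (D x) \<le> max 1 (\<Sum>i\<in>Basis. M i)" for x by (meson max.coboundedI2)
  then show ?thesis using that[of "max 1 (\<Sum>i\<in>Basis. M i)"] by auto
qed

lemma tensor_bumps_Lipschitz:
  fixes f :: "'a::euclidean_space \<Rightarrow> real"
  assumes "f \<in> tensor_bumps a"
  obtains L where "L > 0" "\<And>x h. \<bar>f (x + h) - f x\<bar> \<le> L * norm h"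
proof -
  obtain D where D: "C1_grad f D" "\<And>i. i \<in> Basis \<Longrightarrow> (\<lambda>x. D x \<bullet> i) \<in> tensor_bumps a"
    using tensor_bumps_C1_grad[OF assms] by metis
  obtain M where M: "M > 0" "\<And>x. norm (D x) \<le> M"
  proof (rule bounded_components[of D])
    show "\<exists>M. \<forall>x. \<bar>D x \<bullet> i\<bar> \<le> M" if "i \<in> Basis" for i
      using tensor_bumps_bounded[OF D(2)[OF that]] by blast
  qed auto
  have "\<bar>f (x + h) - f x\<bar> \<le> M * norm h" for x h
  proof -
    obtain t where "f (x + h) - f x = D (x + t *\<^sub>R h) \<bullet> h" using C1_grad_mean_value[OF D(1)] by metis
    then show ?thesis
      by (metis Cauchy_Schwarz_ineq2 M(2) mult_right_mono norm_ge_zero order_trans)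
  qed
  then show ?thesis using M that by blast
qed

text \<open>The components of D are bumps and hence Lipschitz; the mean value theorem turns this
  into a second order remainder that is uniform in the base point. Uniformity is what allows
  differentiation under a convolution integral.\<close>

lemma tensor_bumps_taylor:
  fixes f :: "'a::euclidean_space \<Rightarrow> real"
  assumes "C1_grad f D" "\<And>i. i \<in> Basis \<Longrightarrow> (\<lambda>x. D x \<bullet> i) \<in> tensor_bumps a"
  obtains L where "L > 0" "\<And>x h. \<bar>f (x + h) - f x - D x \<bullet> h\<bar> \<le> L * norm h ^ 2"
proof -
  have "\<exists>L. L > 0 \<and> (\<forall>x h. \<bar>D (x + h) \<bullet> i - D x \<bullet> i\<bar> \<le> L * norm h)" if "i \<in> Basis" for i
    using tensor_bumps_Lipschitz[OF assms(2)[OF that]] by metis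
  then obtain L where L: "\<And>i. i \<in> Basis \<Longrightarrow> L i > 0"
     "\<And>i x h. i \<in> Basis \<Longrightarrow> \<bar>D (x + h) \<bullet> i - D x \<bullet> i\<bar> \<le> L i * norm h" by metis
  define S where "S = (\<Sum>i\<in>Basis. L i)"
  have S: "S > 0" unfolding S_def using L(1) by (intro sum_pos) auto
  have DL: "norm (D (x + h) - D x) \<le> S * norm h" for x h
  proof -
    have "norm (D (x + h) - D x) \<le> (\<Sum>i\<in>Basis. \<bar>(D (x + h) - D x) \<bullet> i\<bar>)" by (rule norm_le_l1)
    also have "\<dots> \<le> (\<Sum>i\<in>Basis. L i * norm h)" using L(2) by (intro sum_mono) (auto simp: inner_diff_left)
    finally show ?thesis by (simp add: S_def sum_distrib_right)
  qed
  have "\<bar>f (x + h) - f x - D x \<bullet> h\<bar> \<le> S * norm h ^ 2" for x h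
  proof -
    obtain t where t: "0 < t" "t < 1" "f (x + h) - f x = D (x + t *\<^sub>R h) \<bullet> h" using C1_grad_mean_value[OF assms(1)] by metis
    have "\<bar>f (x + h) - f x - D x \<bullet> h\<bar> = \<bar>(D (x + t *\<^sub>R h) - D x) \<bullet> h\<bar>" using t by (simp add: inner_diff_left)
    also have "\<dots> \<le> norm (D (x + t *\<^sub>R h) - D x) * norm h" by (rule Cauchy_Schwarz_ineq2)
    also have "\<dots> \<le> (S * norm (t *\<^sub>R h)) * norm h" by (intro mult_right_mono DL) auto
    also have "\<dots> \<le> (S * norm h) * norm h" using t S by (intro mult_right_mono mult_left_mono) (auto simp: mult_left_le_one_le)
    finally show ?thesis by (simp add: power2_eq_square)
  qed
  then show ?thesis using S that by blast
qed

section \<open>Convolution with a bump\<close>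

definition conv :: "('a::euclidean_space \<Rightarrow> real) \<Rightarrow> ('a \<Rightarrow> 'b::euclidean_space) \<Rightarrow> 'a \<Rightarrow> 'b" where
  "conv g f x = (\<integral>y. g (x - y) *\<^sub>R f y \<partial>lborel)"

lemma conv_integrable:
  fixes f :: "'a::euclidean_space \<Rightarrow> 'b::euclidean_space"
  assumes "continuous_on UNIV g" "\<And>x. \<bar>g x\<bar> \<le> M" "integrable lborel f"
  shows "integrable lborel (\<lambda>y. g (x - y) *\<^sub>R f y)"
proof (rule Bochner_Integration.integrable_bound[of _ "\<lambda>y. M * norm (f y)"])
  have "continuous_on UNIV (\<lambda>y. g (x - y))"
    by (rule continuous_on_compose2[OF assms(1)]) (auto intro!: continuous_intros)
  then have "(\<lambda>y. g (x - y)) \<in> borel_measurable borel" by (rule borel_measurable_continuous_onI)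
  then show "(\<lambda>y. g (x - y) *\<^sub>R f y) \<in> borel_measurable lborel"
    using assms(3) by (intro borel_measurable_scaleR) auto
  show "AE y in lborel. norm (g (x - y) *\<^sub>R f y) \<le> norm (M * norm (f y))"
  proof (rule AE_I2)
    fix y
    have "norm (g (x - y) *\<^sub>R f y) \<le> M * norm (f y)" using assms(2) by (simp add: mult_right_mono)
    then show "norm (g (x - y) *\<^sub>R f y) \<le> norm (M * norm (f y))" by simp
  qed
qed (use assms in auto)

lemma conv_tensor_bumps_integrable:
  fixes f :: "'a::euclidean_space \<Rightarrow> 'b::euclidean_space"
  assumes "g \<in> tensor_bumps a" "integrable lborel f"
  shows "integrable lborel (\<lambda>y. g (x - y) *\<^sub>R f y)"
proof -
  obtain M where "\<And>x. \<bar>g x\<bar> \<le> M" using tensor_bumps_bounded[OF assms(1)] by blast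
  then show ?thesis by (rule conv_integrable[OF tensor_bumps_continuous[OF assms(1)] _ assms(2)])
qed

text \<open>The uniform Taylor remainder can be integrated against |f|, so the error of the
  linearisation is at most L |h|^2 times the L^1 norm of f; no limit has to be exchanged with the
  integral.\<close>

lemma conv_has_derivative:
  fixes f :: "'a::euclidean_space \<Rightarrow> real"
  assumes g: "g \<in> tensor_bumps a" and D: "C1_grad g D" "\<And>i. i \<in> Basis \<Longrightarrow> (\<lambda>x. D x \<bullet> i) \<in> tensor_bumps a"
    and f: "integrable lborel f"
  shows "(conv g f has_derivative (\<lambda>h. (\<Sum>i\<in>Basis. conv (\<lambda>x. D x \<bullet> i) f x *\<^sub>R i) \<bullet> h)) (at x)"
proof -
  obtain L where L: "L > 0" "\<And>x h. \<bar>g (x + h) - g x - D x \<bullet> h\<bar> \<le> L * norm h ^ 2"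
    using tensor_bumps_taylor[OF D] by metis
  define I where "I = (\<integral>y. \<bar>f y\<bar> \<partial>lborel)"
  have I0: "I \<ge> 0" by (simp add: I_def)
  let ?D = "\<Sum>i\<in>Basis. conv (\<lambda>x. D x \<bullet> i) f x *\<^sub>R i"
  have Di: "integrable lborel (\<lambda>y. (D (x - y) \<bullet> i) *\<^sub>R f y)" if "i \<in> Basis" for i
    using conv_tensor_bumps_integrable[OF D(2)[OF that] f] .
  have lin: "?D \<bullet> h = (\<integral>y. (D (x - y) \<bullet> h) * f y \<partial>lborel)" and lini: "integrable lborel (\<lambda>y. (D (x - y) \<bullet> h) * f y)" for h
  proof -
    have eq: "(D (x - y) \<bullet> h) * f y = (\<Sum>i\<in>Basis. (h \<bullet> i) * ((D (x - y) \<bullet> i) *\<^sub>R f y))" for y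
      by (subst euclidean_inner[of "D (x - y)" h]) (simp add: sum_distrib_left mult_ac)
    show "integrable lborel (\<lambda>y. (D (x - y) \<bullet> h) * f y)" unfolding eq using Di by auto
    show "?D \<bullet> h = (\<integral>y. (D (x - y) \<bullet> h) * f y \<partial>lborel)"
      unfolding eq inner_sum_left using Di
      by (simp add: conv_def inner_commute[of _ h] mult.commute[of _ "h \<bullet> _"])
  qed
  have est: "norm (conv g f (x + h) - conv g f x - ?D \<bullet> h) \<le> L * I * norm h ^ 2" for h
  proof -
    have "conv g f (x + h) - conv g f x - ?D \<bullet> h =
       (\<integral>y. (g (x + h - y) - g (x - y) - D (x - y) \<bullet> h) * f y \<partial>lborel)"
      using conv_tensor_bumps_integrable[OF g f] lini
      unfolding lin conv_def[of g] by (simp add: left_diff_distrib)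
    also have "norm \<dots> \<le> (\<integral>y. (L * norm h ^ 2) * \<bar>f y\<bar> \<partial>lborel)"
    proof (rule order_trans[OF integral_norm_bound integral_mono])
      have "integrable lborel (\<lambda>y. (g (x + h - y) - g (x - y) - D (x - y) \<bullet> h) * f y)"
        using conv_tensor_bumps_integrable[OF g f] lini by (simp add: left_diff_distrib)
      then show "integrable lborel (\<lambda>y. norm ((g (x + h - y) - g (x - y) - D (x - y) \<bullet> h) * f y))"
        by (rule integrable_norm)
      show "norm ((g (x + h - y) - g (x - y) - D (x - y) \<bullet> h) * f y) \<le> (L * norm h ^ 2) * \<bar>f y\<bar>" for y
      proof -
        have eq: "x - y + h = x + h - y" by simp
        have "\<bar>g (x + h - y) - g (x - y) - D (x - y) \<bullet> h\<bar> \<le> L * norm h ^ 2"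
          using L(2)[of "x - y" h] unfolding eq .
        then show ?thesis by (simp add: abs_mult mult_right_mono)
      qed
    qed (use f in auto)
    finally show ?thesis by (simp add: I_def mult_ac)
  qed
  show ?thesis
    unfolding has_derivative_def
  proof (intro conjI bounded_linear_inner_right)
    show "((\<lambda>y. (conv g f y - conv g f (netlimit (at x)) - ?D \<bullet> (y - netlimit (at x))) /\<^sub>R norm (y - netlimit (at x))) \<longlongrightarrow> 0) (at x)"
    proof (rule Lim_null_comparison)
      show "\<forall>\<^sub>F y in at x. norm ((conv g f y - conv g f (netlimit (at x)) - ?D \<bullet> (y - netlimit (at x))) /\<^sub>R norm (y - netlimit (at x)))
          \<le> L * I * norm (y - x)"
      proof (rule always_eventually, rule allI)
        fix y
        have "norm (conv g f y - conv g f x - ?D \<bullet> (y - x)) \<le> L * I * norm (y - x) ^ 2" using est[of "y - x"] by simp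
        then show "norm ((conv g f y - conv g f (netlimit (at x)) - ?D \<bullet> (y - netlimit (at x))) /\<^sub>R norm (y - netlimit (at x)))
          \<le> L * I * norm (y - x)"
          using L(1) I0 by (cases "y = x") (auto simp: field_simps power2_eq_square)
      qed
      have "((\<lambda>y. L * I * norm (y - x)) \<longlongrightarrow> L * I * norm (x - x)) (at x)" by (intro tendsto_intros)
      then show "((\<lambda>y. L * I * norm (y - x)) \<longlongrightarrow> 0) (at x)" by simp
    qed
  qed
qed

lemma conv_continuous:
  fixes f :: "'a::euclidean_space \<Rightarrow> real"
  assumes "g \<in> tensor_bumps a" "integrable lborel f"
  shows "continuous_on UNIV (conv g f)"
proof -
  obtain D where "C1_grad g D" "\<And>i. i \<in> Basis \<Longrightarrow> (\<lambda>x. D x \<bullet> i) \<in> tensor_bumps a"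
    using tensor_bumps_C1_grad[OF assms(1)] by metis
  from has_derivative_continuous[OF conv_has_derivative[OF assms(1) this assms(2)]]
  show ?thesis by (simp add: continuous_at_imp_continuous_on)
qed

lemma conv_C1_grad:
  fixes f :: "'a::euclidean_space \<Rightarrow> real"
  assumes "g \<in> tensor_bumps a" "C1_grad g D" "\<And>i. i \<in> Basis \<Longrightarrow> (\<lambda>x. D x \<bullet> i) \<in> tensor_bumps a"
    and "integrable lborel f"
  shows "C1_grad (conv g f) (\<lambda>x. \<Sum>i\<in>Basis. conv (\<lambda>x. D x \<bullet> i) f x *\<^sub>R i)"
  unfolding C1_grad_def using assms conv_has_derivative[OF assms]
  by (auto intro!: continuous_intros conv_continuous)

text \<open>The derivative falls on the bump, so the convolutions of f with all of
  \<open>tensor_bumps a\<close> form a family closed under partial derivatives.\<close>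

lemma smooth_fun_conv:
  fixes f :: "'a::euclidean_space \<Rightarrow> real"
  assumes "g \<in> tensor_bumps a" "integrable lborel f"
  shows "smooth_fun (conv g f)"
proof (rule smooth_funI[of _ "{conv g f | g. g \<in> tensor_bumps a}"])
  fix k assume "k \<in> {conv g f | g. g \<in> tensor_bumps a}"
  then obtain g where k: "k = conv g f" and g: "g \<in> tensor_bumps a" by auto
  obtain D where D: "C1_grad g D" "\<And>i. i \<in> Basis \<Longrightarrow> (\<lambda>x. D x \<bullet> i) \<in> tensor_bumps a"
    using tensor_bumps_C1_grad[OF g] by metis
  have "(\<Sum>j\<in>Basis. conv (\<lambda>x. D x \<bullet> j) f x *\<^sub>R j) \<bullet> i = conv (\<lambda>x. D x \<bullet> i) f x" if "i \<in> Basis" for i x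
    using that by (simp add: inner_sum_left inner_Basis if_distrib cong: if_cong)
  then show "\<exists>D. C1_grad k D \<and> (\<forall>i\<in>Basis. (\<lambda>x. D x \<bullet> i) \<in> {conv g f | g. g \<in> tensor_bumps a})"
    using conv_C1_grad[OF g D assms(2)] D unfolding k
    by (intro exI[of _ "\<lambda>x. \<Sum>i\<in>Basis. conv (\<lambda>x. D x \<bullet> i) f x *\<^sub>R i"]) fastforce
qed (use assms in auto)

lemma C1_grad_reflect:
  assumes "C1_grad g D"
  shows "C1_grad (\<lambda>y. g (x - y)) (\<lambda>y. - D (x - y))"
  unfolding C1_grad_def
proof (intro conjI allI)
  fix y
  have "((\<lambda>y. x - y) has_derivative (\<lambda>h. - h)) (at y)" by (auto intro!: derivative_eq_intros)
  from has_derivative_compose[OF this C1_gradD[OF assms, where S=UNIV]]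
  show "((\<lambda>y. g (x - y)) has_derivative (\<lambda>h. - D (x - y) \<bullet> h)) (at y)" by simp
next
  have "continuous_on UNIV D" using assms by (simp add: C1_grad_def)
  then have "continuous_on UNIV (\<lambda>y. D (x - y))"
    by (rule continuous_on_compose2) (auto intro!: continuous_intros)
  then show "continuous_on UNIV (\<lambda>y. - D (x - y))" by (intro continuous_intros)
qed

text \<open>Provides the test function that turns the definition of a weak gradient into a statement
  on mollifications. The sign of the reflection is absorbed by scaling with -1.\<close>

lemma test_fun_reflect:
  fixes g :: "'a::euclidean_space \<Rightarrow> real"
  assumes g: "g \<in> tensor_bumps a" and "cball x (real DIM('a) * a) \<subseteq> U"
  shows "test_fun U (\<lambda>y. g (x - y))"
proof -
  have 1: "smooth_fun (\<lambda>y. g (x - y))"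
  proof (rule smooth_funI[of _ "{\<lambda>y. g (x - y) | g. g \<in> tensor_bumps a}"])
    fix k assume "k \<in> {\<lambda>y. g (x - y) | g. g \<in> tensor_bumps a}"
    then obtain g where k: "k = (\<lambda>y. g (x - y))" and g: "g \<in> tensor_bumps a" by auto
    obtain D where D: "C1_grad g D" "\<And>i. i \<in> Basis \<Longrightarrow> (\<lambda>x. D x \<bullet> i) \<in> tensor_bumps a"
      using tensor_bumps_C1_grad[OF g] by metis
    have "(\<lambda>y. - D (x - y) \<bullet> i) \<in> {\<lambda>y. g (x - y) | g. g \<in> tensor_bumps a}" if "i \<in> Basis" for i
      using tensor_bumps_cmult[OF D(2)[OF that], of "-1"] by auto
    then show "\<exists>D. C1_grad k D \<and> (\<forall>i\<in>Basis. (\<lambda>x. D x \<bullet> i) \<in> {\<lambda>y. g (x - y) | g. g \<in> tensor_bumps a})"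
      using C1_grad_reflect[OF D(1)] unfolding k by blast
  qed (use g in auto)
  have 2: "g (x - y) = 0" if "y \<notin> cball x (real DIM('a) * a)" for y
    using that by (intro tensor_bumps_support[OF g]) (auto simp: dist_norm)
  show ?thesis by (rule test_funI[OF 1 2]) (use assms in auto)
qed

lemma conv_support:
  fixes f :: "'a::euclidean_space \<Rightarrow> 'b::euclidean_space"
  assumes "g \<in> tensor_bumps a" "\<And>x. x \<notin> cball x0 R \<Longrightarrow> f x = 0" "x \<notin> cball x0 (R + real DIM('a) * a)"
  shows "conv g f x = 0"
proof -
  have "g (x - y) *\<^sub>R f y = 0" for y
  proof (cases "y \<in> cball x0 R")
    case True
    then have "norm (x - y) \<ge> real DIM('a) * a"
      using assms(3) dist_triangle[of x0 x y] by (auto simp: dist_norm norm_minus_commute)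
    then show ?thesis using tensor_bumps_support[OF assms(1)] by simp
  qed (use assms(2) in auto)
  then show ?thesis unfolding conv_def by (simp only: integral_zero)
qed


section \<open>Approximation in Lp\<close>

lemma nn_integral_lborel_shift:
  fixes f :: "'a::euclidean_space \<Rightarrow> ennreal"
  assumes [measurable]: "f \<in> borel_measurable borel"
  shows "(\<integral>\<^sup>+x. f (t + x) \<partial>lborel) = (\<integral>\<^sup>+x. f x \<partial>lborel)"
  by (subst (2) lborel_distr_plus[of t, symmetric]) (simp add: nn_integral_distr)

lemma nn_integral_lborel_reflect:
  fixes f :: "'a::euclidean_space \<Rightarrow> ennreal"
  assumes [measurable]: "f \<in> borel_measurable borel"
  shows "(\<integral>\<^sup>+x. f (t - x) \<partial>lborel) = (\<integral>\<^sup>+x. f x \<partial>lborel)"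
  by (subst (2) lborel_affine[of "-1" t])
     (simp_all add: nn_integral_density nn_integral_distr)

text \<open>Bounding both summands by the larger one costs 2^p, but it keeps L^p estimates on the
  level of p-th powers, free of roots.\<close>

lemma powr_add_le_two_powr:
  fixes a b p :: real
  assumes "a \<ge> 0" "b \<ge> 0" "p > 0"
  shows "(a + b) powr p \<le> 2 powr p * (a powr p + b powr p)"
proof -
  have "(a + b) powr p \<le> (2 * max a b) powr p" using assms by (intro powr_mono2) auto
  also have "\<dots> = 2 powr p * max a b powr p" using assms by (simp add: powr_mult)
  also have "max a b powr p \<le> a powr p + b powr p" by (simp add: max_def)
  finally show ?thesis by (simp add: mult_left_mono)
qed

text \<open>The \<open>p\<close>-th power of the norm, not the norm itself.\<close>
definition Lpn :: "real \<Rightarrow> ('a::euclidean_space \<Rightarrow> 'b::euclidean_space) \<Rightarrow> ennreal" where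
  "Lpn p f = (\<integral>\<^sup>+x. ennreal (norm (f x) powr p) \<partial>lborel)"

lemma Lpn_mono:
  assumes "\<And>x. norm (f x) \<le> norm (g x)" "p > 0"
  shows "Lpn p f \<le> Lpn p g"
  unfolding Lpn_def using assms by (intro nn_integral_mono ennreal_leI powr_mono2) auto

lemma Lpn_add:
  fixes f g :: "'a::euclidean_space \<Rightarrow> 'b::euclidean_space"
  assumes [measurable]: "f \<in> borel_measurable borel" "g \<in> borel_measurable borel" and p: "p > 0"
  shows "Lpn p (\<lambda>x. f x + g x) \<le> ennreal (2 powr p) * (Lpn p f + Lpn p g)"
proof -
  have "Lpn p (\<lambda>x. f x + g x) \<le> (\<integral>\<^sup>+x. ennreal (2 powr p) * (ennreal (norm (f x) powr p) + ennreal (norm (g x) powr p)) \<partial>lborel)"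
    unfolding Lpn_def
  proof (intro nn_integral_mono)
    fix x
    have "norm (f x + g x) powr p \<le> (norm (f x) + norm (g x)) powr p"
      using p by (intro powr_mono2 norm_triangle_ineq) auto
    also have "\<dots> \<le> 2 powr p * (norm (f x) powr p + norm (g x) powr p)"
      using p by (intro powr_add_le_two_powr) auto
    finally have "ennreal (norm (f x + g x) powr p) \<le> ennreal (2 powr p * (norm (f x) powr p + norm (g x) powr p))"
      by (rule ennreal_leI)
    then show "ennreal (norm (f x + g x) powr p) \<le> ennreal (2 powr p) * (ennreal (norm (f x) powr p) + ennreal (norm (g x) powr p))"
      by (simp add: ennreal_mult')
  qed
  also have "\<dots> = ennreal (2 powr p) * (Lpn p f + Lpn p g)"
    unfolding Lpn_def by (subst nn_integral_cmult) (auto simp: nn_integral_add)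
  finally show ?thesis .
qed

lemma Lpn_diff_trans:
  fixes f g h :: "'a::euclidean_space \<Rightarrow> 'b::euclidean_space"
  assumes [measurable]: "f \<in> borel_measurable borel" "g \<in> borel_measurable borel" "h \<in> borel_measurable borel" and p: "p > 0"
  shows "Lpn p (\<lambda>x. f x - h x) \<le> ennreal (2 powr p) * (Lpn p (\<lambda>x. f x - g x) + Lpn p (\<lambda>x. g x - h x))"
  using Lpn_add[of "\<lambda>x. f x - g x" "\<lambda>x. g x - h x" p] p by simp

lemma Lpn_scale:
  fixes f :: "'a::euclidean_space \<Rightarrow> 'b::euclidean_space"
  assumes [measurable]: "f \<in> borel_measurable borel"
  shows "Lpn p (\<lambda>x. c *\<^sub>R f x) = ennreal (\<bar>c\<bar> powr p) * Lpn p f"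
  unfolding Lpn_def by (subst nn_integral_cmult[symmetric]) (auto simp: powr_mult ennreal_mult)

lemma Lpn_bound_on:
  fixes f :: "'a::euclidean_space \<Rightarrow> 'b::euclidean_space"
  assumes "\<And>x. norm (f x) \<le> M" "\<And>x. x \<notin> cball x0 R \<Longrightarrow> f x = 0" "p > 0"
  shows "Lpn p f \<le> ennreal (M powr p) * emeasure lborel (cball x0 R)"
proof -
  have "Lpn p f \<le> (\<integral>\<^sup>+x. ennreal (M powr p) * indicator (cball x0 R) x \<partial>lborel)"
    unfolding Lpn_def
  proof (intro nn_integral_mono)
    fix x show "ennreal (norm (f x) powr p) \<le> ennreal (M powr p) * indicator (cball x0 R) x"
      using assms(1)[of x] assms(2)[of x] assms(3)
      by (cases "x \<in> cball x0 R") (auto intro!: ennreal_leI powr_mono2)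
  qed
  then show ?thesis by (simp add: nn_integral_cmult_indicator)
qed

lemma Lpn_dominated:
  fixes f :: "nat \<Rightarrow> 'a::euclidean_space \<Rightarrow> 'b::euclidean_space"
  assumes [measurable]: "\<And>n. f n \<in> borel_measurable borel" "g \<in> borel_measurable borel"
    and "\<And>n x. norm (f n x) \<le> norm (g x :: 'c::euclidean_space)" "Lpn p g < \<infinity>" "AE x in lborel. (\<lambda>n. f n x) \<longlonglongrightarrow> 0" "p > 0"
  shows "(\<lambda>n. Lpn p (f n)) \<longlonglongrightarrow> 0"
proof -
  have "(\<lambda>n. \<integral>\<^sup>+x. ennreal (norm (f n x) powr p) \<partial>lborel) \<longlonglongrightarrow> (\<integral>\<^sup>+x. 0 \<partial>(lborel :: 'a measure))"
  proof (rule nn_integral_dominated_convergence[where w = "\<lambda>x. ennreal (norm (g x) powr p)"])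
    show "AE x in lborel. ennreal (norm (f n x) powr p) \<le> ennreal (norm (g x) powr p)" for n
      using assms by (intro AE_I2 ennreal_leI powr_mono2) auto
    show "AE x in lborel. (\<lambda>n. ennreal (norm (f n x) powr p)) \<longlonglongrightarrow> 0"
      using assms(5)
    proof eventually_elim
      fix x assume "(\<lambda>n. f n x) \<longlonglongrightarrow> 0"
      then have "(\<lambda>n. norm (f n x) powr p) \<longlonglongrightarrow> 0 powr p"
        using assms(6) by (intro tendsto_powr' tendsto_const) (auto intro: tendsto_norm_zero)
      then have "(\<lambda>n. norm (f n x) powr p) \<longlonglongrightarrow> 0" by simp
      then show "(\<lambda>n. ennreal (norm (f n x) powr p)) \<longlonglongrightarrow> 0"
        using tendsto_ennrealI by fastforce
    qed
  qed (use assms(4) in \<open>auto simp: Lpn_def\<close>)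
  then show ?thesis by (simp add: Lpn_def)
qed

section \<open>Density of continuous functions in L^p\<close>

lemma eventually_small_ennreal:
  assumes "(X :: nat \<Rightarrow> ennreal) \<longlonglongrightarrow> 0" "(e::real) > 0"
  obtains n where "X n < ennreal e"
proof -
  have "\<forall>\<^sub>F n in sequentially. X n < ennreal e"
    using assms by (intro order_tendstoD(2)[OF assms(1)]) auto
  then show ?thesis using that by (auto simp: eventually_sequentially)
qed

text \<open>Radial retraction onto the closed ball of radius M. Dividing by
  \<open>max M (norm y)\<close> gives one formula for both regimes, continuous because the
  denominator is at least M > 0.\<close>

definition clampn :: "real \<Rightarrow> 'b::euclidean_space \<Rightarrow> 'b" where
  "clampn M y = (M / max M (norm y)) *\<^sub>R y"

lemma clampn_norm: "M > 0 \<Longrightarrow> norm (clampn M y) \<le> M"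
  by (auto simp: clampn_def max_def field_simps)

lemma clampn_id: "M > 0 \<Longrightarrow> norm y \<le> M \<Longrightarrow> clampn M y = y"
  by (auto simp: clampn_def max_def)

lemma clampn_diff: "M > 0 \<Longrightarrow> norm (clampn M y - y) \<le> norm y"
proof -
  assume M: "M > 0"
  have "clampn M y - y = (M / max M (norm y) - 1) *\<^sub>R y" by (simp add: clampn_def scaleR_left_diff_distrib)
  moreover have "0 \<le> M / max M (norm y)" "M / max M (norm y) \<le> 1" using M by (auto simp: divide_le_eq)
  then have "\<bar>M / max M (norm y) - 1\<bar> \<le> 1" by linarith
  ultimately show ?thesis by (simp add: mult_left_le_one_le)
qed

lemma continuous_clampn: "M > 0 \<Longrightarrow> continuous_on UNIV (clampn M)"
  unfolding clampn_def[abs_def] by (intro continuous_intros) (auto simp: max_def)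

lemma clampn_measurable: "M > 0 \<Longrightarrow> clampn M \<in> borel_measurable borel"
  by (rule borel_measurable_continuous_onI[OF continuous_clampn])

text \<open>Two dominated limits: clamping f at growing heights makes it bounded, and a bounded
  measurable function is an a.e. limit of continuous ones. The radius grows by 1 to leave room for a
  cutoff that equals 1 on the ball carrying f.\<close>

lemma Lp_continuous_approx:
  fixes f :: "'a::euclidean_space \<Rightarrow> 'b::euclidean_space"
  assumes f[measurable]: "f \<in> borel_measurable borel" and fin: "Lpn p f < \<infinity>"
    and supp: "\<And>x. x \<notin> cball x0 R \<Longrightarrow> f x = 0" and p: "p > 0" and e: "e > 0"
  obtains g where "continuous_on UNIV g" "\<And>x. x \<notin> cball x0 (R + 1) \<Longrightarrow> g x = 0" "Lpn p (\<lambda>x. f x - g x) < ennreal e"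
proof -
  \<comment> \<open>Dividing by 2 * 2^p pays for the quasi-triangle inequality of \<open>Lpn\<close>
    applied to two errors.\<close>
  define e' where "e' = e / (2 * 2 powr p)"
  have e': "e' > 0" using e by (simp add: e'_def)
  have "(\<lambda>n. Lpn p (\<lambda>x. f x - clampn (real (Suc n)) (f x))) \<longlonglongrightarrow> 0"
  proof (rule Lpn_dominated[where g = f])
    show "(\<lambda>x. f x - clampn (real (Suc n)) (f x)) \<in> borel_measurable borel" for n
      using measurable_compose[OF f clampn_measurable[of "real (Suc n)"]] by auto
    show "norm (f x - clampn (real (Suc n)) (f x)) \<le> norm (f x)" for n x
      using clampn_diff[of "real (Suc n)" "f x"] by (simp add: norm_minus_commute)
    show "AE x in lborel. (\<lambda>n. f x - clampn (real (Suc n)) (f x)) \<longlonglongrightarrow> 0"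
    proof (rule AE_I2, rule tendsto_eventually)
      fix x
      obtain m where "norm (f x) \<le> real m" using real_arch_simple by blast
      then show "\<forall>\<^sub>F n in sequentially. f x - clampn (real (Suc n)) (f x) = 0"
        by (intro eventually_sequentiallyI[of m]) (auto simp: clampn_id)
    qed
  qed (use fin p in auto)
  from eventually_small_ennreal[OF this e']
  obtain n where n: "Lpn p (\<lambda>x. f x - clampn (real (Suc n)) (f x)) < ennreal e'" .
  define M where "M = real (Suc n)"
  have M: "M > 0" by (simp add: M_def)
  note cm = measurable_compose[OF f clampn_measurable[OF M]]
  have "f measurable_on UNIV" by (subst measurable_on_iff_borel_measurable) (auto simp: lebesgue_on_UNIV_eq measurable_completion)
  then obtain N g where N: "negligible N" and g: "\<And>n. continuous_on UNIV (g n)"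
    and gl: "\<And>x. x \<notin> N \<Longrightarrow> (\<lambda>n. g n x) \<longlonglongrightarrow> f x"
    unfolding measurable_on_def by auto
  define ch where "ch x = max 0 (min 1 (R + 1 - dist x0 x))" for x
  have chc: "continuous_on UNIV ch" unfolding ch_def[abs_def] by (intro continuous_intros)
  define k where "k n x = ch x *\<^sub>R clampn M (g n x)" for n x
  have kc: "continuous_on UNIV (k n)" for n
    unfolding k_def[abs_def] by (intro continuous_intros chc continuous_on_compose2[OF continuous_clampn[OF M] g]) auto
  have ks: "k n x = 0" if "x \<notin> cball x0 (R + 1)" for n x using that by (simp add: k_def ch_def)
  have ch01: "0 \<le> ch x" "ch x \<le> 1" for x by (auto simp: ch_def)
  have kM: "norm (k n x) \<le> M" for n x
    using ch01[of x] mult_mono[of "ch x" 1 "norm (clampn M (g n x))" M] clampn_norm[OF M, of "g n x"] by (simp add: k_def)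
  have "(\<lambda>n. Lpn p (\<lambda>x. clampn M (f x) - k n x)) \<longlonglongrightarrow> 0"
  proof (rule Lpn_dominated[where g = "\<lambda>x. (2 * M) *\<^sub>R indicat_real (cball x0 (R + 1)) x"])
    show "(\<lambda>x. clampn M (f x) - k n x) \<in> borel_measurable borel" for n
      using cm borel_measurable_continuous_onI[OF kc] by auto
    show "norm (clampn M (f x) - k n x) \<le> norm ((2 * M) *\<^sub>R indicat_real (cball x0 (R + 1)) x)" for n x
    proof (cases "x \<in> cball x0 (R + 1)")
      case True
      have "norm (clampn M (f x) - k n x) \<le> M + M"
        using norm_triangle_ineq4[of "clampn M (f x)" "k n x"] clampn_norm[OF M, of "f x"] kM[of n x] by linarith
      then show ?thesis using True M by simp
    next
      case False
      then have "f x = 0" by (intro supp) auto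
      then show ?thesis using False ks by (simp add: clampn_def)
    qed
    have "Lpn p (\<lambda>x. (2 * M) *\<^sub>R indicat_real (cball x0 (R + 1)) x) \<le> ennreal ((2 * M) powr p) * emeasure lborel (cball x0 (R + 1))"
      using M p by (intro Lpn_bound_on) (auto simp: indicator_def)
    also have "\<dots> < \<infinity>" using emeasure_lborel_cball_finite[of x0 "R + 1"] by (simp add: ennreal_mult_less_top)
    finally show "Lpn p (\<lambda>x. (2 * M) *\<^sub>R indicat_real (cball x0 (R + 1)) x) < \<infinity>" .
    have "AE x in lebesgue. x \<notin> N" using N by (simp add: AE_not_in negligible_iff_null_sets)
    then have "AE x in lebesgue. (\<lambda>n. clampn M (f x) - k n x) \<longlonglongrightarrow> 0"
    proof eventually_elim
      fix x assume x: "x \<notin> N"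
      have "isCont (clampn M) (f x)" using continuous_clampn[OF M, where 'a='b] by (simp add: continuous_on_eq_continuous_at)
      then have "(\<lambda>n. clampn M (g n x)) \<longlonglongrightarrow> clampn M (f x)" using gl[OF x] isCont_tendsto_compose by blast
      then have "(\<lambda>n. clampn M (f x) - k n x) \<longlonglongrightarrow> clampn M (f x) - ch x *\<^sub>R clampn M (f x)"
        unfolding k_def by (intro tendsto_intros)
      moreover have "ch x *\<^sub>R clampn M (f x) = clampn M (f x)"
      proof (cases "x \<in> cball x0 R")
        case True then show ?thesis by (simp add: ch_def)
      next
        case False then show ?thesis using supp by (simp add: clampn_def)
      qed
      ultimately show "(\<lambda>n. clampn M (f x) - k n x) \<longlonglongrightarrow> 0" by simp
    qed
    then show "AE x in lborel. (\<lambda>n. clampn M (f x) - k n x) \<longlonglongrightarrow> 0" by (simp add: AE_completion_iff)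
    show "(\<lambda>x. (2 * M) *\<^sub>R indicat_real (cball x0 (R + 1)) x) \<in> borel_measurable borel"
      by (intro borel_measurable_scaleR borel_measurable_const borel_measurable_indicator) auto
  qed (use p in auto)
  from eventually_small_ennreal[OF this e']
  obtain m where m: "Lpn p (\<lambda>x. clampn M (f x) - k m x) < ennreal e'" .
  have "Lpn p (\<lambda>x. f x - k m x) \<le> ennreal (2 powr p) * (Lpn p (\<lambda>x. f x - clampn M (f x)) + Lpn p (\<lambda>x. clampn M (f x) - k m x))"
    using p cm borel_measurable_continuous_onI[OF kc] by (intro Lpn_diff_trans) auto
  also have "\<dots> < ennreal (2 powr p) * (ennreal e' + ennreal e')"
    using n m unfolding M_def[symmetric] by (intro ennreal_mult_strict_left_mono add_strict_mono) auto
  also have "\<dots> = ennreal e"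
    using e' by (simp add: ennreal_plus[symmetric] ennreal_mult[symmetric] e'_def del: ennreal_plus)
  finally have "Lpn p (\<lambda>x. f x - k m x) < ennreal e" .
  then show ?thesis using that kc ks by blast
qed

section \<open>Jensen's inequality and convergence of mollifications in L^p\<close>

lemma powr_tangent:
  fixes a m p :: real
  assumes "a \<ge> 0" "m \<ge> 0" "p > 1"
  shows "a powr p \<ge> m powr p + p * m powr (p - 1) * (a - m)"
proof (cases "m = 0")
  case False
  then have m: "m > 0" using assms by simp
  show ?thesis
  \<comment> \<open>The value a = 0 is treated by hand because the tangent inequality for convex
    functions is applied on the open half line.\<close>
  proof (cases "a = 0")
    case True
    have "m powr p = m powr (p - 1) * m" using m by (simp add: powr_diff)
    then have "m powr p + p * m powr (p - 1) * (a - m) = (1 - p) * (m powr (p - 1) * m)"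
      by (simp add: True algebra_simps)
    also have "\<dots> \<le> 0" using m assms by (intro mult_nonpos_nonneg) auto
    finally show ?thesis using True by simp
  next
    case False
    then have a: "a > 0" using assms by simp
    have "convex_on {0<..} (\<lambda>x. x powr p)" using assms by (intro powr_convex) auto
    then have "a powr p - m powr p \<ge> (p * m powr (p - 1)) * (a - m)"
      using a m by (intro convex_on_imp_above_tangent[of "{0<..}"]) (auto intro!: derivative_eq_intros simp: interior_open)
    then show ?thesis by simp
  qed
qed (use assms in auto)

text \<open>Integrating the tangent line of t^p at the weighted mean m against w kills the linear
  term. If the right side is infinite there is nothing to show; otherwise t \<le> 1 + t^p makes w
  |F| integrable, so that m is meaningful.\<close>

lemma Jensen_powr:
  fixes F :: "'a \<Rightarrow> 'b::euclidean_space"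
  assumes w: "integrable M w" "\<And>x. w x \<ge> 0" "integral\<^sup>L M w = 1" and F[measurable]: "F \<in> borel_measurable M" and p: "p > 1"
  shows "ennreal (norm (\<integral>x. w x *\<^sub>R F x \<partial>M) powr p) \<le> (\<integral>\<^sup>+x. ennreal (w x * norm (F x) powr p) \<partial>M)"
proof (cases "(\<integral>\<^sup>+x. ennreal (w x * norm (F x) powr p) \<partial>M) < \<infinity>")
  case True
  note [measurable] = borel_measurable_integrable[OF w(1)]
  have ip: "integrable M (\<lambda>x. w x * norm (F x) powr p)"
    using True w by (intro integrableI_nonneg) auto
  have i1: "integrable M (\<lambda>x. w x * norm (F x))"
  proof (rule Bochner_Integration.integrable_bound[OF Bochner_Integration.integrable_add[OF w(1) ip]])
    show "AE x in M. norm (w x * norm (F x)) \<le> norm (w x + w x * norm (F x) powr p)"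
    proof (rule AE_I2)
      fix x
      have "norm (F x) \<le> 1 + norm (F x) powr p"
      proof (cases "norm (F x) \<le> 1")
        case True then show ?thesis by (smt (verit) powr_ge_zero)
      next
        case False
        then have "norm (F x) powr 1 \<le> norm (F x) powr p" using p by (intro powr_mono) auto
        then show ?thesis using False by simp
      qed
      then have "w x * norm (F x) \<le> w x * (1 + norm (F x) powr p)" using w by (intro mult_left_mono)
      then show "norm (w x * norm (F x)) \<le> norm (w x + w x * norm (F x) powr p)"
        using w(2)[of x] by (simp add: algebra_simps)
    qed
  qed auto
  define m where "m = (\<integral>x. w x * norm (F x) \<partial>M)"
  have m0: "m \<ge> 0" unfolding m_def using w by (intro integral_nonneg_AE) auto
  have "norm (\<integral>x. w x *\<^sub>R F x \<partial>M) \<le> m"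
    using integral_norm_bound[of M "\<lambda>x. w x *\<^sub>R F x"] w(2) by (simp add: m_def)
  then have "norm (\<integral>x. w x *\<^sub>R F x \<partial>M) powr p \<le> m powr p" using p by (intro powr_mono2) auto
  also have "m powr p = (\<integral>x. m powr p * w x + p * m powr (p - 1) * (w x * norm (F x) - m * w x) \<partial>M)"
    using w i1 by (simp add: m_def)
  also have "\<dots> \<le> (\<integral>x. w x * norm (F x) powr p \<partial>M)"
  proof (rule integral_mono)
    fix x
    have "w x * (m powr p + p * m powr (p - 1) * (norm (F x) - m)) \<le> w x * norm (F x) powr p"
      using w(2) m0 p by (intro mult_left_mono powr_tangent) auto
    then show "m powr p * w x + p * m powr (p - 1) * (w x * norm (F x) - m * w x) \<le> w x * norm (F x) powr p"
      by (simp add: algebra_simps)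
  qed (use w i1 ip in auto)
  finally have "ennreal (norm (\<integral>x. w x *\<^sub>R F x \<partial>M) powr p) \<le> ennreal (\<integral>x. w x * norm (F x) powr p \<partial>M)"
    by (rule ennreal_leI)
  then show ?thesis using ip w by (simp add: nn_integral_eq_integral)
qed (simp add: not_less top_unique)

lemma Lp_compact_integrable:
  fixes f :: "'a::euclidean_space \<Rightarrow> 'b::euclidean_space"
  assumes [measurable]: "f \<in> borel_measurable borel" and "Lpn p f < \<infinity>" "\<And>x. x \<notin> cball x0 R \<Longrightarrow> f x = 0" "p \<ge> 1"
  shows "integrable lborel f"
proof (rule integrableI_bounded)
  have "(\<integral>\<^sup>+x. ennreal (norm (f x)) \<partial>lborel) \<le> (\<integral>\<^sup>+x. indicator (cball x0 R) x + ennreal (norm (f x) powr p) \<partial>lborel)"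
  proof (rule nn_integral_mono)
    fix x
    show "ennreal (norm (f x)) \<le> indicator (cball x0 R) x + ennreal (norm (f x) powr p)"
    proof (cases "x \<in> cball x0 R")
      case True
      have "norm (f x) \<le> 1 + norm (f x) powr p"
      proof (cases "norm (f x) \<le> 1")
        case True then show ?thesis by (smt (verit) powr_ge_zero)
      next
        case False
        then have "norm (f x) powr 1 \<le> norm (f x) powr p" using assms by (intro powr_mono) auto
        then show ?thesis using False by simp
      qed
      then have "ennreal (norm (f x)) \<le> ennreal (1 + norm (f x) powr p)" by (rule ennreal_leI)
      then show ?thesis using True by simp
    qed (use assms(3) in simp)
  qed
  also have "\<dots> = emeasure lborel (cball x0 R) + Lpn p f"
    by (subst nn_integral_add) (auto simp: Lpn_def intro!: borel_measurable_indicator)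
  also have "\<dots> < \<infinity>" using assms(2) emeasure_lborel_cball_finite[of x0 R] by simp
  finally show "(\<integral>\<^sup>+x. ennreal (norm (f x)) \<partial>lborel) < \<infinity>" .
qed simp

lemma conv_measurable[measurable]:
  fixes f :: "'a::euclidean_space \<Rightarrow> 'b::euclidean_space"
  assumes [measurable]: "g \<in> borel_measurable borel" "f \<in> borel_measurable borel"
  shows "conv g f \<in> borel_measurable borel"
  unfolding conv_def[abs_def] by (rule lborel.borel_measurable_lebesgue_integral[of _ borel, simplified]) measurable

lemma ennreal_add_less_le_mono:
  fixes a b c :: ennreal
  assumes "a < b" "c \<le> d" "d < \<infinity>" shows "a + c < b + d"
proof -
  have "a + c < b + c" using assms by (metis add.commute ennreal_add_left_cancel_less infinity_ennreal_def le_less_trans)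
  then show ?thesis using assms(2) by (meson add_left_mono less_le_trans)
qed

lemma nn_integral_cmult_add3:
  assumes [measurable]: "A \<in> borel_measurable M" "B \<in> borel_measurable M" "C \<in> borel_measurable M"
  shows "(\<integral>\<^sup>+x. c * (A x + B x + C x) \<partial>M) = c * ((\<integral>\<^sup>+x. A x \<partial>M) + (\<integral>\<^sup>+x. B x \<partial>M) + (\<integral>\<^sup>+x. C x \<partial>M))"
  by (simp add: nn_integral_cmult nn_integral_add)

text \<open>The difference f(y) - f(x) is split through a continuous g. Jensen and Tonelli cost the
  distance of f to g twice; the middle term is small by uniform continuity. The threshold d serves
  every mollifier of small enough support, so that one mollifier can treat a function and its
  gradient at once.\<close>

theorem conv_tendsto_Lp:
  fixes f :: "'a::euclidean_space \<Rightarrow> 'b::euclidean_space"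
  assumes f[measurable]: "f \<in> borel_measurable borel" and fin: "Lpn p f < \<infinity>"
    and supp: "\<And>x. x \<notin> cball x0 R \<Longrightarrow> f x = 0" and p: "p > 1" and e: "e > 0"
  obtains d where "d > 0"
    "\<And>a \<rho>. real DIM('a) * a \<le> d \<Longrightarrow> \<rho> \<in> tensor_bumps a \<Longrightarrow> (\<And>x. \<rho> x \<ge> 0) \<Longrightarrow> integral\<^sup>L lborel \<rho> = 1 \<Longrightarrow>
       Lpn p (\<lambda>x. conv \<rho> f x - f x) < ennreal e"
proof -
  have fi: "integrable lborel f" using Lp_compact_integrable[OF f fin supp] p by auto
  \<comment> \<open>Three errors of size e1 enter with the factor 4^p, which leaves 3 e / 4 <
    e.\<close>
  define e1 where "e1 = e / (4 * 4 powr p)"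
  have e1: "e1 > 0" using e by (simp add: e1_def)
  obtain g where gc: "continuous_on UNIV g" and gs: "\<And>x. x \<notin> cball x0 (R + 1) \<Longrightarrow> g x = 0"
    and gf: "Lpn p (\<lambda>x. f x - g x) < ennreal e1"
  proof (rule Lp_continuous_approx[OF f fin supp _ e1])
    show "p > 0" using p by simp
  qed auto
  note [measurable] = borel_measurable_continuous_onI[OF gc]
  define V where "V = measure lborel (cball x0 (R + 2))"
  have V0: "V \<ge> 0" by (simp add: V_def)
  \<comment> \<open>Uniform closeness et on a ball of volume V contributes et^p V \<le> e1; V + 1
    guards against V = 0.\<close>
  define et where "et = (e1 / (V + 1)) powr (1 / p)"
  have et: "et > 0" using e1 V0 by (simp add: et_def)
  have etp: "et powr p * V \<le> e1"
  proof -
    have "et powr p = e1 / (V + 1)" using p e1 V0 by (simp add: et_def powr_powr)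
    then show ?thesis using e1 V0 mult_mono[of e1 e1 V "V + 1"] by (simp add: pos_divide_le_eq)
  qed
  \<comment> \<open>g lives in radius R + 1. If g(y) - g(x) is nonzero with |x - y| < 1, then x is
    within R + 2 and y within R + 3.\<close>
  have "uniformly_continuous_on (cball x0 (R + 3)) g"
    by (rule compact_uniformly_continuous) (use gc in \<open>auto intro: continuous_on_subset\<close>)
  then obtain d0 where d0: "d0 > 0" "\<And>x y. x \<in> cball x0 (R + 3) \<Longrightarrow> y \<in> cball x0 (R + 3) \<Longrightarrow> dist y x < d0 \<Longrightarrow> dist (g y) (g x) < et"
    using et unfolding uniformly_continuous_on_def by metis
  define d where "d = min 1 d0"
  define I2 where "I2 = indicat_real (cball x0 (R + 2))"
  have I2m[measurable]: "I2 \<in> borel_measurable borel" unfolding I2_def by (intro borel_measurable_indicator) auto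
  have main: "Lpn p (\<lambda>x. conv \<rho> f x - f x) < ennreal e"
    if a: "real DIM('a) * a \<le> d" and \<rho>: "\<rho> \<in> tensor_bumps a" "\<And>x. \<rho> x \<ge> 0" "integral\<^sup>L lborel \<rho> = 1" for a \<rho>
  proof -
    have [measurable]: "\<rho> \<in> borel_measurable borel"
      by (rule borel_measurable_continuous_onI[OF tensor_bumps_continuous[OF \<rho>(1)]])
    \<comment> \<open>A function that is not integrable has integral 0, so integral 1 already yields
      integrability.\<close>
    have \<rho>i: "integrable lborel \<rho>" using \<rho>(3) not_integrable_integral_eq by fastforce
    have \<rho>1: "(\<integral>\<^sup>+x. ennreal (\<rho> x) \<partial>lborel) = 1" using \<rho>i \<rho> by (simp add: nn_integral_eq_integral)
    have \<rho>y: "(\<integral>\<^sup>+y. ennreal (\<rho> (x - y)) \<partial>lborel) = 1" for x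
      using nn_integral_lborel_reflect[of "\<lambda>x. ennreal (\<rho> x)" x] \<rho>1 by simp
    have \<rho>x: "(\<integral>\<^sup>+x. ennreal (\<rho> (x - y)) \<partial>lborel) = 1" for y
      using nn_integral_lborel_shift[of "\<lambda>x. ennreal (\<rho> x)" "-y"] \<rho>1 by simp
    have wi: "integrable lborel (\<lambda>y. \<rho> (x - y))" for x
      using \<rho>y \<rho> by (intro integrableI_nonneg) auto
    have w1: "(\<integral>y. \<rho> (x - y) \<partial>lborel) = 1" for x
      using \<rho>y \<rho> by (subst integral_eq_nn_integral) auto
    have "ennreal (norm (conv \<rho> f x - f x) powr p) \<le> (\<integral>\<^sup>+y. ennreal (\<rho> (x - y) * norm (f y - f x) powr p) \<partial>lborel)" for x
    proof -
      have "conv \<rho> f x - f x = (\<integral>y. \<rho> (x - y) *\<^sub>R (f y - f x) \<partial>lborel)"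
        unfolding scaleR_diff_right
        using conv_tensor_bumps_integrable[OF \<rho>(1) fi, of x] wi[of x] w1[of x]
        by (subst Bochner_Integration.integral_diff) (auto simp: conv_def)
      then show ?thesis using Jensen_powr[OF wi \<rho>(2) w1, of "\<lambda>y. f y - f x" p x] p by simp
    qed
    then have "Lpn p (\<lambda>x. conv \<rho> f x - f x) \<le> (\<integral>\<^sup>+x. \<integral>\<^sup>+y. ennreal (\<rho> (x - y) * norm (f y - f x) powr p) \<partial>lborel \<partial>lborel)"
      unfolding Lpn_def by (intro nn_integral_mono)
    also have "\<dots> \<le> (\<integral>\<^sup>+x. \<integral>\<^sup>+y. ennreal (4 powr p) * (ennreal (\<rho> (x - y)) * ennreal (norm (f y - g y) powr p)
         + ennreal (\<rho> (x - y)) * ennreal (et powr p * I2 x)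
         + ennreal (\<rho> (x - y)) * ennreal (norm (f x - g x) powr p)) \<partial>lborel \<partial>lborel)"
    proof (intro nn_integral_mono)
      fix x y
      have "norm (f y - f x) powr p \<le> (norm (f y - g y) + (norm (g y - g x) + norm (f x - g x))) powr p"
      proof (intro powr_mono2)
        have "f y - f x = (f y - g y) + ((g y - g x) + (g x - f x))" by simp
        then show "norm (f y - f x) \<le> norm (f y - g y) + (norm (g y - g x) + norm (f x - g x))"
          by (metis add_left_mono norm_minus_commute norm_triangle_ineq norm_triangle_le)
      qed (use p in auto)
      also have "\<dots> \<le> 2 powr p * (norm (f y - g y) powr p + (norm (g y - g x) + norm (f x - g x)) powr p)"
        using p by (intro powr_add_le_two_powr) auto
      also have "\<dots> \<le> 2 powr p * (norm (f y - g y) powr p + 2 powr p * (norm (g y - g x) powr p + norm (f x - g x) powr p))"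
        using p by (intro mult_left_mono add_left_mono powr_add_le_two_powr) auto
      also have "\<dots> \<le> 2 powr p * (2 powr p * (norm (f y - g y) powr p) + 2 powr p * (norm (g y - g x) powr p + norm (f x - g x) powr p))"
      proof -
        have "1 * (norm (f y - g y) powr p) \<le> 2 powr p * (norm (f y - g y) powr p)"
          using p by (intro mult_right_mono ge_one_powr_ge_zero) auto
        then show ?thesis by (intro mult_left_mono add_right_mono) auto
      qed
      also have "\<dots> = 4 powr p * (norm (f y - g y) powr p + norm (g y - g x) powr p + norm (f x - g x) powr p)"
        using powr_mult[of 2 2 p] by (simp add: algebra_simps)
      finally have A: "norm (f y - f x) powr p \<le> 4 powr p * (norm (f y - g y) powr p + norm (g y - g x) powr p + norm (f x - g x) powr p)" .
      have B: "\<rho> (x - y) * norm (g y - g x) powr p \<le> \<rho> (x - y) * (et powr p * I2 x)"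
      proof (cases "\<rho> (x - y) = 0")
        case False
        then have xy: "norm (x - y) < d" using tensor_bumps_support[OF \<rho>(1), of "x - y"] a by force
        show ?thesis
        proof (cases "x \<in> cball x0 (R + 2)")
          case True
          have "dist x0 y \<le> dist x0 x + norm (x - y)" using dist_triangle[of x0 y x] by (simp add: dist_norm)
          then have "dist (g y) (g x) < et" using True xy
            by (intro d0(2)) (auto simp: d_def dist_norm norm_minus_commute)
          then show ?thesis using True \<rho>(2) p by (auto simp: dist_norm I2_def intro!: mult_left_mono powr_mono2)
        next
          case False
          have "dist x0 x \<le> dist x0 y + norm (x - y)" using dist_triangle[of x0 x y] by (simp add: dist_norm norm_minus_commute)
          then have "g y = 0" "g x = 0" using False xy by (auto intro!: gs simp: d_def)
          then show ?thesis using \<rho>(2)[of "x - y"] by (simp add: I2_def)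
        qed
      qed simp
      have "\<rho> (x - y) * norm (f y - f x) powr p \<le> \<rho> (x - y) * (4 powr p * (norm (f y - g y) powr p + norm (g y - g x) powr p + norm (f x - g x) powr p))"
        using A \<rho>(2) by (intro mult_left_mono)
      also have "\<dots> = 4 powr p * (\<rho> (x - y) * norm (f y - g y) powr p + \<rho> (x - y) * norm (g y - g x) powr p + \<rho> (x - y) * norm (f x - g x) powr p)"
        by (simp add: algebra_simps)
      also have "\<dots> \<le> 4 powr p * (\<rho> (x - y) * norm (f y - g y) powr p + \<rho> (x - y) * (et powr p * I2 x) + \<rho> (x - y) * norm (f x - g x) powr p)"
        using B by (simp add: mult_left_mono)
      finally have "ennreal (\<rho> (x - y) * norm (f y - f x) powr p) \<le> ennreal \<dots>" by (rule ennreal_leI)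
      then show "ennreal (\<rho> (x - y) * norm (f y - f x) powr p) \<le> ennreal (4 powr p) * (ennreal (\<rho> (x - y)) * ennreal (norm (f y - g y) powr p)
         + ennreal (\<rho> (x - y)) * ennreal (et powr p * I2 x)
         + ennreal (\<rho> (x - y)) * ennreal (norm (f x - g x) powr p))"
        using \<rho>(2)[of "x - y"] by (simp add: ennreal_mult' ennreal_plus I2_def)
    qed
    also have "\<dots> = ennreal (4 powr p) * (Lpn p (\<lambda>x. f x - g x) + ennreal (et powr p * V) + Lpn p (\<lambda>x. f x - g x))"
    proof -
      have 1: "(\<integral>\<^sup>+x. \<integral>\<^sup>+y. ennreal (\<rho> (x - y)) * ennreal (norm (f y - g y) powr p) \<partial>lborel \<partial>lborel) = Lpn p (\<lambda>x. f x - g x)"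
      proof -
        have "(\<integral>\<^sup>+x. \<integral>\<^sup>+y. ennreal (\<rho> (x - y)) * ennreal (norm (f y - g y) powr p) \<partial>lborel \<partial>lborel)
          = (\<integral>\<^sup>+y. \<integral>\<^sup>+x. ennreal (\<rho> (x - y)) * ennreal (norm (f y - g y) powr p) \<partial>lborel \<partial>lborel)"
          by (rule lborel_pair.Fubini') simp
        also have "\<dots> = (\<integral>\<^sup>+y. 1 * ennreal (norm (f y - g y) powr p) \<partial>lborel)"
          by (simp add: nn_integral_multc \<rho>x)
        finally show ?thesis by (simp add: Lpn_def)
      qed
      have 2: "(\<integral>\<^sup>+x. \<integral>\<^sup>+y. ennreal (\<rho> (x - y)) * ennreal (et powr p * I2 x) \<partial>lborel \<partial>lborel) = ennreal (et powr p * V)"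
      proof -
        have "(\<integral>\<^sup>+x. \<integral>\<^sup>+y. ennreal (\<rho> (x - y)) * ennreal (et powr p * I2 x) \<partial>lborel \<partial>lborel)
           = (\<integral>\<^sup>+x. ennreal (et powr p) * indicator (cball x0 (R + 2)) x \<partial>lborel)"
          by (simp add: nn_integral_multc \<rho>y ennreal_mult' ennreal_indicator I2_def)
        also have "\<dots> = ennreal (et powr p) * emeasure lborel (cball x0 (R + 2))" by (simp add: nn_integral_cmult_indicator)
        also have "emeasure lborel (cball x0 (R + 2)) = ennreal V"
          unfolding V_def by (rule emeasure_eq_ennreal_measure) (use emeasure_lborel_cball_finite[of x0 "R + 2"] in auto)
        finally show ?thesis by (simp add: ennreal_mult')
      qed
      have 3: "(\<integral>\<^sup>+x. \<integral>\<^sup>+y. ennreal (\<rho> (x - y)) * ennreal (norm (f x - g x) powr p) \<partial>lborel \<partial>lborel) = Lpn p (\<lambda>x. f x - g x)"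
        by (simp add: nn_integral_multc \<rho>y Lpn_def)
      have "(\<integral>\<^sup>+x. \<integral>\<^sup>+y. ennreal (4 powr p) * (ennreal (\<rho> (x - y)) * ennreal (norm (f y - g y) powr p)
           + ennreal (\<rho> (x - y)) * ennreal (et powr p * I2 x)
           + ennreal (\<rho> (x - y)) * ennreal (norm (f x - g x) powr p)) \<partial>lborel \<partial>lborel)
         = (\<integral>\<^sup>+x. ennreal (4 powr p) * ((\<integral>\<^sup>+y. ennreal (\<rho> (x - y)) * ennreal (norm (f y - g y) powr p) \<partial>lborel)
           + (\<integral>\<^sup>+y. ennreal (\<rho> (x - y)) * ennreal (et powr p * I2 x) \<partial>lborel)
           + (\<integral>\<^sup>+y. ennreal (\<rho> (x - y)) * ennreal (norm (f x - g x) powr p) \<partial>lborel)) \<partial>lborel)"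
        by (rule nn_integral_cong, rule nn_integral_cmult_add3; measurable)
      also have "\<dots> = ennreal (4 powr p) * ((\<integral>\<^sup>+x. \<integral>\<^sup>+y. ennreal (\<rho> (x - y)) * ennreal (norm (f y - g y) powr p) \<partial>lborel \<partial>lborel)
           + (\<integral>\<^sup>+x. \<integral>\<^sup>+y. ennreal (\<rho> (x - y)) * ennreal (et powr p * I2 x) \<partial>lborel \<partial>lborel)
           + (\<integral>\<^sup>+x. \<integral>\<^sup>+y. ennreal (\<rho> (x - y)) * ennreal (norm (f x - g x) powr p) \<partial>lborel \<partial>lborel))"
      proof (rule nn_integral_cmult_add3)
        show "(\<lambda>x. \<integral>\<^sup>+y. ennreal (\<rho> (x - y)) * ennreal (norm (f y - g y) powr p) \<partial>lborel) \<in> borel_measurable lborel"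
          by (rule lborel.borel_measurable_nn_integral) simp
        have "(\<integral>\<^sup>+y. ennreal (\<rho> (x - y)) * c \<partial>lborel) = c" for x c
          by (subst nn_integral_multc) (simp_all add: \<rho>y)
        then show "(\<lambda>x. \<integral>\<^sup>+y. ennreal (\<rho> (x - y)) * ennreal (et powr p * I2 x) \<partial>lborel) \<in> borel_measurable lborel"
          "(\<lambda>x. \<integral>\<^sup>+y. ennreal (\<rho> (x - y)) * ennreal (norm (f x - g x) powr p) \<partial>lborel) \<in> borel_measurable lborel"
          by simp_all
      qed
      finally show ?thesis unfolding 1 2 3 .
    qed
    also have "\<dots> < ennreal (4 powr p) * (ennreal e1 + ennreal e1 + ennreal e1)"
    proof (rule ennreal_mult_strict_left_mono)
      have "ennreal (et powr p * V) \<le> ennreal e1" using etp by (rule ennreal_leI)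
      then show "Lpn p (\<lambda>x. f x - g x) + ennreal (et powr p * V) + Lpn p (\<lambda>x. f x - g x) < ennreal e1 + ennreal e1 + ennreal e1"
        using gf by (intro add_strict_mono ennreal_add_less_le_mono) auto
    qed auto
    also have "\<dots> = ennreal (3 * e / 4)"
      using e1 by (simp add: ennreal_plus[symmetric] ennreal_mult[symmetric] e1_def del: ennreal_plus)
    also have "\<dots> \<le> ennreal e" using e by (intro ennreal_leI) auto
    finally show ?thesis .
  qed
  show ?thesis by (rule that[of d]) (use d0 main in \<open>auto simp: d_def\<close>)
qed


section \<open>Weak gradients and truncation\<close>

lemma line_derivative_outside_support:
  fixes F :: "'a::euclidean_space \<Rightarrow> real"
  assumes "\<And>x. x \<notin> cball x0 R \<Longrightarrow> F x = 0" "x \<notin> cball x0 R"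
    and "((\<lambda>t. F (x + t *\<^sub>R v)) has_real_derivative d) (at 0)"
  shows "d = 0"
proof -
  have "open ((\<lambda>t. x + t *\<^sub>R v) -` (- cball x0 R))"
    by (rule continuous_open_vimage) (auto intro!: continuous_intros)
  then have "((\<lambda>t. 0) has_real_derivative d) (at 0)"
    by (rule has_field_derivative_transform_within_open[OF assms(3)]) (use assms(1,2) in auto)
  then show ?thesis using DERIV_unique DERIV_const by blast
qed

lemma C1_grad_outside_support:
  assumes "C1_grad f D" "\<And>x. x \<notin> cball x0 R \<Longrightarrow> f x = 0" "x \<notin> cball x0 R"
  shows "D x = 0"
proof -
  have "D x \<bullet> D x = 0"
    by (rule line_derivative_outside_support[of x0 R f x "D x"])
       (use assms C1_grad_line[OF assms(1), of x "D x" 0 UNIV] in auto)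
  then show ?thesis by simp
qed

lemma cball_support_bounded:
  fixes f :: "'a::euclidean_space \<Rightarrow> 'b::real_normed_vector"
  assumes "continuous_on UNIV f" "\<And>x. x \<notin> cball x0 R \<Longrightarrow> f x = 0"
  obtains M where "M > 0" "\<And>x. norm (f x) \<le> M"
proof (rule compact_support_bounded[OF assms(1), of "norm x0 + R"])
  show "f x = 0" if "norm x0 + R < norm x" for x
    using that norm_triangle_ineq2[of x x0] by (intro assms(2)) (auto simp: dist_norm norm_minus_commute)
qed auto

lemma integral_lborel_shift:
  fixes F :: "'a::euclidean_space \<Rightarrow> real"
  assumes [measurable]: "F \<in> borel_measurable borel"
  shows "(\<integral>x. F (c + x) \<partial>lborel) = (\<integral>x. F x \<partial>lborel)"
  by (subst (2) lborel_distr_plus[of c, symmetric]) (simp add: integral_distr)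

text \<open>By translation invariance every difference quotient has integral 0. The mean value
  theorem bounds the quotients by a bound of P, on a ball enlarged by 1 because the steps have
  length at most 1, and dominated convergence passes the identity to the derivative.\<close>

lemma integral_partial_zero:
  fixes F :: "'a::euclidean_space \<Rightarrow> real"
  assumes F: "continuous_on UNIV F" "\<And>x. x \<notin> cball x0 R \<Longrightarrow> F x = 0"
    and d: "\<And>x. ((\<lambda>t. F (x + t *\<^sub>R i)) has_real_derivative P x) (at 0)"
    and P: "continuous_on UNIV P" and i: "norm i = 1"
  shows "(\<integral>x. P x \<partial>lborel) = 0"
proof -
  note [measurable] = borel_measurable_continuous_onI[OF F(1)] borel_measurable_continuous_onI[OF P]
  have Ps: "P x = 0" if "x \<notin> cball x0 R" for x
    using line_derivative_outside_support[OF F(2) that d] by simp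
  obtain M where M: "M > 0" "\<And>x. norm (P x) \<le> M" using cball_support_bounded[OF P Ps] by blast
  have dl: "((\<lambda>t. F (x + t *\<^sub>R i)) has_real_derivative P (x + t *\<^sub>R i)) (at t)" for x t
    using d[of "x + t *\<^sub>R i"] DERIV_shift[of "\<lambda>s. F (x + s *\<^sub>R i)" _ 0 t]
    by (simp add: scaleR_add_left algebra_simps)
  define h where "h n = 1 / (real n + 1)" for n
  have h: "h n > 0" "h n \<le> 1" for n by (auto simp: h_def)
  define S where "S n x = (F (h n *\<^sub>R i + x) - F x) / h n" for n x
  have Fi: "integrable lborel F" by (rule compact_support_integrable[OF F compact_cball])
  have Fis: "integrable lborel (\<lambda>x. F (c + x))" for c
  proof (rule compact_support_integrable[of _ "cball (x0 - c) R"])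
    show "continuous_on UNIV (\<lambda>x. F (c + x))"
      by (rule continuous_on_compose2[OF F(1)]) (auto intro!: continuous_intros)
    show "F (c + x) = 0" if "x \<notin> cball (x0 - c) R" for x
      using that by (intro F(2)) (auto simp: dist_norm algebra_simps)
  qed auto
  have S0: "(\<integral>x. S n x \<partial>lborel) = 0" for n
    unfolding S_def using Fi Fis integral_lborel_shift[of F] by simp
  have "(\<lambda>n. \<integral>x. S n x \<partial>lborel) \<longlonglongrightarrow> (\<integral>x. P x \<partial>lborel)"
  proof (rule integral_dominated_convergence[where w = "\<lambda>x. M * indicat_real (cball x0 (R + 1)) x"])
    show "P \<in> borel_measurable lborel" by simp
    show "S n \<in> borel_measurable lborel" for n unfolding S_def[abs_def] by simp
    have "integrable lborel (indicat_real (cball x0 (R + 1)))"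
      using emeasure_lborel_cball_finite by (intro integrable_real_indicator) auto
    then show "integrable lborel (\<lambda>x. M * indicat_real (cball x0 (R + 1)) x)" by simp
    have h0: "h \<longlonglongrightarrow> 0" unfolding h_def[abs_def]
      using LIMSEQ_Suc[OF lim_1_over_n[where 'a=real]] by (simp add: add.commute)
    have hf: "filterlim h (at 0) sequentially"
      using h0 h by (intro filterlim_atI) (auto simp: less_imp_neq[symmetric] h_def)
    have "(\<lambda>n. S n x) \<longlonglongrightarrow> P x" for x
    proof -
      have "((\<lambda>t. (F (x + t *\<^sub>R i) - F x) / t) \<longlongrightarrow> P x) (at 0)"
        using d[of x] unfolding DERIV_def by simp
      from filterlim_compose[OF this hf] show ?thesis by (simp add: S_def add.commute)
    qed
    then show "AE x in lborel. (\<lambda>n. S n x) \<longlonglongrightarrow> P x" by simp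
    have "norm (S n x) \<le> M * indicat_real (cball x0 (R + 1)) x" for n x
    proof (cases "x \<in> cball x0 (R + 1)")
      case True
      obtain z where "F (x + h n *\<^sub>R i) - F (x + 0 *\<^sub>R i) = (h n - 0) * P (x + z *\<^sub>R i)"
        using MVT2[of 0 "h n" "\<lambda>t. F (x + t *\<^sub>R i)" "\<lambda>t. P (x + t *\<^sub>R i)"] dl h by blast
      then have "S n x = P (x + z *\<^sub>R i)" using h(1)[of n] by (simp add: S_def field_simps)
      then show ?thesis using True M(2)[of "x + z *\<^sub>R i"] by simp
    next
      case False
      have "dist x0 x \<le> dist x0 (h n *\<^sub>R i + x) + norm (h n *\<^sub>R i)"
        using dist_triangle[of x0 x "h n *\<^sub>R i + x"] by (simp add: dist_norm)
      then have "F (h n *\<^sub>R i + x) = 0" using False i h[of n] by (intro F(2)) auto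
      moreover have "F x = 0" using False by (intro F(2)) auto
      ultimately show ?thesis using False by (simp add: S_def)
    qed
    then show "AE x in lborel. norm (S n x) \<le> M * indicat_real (cball x0 (R + 1)) x" for n by simp
  qed
  then show ?thesis by (simp add: S0 LIMSEQ_const_iff)
qed

lemma smooth_funD:
  assumes "smooth_fun \<phi>" "i \<in> Basis"
  shows "continuous_on UNIV \<phi>" "continuous_on UNIV (partial \<phi> i)"
    "((\<lambda>t. \<phi> (x + t *\<^sub>R i)) has_real_derivative partial \<phi> i x) (at 0)"
proof -
  obtain F where F: "\<phi> \<in> F" "\<forall>g\<in>F. continuous_on UNIV g \<and>
      (\<forall>i\<in>Basis. (\<forall>x. (\<lambda>t. g (x + t *\<^sub>R i)) differentiable (at 0)) \<and> partial g i \<in> F)"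
    using assms(1) unfolding smooth_fun_def by blast
  then show "continuous_on UNIV \<phi>" "continuous_on UNIV (partial \<phi> i)" using assms(2) by blast+
  have "(\<lambda>t. \<phi> (x + t *\<^sub>R i)) field_differentiable (at 0)"
    using F assms(2) by (meson field_differentiable_def real_differentiable_def)
  then show "((\<lambda>t. \<phi> (x + t *\<^sub>R i)) has_real_derivative partial \<phi> i x) (at 0)"
    unfolding partial_def by (rule field_differentiable_derivI)
qed

lemma C1_grad_integration_by_parts:
  fixes f :: "'a::euclidean_space \<Rightarrow> real"
  assumes f: "C1_grad f D" "\<And>x. x \<notin> cball x0 R \<Longrightarrow> f x = 0" and \<phi>: "smooth_fun \<phi>" and i: "i \<in> Basis"
  shows "(\<integral>x. f x * partial \<phi> i x \<partial>lborel) = - (\<integral>x. (D x \<bullet> i) * \<phi> x \<partial>lborel)"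
proof -
  have Dc: "continuous_on UNIV D" using f by (simp add: C1_grad_def)
  note c = smooth_funD(1,2)[OF \<phi> i] C1_grad_continuous[OF f(1), of UNIV] Dc
  have Ds: "D x = 0" if "x \<notin> cball x0 R" for x using C1_grad_outside_support[OF f that] .
  have "(\<integral>x. f x * partial \<phi> i x + (D x \<bullet> i) * \<phi> x \<partial>lborel) = 0"
  proof (rule integral_partial_zero[of "\<lambda>x. f x * \<phi> x" x0 R i])
    fix x
    show "((\<lambda>t. f (x + t *\<^sub>R i) * \<phi> (x + t *\<^sub>R i)) has_real_derivative f x * partial \<phi> i x + D x \<bullet> i * \<phi> x) (at 0)"
      using DERIV_mult[OF C1_grad_line[OF f(1), of x i 0 UNIV] smooth_funD(3)[OF \<phi> i, of x]] by (simp add: algebra_simps)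
  qed (use c f i in \<open>auto intro!: continuous_intros\<close>)
  moreover have "integrable lborel (\<lambda>x. f x * partial \<phi> i x)"
    by (rule compact_support_integrable[of _ "cball x0 R"]) (use c f in \<open>auto intro!: continuous_intros\<close>)
  moreover have "integrable lborel (\<lambda>x. (D x \<bullet> i) * \<phi> x)"
    by (rule compact_support_integrable[of _ "cball x0 R"]) (use c Ds in \<open>auto intro!: continuous_intros\<close>)
  ultimately show ?thesis by simp
qed

section \<open>Mollification of weak gradients\<close>

text \<open>Whole-space Borel counterpart of \<open>weak_grad\<close>: a test function vanishes off
  U, so the integrals are taken over all of \<open>lborel\<close>, which suits convolutions.\<close>

definition wgrad_on :: "'a::euclidean_space set \<Rightarrow> ('a \<Rightarrow> real) \<Rightarrow> ('a \<Rightarrow> 'a) \<Rightarrow> bool" where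
  "wgrad_on U u g \<longleftrightarrow> (\<forall>\<phi>. test_fun U \<phi> \<longrightarrow> (\<forall>i\<in>Basis.
     (\<integral>x. u x * partial \<phi> i x \<partial>lborel) = - (\<integral>x. (g x \<bullet> i) * \<phi> x \<partial>lborel)))"

text \<open>The reflected bump centred at x is an admissible test function as soon as its support
  ball lies in U; the minus sign of the reflection cancels the one in integration by parts.\<close>

lemma conv_weak_grad:
  fixes u :: "'a::euclidean_space \<Rightarrow> real"
  assumes w: "wgrad_on U u g" and "integrable lborel u" and g: "integrable lborel g"
    and \<rho>: "\<rho> \<in> tensor_bumps a" and D: "C1_grad \<rho> D" "\<And>i. i \<in> Basis \<Longrightarrow> (\<lambda>x. D x \<bullet> i) \<in> tensor_bumps a"
    and x: "cball x (real DIM('a) * a) \<subseteq> U"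
  shows "(\<Sum>i\<in>Basis. conv (\<lambda>x. D x \<bullet> i) u x *\<^sub>R i) = conv \<rho> g x"
proof (rule euclidean_eqI)
  fix i :: 'a assume i: "i \<in> Basis"
  have t: "test_fun U (\<lambda>y. \<rho> (x - y))" using test_fun_reflect[OF \<rho> x] .
  have "(\<integral>y. u y * partial (\<lambda>y. \<rho> (x - y)) i y \<partial>lborel) = - (\<integral>y. (g y \<bullet> i) * \<rho> (x - y) \<partial>lborel)"
    using w t i unfolding wgrad_on_def by blast
  then have "(\<integral>y. (D (x - y) \<bullet> i) * u y \<partial>lborel) = (\<integral>y. (g y \<bullet> i) * \<rho> (x - y) \<partial>lborel)"
    by (simp add: C1_grad_partial[OF C1_grad_reflect[OF D(1)]] mult.commute)
  also have "\<dots> = (\<integral>y. (\<rho> (x - y) *\<^sub>R g y) \<bullet> i \<partial>lborel)" by (simp add: mult.commute)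
  also have "\<dots> = conv \<rho> g x \<bullet> i"
    unfolding conv_def by (rule integral_inner_left) (use conv_tensor_bumps_integrable[OF \<rho> g] in auto)
  finally show "(\<Sum>j\<in>Basis. conv (\<lambda>x. D x \<bullet> j) u x *\<^sub>R j) \<bullet> i = conv \<rho> g x \<bullet> i"
    using i by (simp add: inner_sum_left inner_Basis if_distrib conv_def cong: if_cong)
qed

text \<open>The width a is taken below d and below both L^p thresholds, so u and g are mollified by
  the same kernel, and at points whose d-ball lies in U the gradient of the mollification is the
  mollified gradient.\<close>

lemma mollify_weak_grad:
  fixes u :: "'a::euclidean_space \<Rightarrow> real"
  assumes u[measurable]: "u \<in> borel_measurable borel" and up: "Lpn p u < \<infinity>" and us: "\<And>x. x \<notin> cball x0 R \<Longrightarrow> u x = 0"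
    and g[measurable]: "g \<in> borel_measurable borel" and gp: "Lpn p g < \<infinity>" and gs: "\<And>x. x \<notin> cball x0 R \<Longrightarrow> g x = 0"
    and w: "wgrad_on U u g" and p: "p > 1" and e: "e > 0" and d: "d > 0"
  obtains a \<rho> where "real DIM('a) * a \<le> d" "\<rho> \<in> tensor_bumps a" "C1_grad (conv \<rho> u) (\<lambda>x. sgrad (conv \<rho> u) x)"
    "\<forall>x. cball x d \<subseteq> U \<longrightarrow> sgrad (conv \<rho> u) x = conv \<rho> g x"
    "Lpn p (\<lambda>x. conv \<rho> u x - u x) < ennreal e" "Lpn p (\<lambda>x. conv \<rho> g x - g x) < ennreal e"
proof -
  have ui: "integrable lborel u" using Lp_compact_integrable[OF u up us] p by auto
  have gi: "integrable lborel g" using Lp_compact_integrable[OF g gp gs] p by auto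
  obtain d1 where d1: "d1 > 0" "\<And>a \<rho>. real DIM('a) * a \<le> d1 \<Longrightarrow> \<rho> \<in> tensor_bumps a \<Longrightarrow> (\<And>x. \<rho> x \<ge> 0) \<Longrightarrow> integral\<^sup>L lborel \<rho> = 1 \<Longrightarrow>
       Lpn p (\<lambda>x. conv \<rho> u x - u x) < ennreal e"
    using conv_tendsto_Lp[OF u up us p e] by blast
  obtain d2 where d2: "d2 > 0" "\<And>a \<rho>. real DIM('a) * a \<le> d2 \<Longrightarrow> \<rho> \<in> tensor_bumps a \<Longrightarrow> (\<And>x. \<rho> x \<ge> 0) \<Longrightarrow> integral\<^sup>L lborel \<rho> = 1 \<Longrightarrow>
       Lpn p (\<lambda>x. conv \<rho> g x - g x) < ennreal e"
    using conv_tendsto_Lp[OF g gp gs p e] by blast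
  define a where "a = min d (min d1 d2) / real DIM('a)"
  have a: "a > 0" "real DIM('a) * a = min d (min d1 d2)" using d d1(1) d2(1) by (auto simp: a_def)
  obtain \<rho> :: "'a \<Rightarrow> real" where \<rho>: "\<rho> \<in> tensor_bumps a" "\<And>x. \<rho> x \<ge> 0" "integral\<^sup>L lborel \<rho> = 1"
    using mollifier_exists[OF a(1)] by metis
  obtain D where D: "C1_grad \<rho> D" "\<And>i. i \<in> Basis \<Longrightarrow> (\<lambda>x. D x \<bullet> i) \<in> tensor_bumps a"
    using tensor_bumps_C1_grad[OF \<rho>(1)] by metis
  note C = conv_C1_grad[OF \<rho>(1) D ui]
  have s: "sgrad (conv \<rho> u) = (\<lambda>x. \<Sum>i\<in>Basis. conv (\<lambda>x. D x \<bullet> i) u x *\<^sub>R i)"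
    using C1_grad_sgrad[OF C] by auto
  have *: "sgrad (conv \<rho> u) x = conv \<rho> g x" if "cball x d \<subseteq> U" for x
  proof -
    have "cball x (real DIM('a) * a) \<subseteq> U" using that a(2) by (auto simp: subset_iff)
    from conv_weak_grad[OF w ui gi \<rho>(1) D this] show ?thesis unfolding s .
  qed
  show ?thesis
    by (rule that[of a \<rho>, OF _ \<rho>(1)]) (use * a C s d1(2)[OF _ \<rho>] d2(2)[OF _ \<rho>] in auto)
qed

section \<open>Limits of C^1 functions and truncation\<close>

text \<open>Pairs in the W^(1,p) closure of the C^1 functions supported in a fixed closed ball. C^1
  is stable under the chain rule with a C^1 outer function, and mollification restores smoothness at
  the end.\<close>

definition W1p_approx :: "real \<Rightarrow> 'a::euclidean_space \<Rightarrow> real \<Rightarrow> ('a \<Rightarrow> real) \<Rightarrow> ('a \<Rightarrow> 'a) \<Rightarrow> bool" where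
  "W1p_approx p x0 R f G \<longleftrightarrow> f \<in> borel_measurable borel \<and> G \<in> borel_measurable borel \<and>
     (\<forall>e>0. \<exists>h D. C1_grad h D \<and> (\<forall>x. x \<notin> cball x0 R \<longrightarrow> h x = 0) \<and>
        Lpn p (\<lambda>x. f x - h x) < ennreal e \<and> Lpn p (\<lambda>x. G x - D x) < ennreal e)"

lemma C1_grad_measurable:
  assumes "C1_grad h D" shows "h \<in> borel_measurable borel" "D \<in> borel_measurable borel"
  using assms C1_grad_continuous[OF assms] by (auto simp: C1_grad_def intro!: borel_measurable_continuous_onI)

lemma Lpn_diff_trans_less:
  fixes f g h :: "'a::euclidean_space \<Rightarrow> 'b::euclidean_space"
  assumes "f \<in> borel_measurable borel" "g \<in> borel_measurable borel" "h \<in> borel_measurable borel" and p: "p > 0"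
    and "Lpn p (\<lambda>x. f x - g x) < ennreal (e / (2 * 2 powr p))" "Lpn p (\<lambda>x. g x - h x) < ennreal (e / (2 * 2 powr p))" "e > 0"
  shows "Lpn p (\<lambda>x. f x - h x) < ennreal e"
proof -
  have "Lpn p (\<lambda>x. f x - h x) \<le> ennreal (2 powr p) * (Lpn p (\<lambda>x. f x - g x) + Lpn p (\<lambda>x. g x - h x))"
    by (rule Lpn_diff_trans) (use assms in auto)
  also have "\<dots> < ennreal (2 powr p) * (ennreal (e / (2 * 2 powr p)) + ennreal (e / (2 * 2 powr p)))"
    using assms by (intro ennreal_mult_strict_left_mono add_strict_mono) auto
  also have "\<dots> = ennreal e"
    using assms by (simp add: ennreal_plus[symmetric] ennreal_mult[symmetric] del: ennreal_plus)
  finally show ?thesis .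
qed

lemma W1p_approx_closed:
  assumes "f \<in> borel_measurable borel" "G \<in> borel_measurable borel" and p: "p > 0"
    and "\<And>e. e > 0 \<Longrightarrow> \<exists>f' G'. W1p_approx p x0 R f' G' \<and> Lpn p (\<lambda>x. f x - f' x) < ennreal e \<and> Lpn p (\<lambda>x. G x - G' x) < ennreal e"
  shows "W1p_approx p x0 R f G"
  unfolding W1p_approx_def
proof (intro conjI assms(1,2) allI impI)
  fix e :: real assume e: "e > 0"
  define e' where "e' = e / (2 * 2 powr p)"
  have e': "e' > 0" using e by (simp add: e'_def)
  obtain f' G' where 1: "W1p_approx p x0 R f' G'" "Lpn p (\<lambda>x. f x - f' x) < ennreal e'" "Lpn p (\<lambda>x. G x - G' x) < ennreal e'"
    using assms(4)[OF e'] by blast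
  then obtain h D where 2: "C1_grad h D" "\<forall>x. x \<notin> cball x0 R \<longrightarrow> h x = 0"
      "Lpn p (\<lambda>x. f' x - h x) < ennreal e'" "Lpn p (\<lambda>x. G' x - D x) < ennreal e'"
    and m: "f' \<in> borel_measurable borel" "G' \<in> borel_measurable borel"
    unfolding W1p_approx_def using e' by blast
  have "Lpn p (\<lambda>x. f x - h x) < ennreal e" "Lpn p (\<lambda>x. G x - D x) < ennreal e"
    using Lpn_diff_trans_less[OF assms(1) m(1) C1_grad_measurable(1)[OF 2(1)] p _ _ e]
      Lpn_diff_trans_less[OF assms(2) m(2) C1_grad_measurable(2)[OF 2(1)] p _ _ e] 1 2 by (auto simp: e'_def)
  with 2 show "\<exists>h D. C1_grad h D \<and> (\<forall>x. x \<notin> cball x0 R \<longrightarrow> h x = 0) \<and>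
        Lpn p (\<lambda>x. f x - h x) < ennreal e \<and> Lpn p (\<lambda>x. G x - D x) < ennreal e" by blast
qed

text \<open>L^1 convergence of |f_n|^p yields an a.e. convergent subsequence; taking p-th roots
  returns to f_n.\<close>

lemma Lpn_tendsto_AE_subseq:
  fixes f :: "nat \<Rightarrow> 'a::euclidean_space \<Rightarrow> real"
  assumes [measurable]: "\<And>n. f n \<in> borel_measurable borel" and p: "p > 0" and lim: "(\<lambda>n. Lpn p (f n)) \<longlonglongrightarrow> 0"
    and fin: "\<And>n. Lpn p (f n) < \<infinity>"
  obtains r :: "nat \<Rightarrow> nat" where "strict_mono r" "AE x in lborel. (\<lambda>n. f (r n) x) \<longlonglongrightarrow> 0"
proof -
  have i: "integrable lborel (\<lambda>x. norm (f n x) powr p)" for n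
    using fin[of n] by (intro integrableI_nonneg) (auto simp: Lpn_def)
  have eq: "(\<integral>x. norm (norm (f n x) powr p) \<partial>lborel) = enn2real (Lpn p (f n))" for n
    unfolding Lpn_def by (subst integral_eq_nn_integral) auto
  have "(\<lambda>n. enn2real (Lpn p (f n))) \<longlonglongrightarrow> enn2real 0"
    by (rule tendsto_enn2real) (use lim in auto)
  then have "\<exists>r. strict_mono r \<and> (AE x in lborel. (\<lambda>n. norm (f (r n) x) powr p) \<longlonglongrightarrow> 0)"
    using i by (intro tendsto_L1_AE_subseq) (auto simp: eq simp del: real_norm_def)
  then obtain r where r: "strict_mono r" "AE x in lborel. (\<lambda>n. norm (f (r n) x) powr p) \<longlonglongrightarrow> 0" by blast
  from r(2) have "AE x in lborel. (\<lambda>n. f (r n) x) \<longlonglongrightarrow> 0"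
  proof eventually_elim
    fix x assume "(\<lambda>n. norm (f (r n) x) powr p) \<longlonglongrightarrow> 0"
    then have "(\<lambda>n. (norm (f (r n) x) powr p) powr (1 / p)) \<longlonglongrightarrow> 0 powr (1 / p)"
      using p by (intro tendsto_powr' tendsto_const) auto
    then have "(\<lambda>n. norm (f (r n) x)) \<longlonglongrightarrow> 0" using p by (simp add: powr_powr)
    then show "(\<lambda>n. f (r n) x) \<longlonglongrightarrow> 0" by (rule tendsto_norm_zero_cancel)
  qed
  with r(1) show ?thesis using that by blast
qed


lemma Lpn_mult_bound:
  fixes f :: "'a::euclidean_space \<Rightarrow> 'b::euclidean_space" and g :: "'a \<Rightarrow> 'c::euclidean_space"
  assumes "f \<in> borel_measurable borel" "\<And>x. norm (g x) \<le> M * norm (f x)" "M \<ge> 0" "p > 0"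
  shows "Lpn p g \<le> ennreal (M powr p) * Lpn p f"
proof -
  have "Lpn p g \<le> Lpn p (\<lambda>x. M *\<^sub>R f x)" using assms by (intro Lpn_mono) auto
  then show ?thesis using assms by (simp add: Lpn_scale)
qed

lemma C1_grad_chain_mult:
  assumes v: "C1_grad v Dv" and z: "C1_grad \<zeta> D\<zeta>"
    and F: "\<And>t. (F has_real_derivative F' t) (at t)" "continuous_on UNIV F'"
  shows "C1_grad (\<lambda>x. F (v x) * \<zeta> x) (\<lambda>x. (F' (v x) * \<zeta> x) *\<^sub>R Dv x + F (v x) *\<^sub>R D\<zeta> x)"
  unfolding C1_grad_def
proof (intro conjI allI)
  fix x
  have "((\<lambda>x. F (v x)) has_derivative (\<lambda>h. F' (v x) * (Dv x \<bullet> h))) (at x)"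
    using has_derivative_compose[OF C1_gradD[OF v, where S=UNIV] F(1)[unfolded has_field_derivative_def]] by simp
  from has_derivative_mult[OF this C1_gradD[OF z]]
  show "((\<lambda>x. F (v x) * \<zeta> x) has_derivative (\<lambda>h. ((F' (v x) * \<zeta> x) *\<^sub>R Dv x + F (v x) *\<^sub>R D\<zeta> x) \<bullet> h)) (at x)"
    by (rule has_derivative_eq_rhs) (auto simp: inner_add_left algebra_simps)
next
  have Fc: "continuous_on UNIV F" by (rule DERIV_continuous_on[OF F(1)])
  have vc: "continuous_on UNIV v" and zc: "continuous_on UNIV \<zeta>" using v z C1_grad_continuous by blast+
  show "continuous_on UNIV (\<lambda>x. (F' (v x) * \<zeta> x) *\<^sub>R Dv x + F (v x) *\<^sub>R D\<zeta> x)"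
    using v z by (intro continuous_intros continuous_on_compose2[OF F(2) vc] continuous_on_compose2[OF Fc vc] zc)
      (auto simp: C1_grad_def)
qed

text \<open>After mollifying u the chain rule is classical, and the gradient error has three parts.
  Two are controlled by the L^p errors because 0 \<le> F' \<le> 1, which also makes F 1-Lipschitz;
  the part with F'(u) - F'(v_n) has no rate and goes by dominated convergence along an a.e.
  convergent subsequence.\<close>

lemma W1p_approx_chain:
  fixes u :: "'a::euclidean_space \<Rightarrow> real"
  assumes u[measurable]: "u \<in> borel_measurable borel" and up: "Lpn p u < \<infinity>" and us: "\<And>x. x \<notin> cball x0 R \<Longrightarrow> u x = 0"
    and g[measurable]: "g \<in> borel_measurable borel" and gp: "Lpn p g < \<infinity>" and gs: "\<And>x. x \<notin> cball x0 R \<Longrightarrow> g x = 0"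
    and w: "wgrad_on (ball x0 R) u g" and p: "p > 1"
    and z: "C1_grad \<zeta> D\<zeta>" "\<And>x. x \<notin> cball x0 \<sigma> \<Longrightarrow> \<zeta> x = 0" "\<sigma> < R"
    and F: "\<And>t. (F has_real_derivative F' t) (at t)" "continuous_on UNIV F'" "\<And>t. 0 \<le> F' t" "\<And>t. F' t \<le> 1"
  shows "W1p_approx p x0 \<sigma> (\<lambda>x. F (u x) * \<zeta> x) (\<lambda>x. (F' (u x) * \<zeta> x) *\<^sub>R g x + F (u x) *\<^sub>R D\<zeta> x)"
proof -
  have Fc: "continuous_on UNIV F" by (rule DERIV_continuous_on[OF F(1)])
  have zc: "continuous_on UNIV \<zeta>" "continuous_on UNIV D\<zeta>" using z C1_grad_continuous by (auto simp: C1_grad_def)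
  note [measurable] = borel_measurable_continuous_onI[OF Fc] borel_measurable_continuous_onI[OF F(2)]
    borel_measurable_continuous_onI[OF zc(1)] borel_measurable_continuous_onI[OF zc(2)]
  have Dzs: "D\<zeta> x = 0" if "x \<notin> cball x0 \<sigma>" for x using C1_grad_outside_support[OF z(1,2) that] .
  obtain M1 where M1: "M1 > 0" "\<And>x. norm (\<zeta> x) \<le> M1" using cball_support_bounded[OF zc(1) z(2)] by blast
  obtain M2 where M2: "M2 > 0" "\<And>x. norm (D\<zeta> x) \<le> M2" using cball_support_bounded[OF zc(2) Dzs] by blast
  have FL: "\<bar>F a - F b\<bar> \<le> \<bar>a - b\<bar>" for a b
  proof (induction a b rule: linorder_wlog)
    case (le a b)
    show ?case
    proof (cases "a = b")
      case False
      then obtain t where "F b - F a = (b - a) * F' t" using MVT2[of a b F F'] le F(1) by auto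
      moreover have "0 \<le> (b - a) * F' t" "(b - a) * F' t \<le> (b - a) * 1"
        using F(3,4)[of t] le by (intro mult_nonneg_nonneg mult_left_mono; simp)+
      ultimately show ?thesis using le by (simp add: abs_if)
    qed simp
  qed (simp add: abs_minus_commute)
  define en where "en n = 1 / (real n + 1)" for n
  have en: "en n > 0" for n by (simp add: en_def)
  have en0: "en \<longlonglongrightarrow> 0" unfolding en_def[abs_def]
      using LIMSEQ_Suc[OF lim_1_over_n[where 'a=real]] by (simp add: add.commute)
  have "\<exists>v Dv gm. C1_grad v Dv \<and> gm \<in> borel_measurable borel \<and> (\<forall>x\<in>cball x0 \<sigma>. Dv x = gm x) \<and>
      Lpn p (\<lambda>x. v x - u x) < ennreal (en n) \<and> Lpn p (\<lambda>x. gm x - g x) < ennreal (en n)" for n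
  proof -
    \<comment> \<open>Half of the gap is spent on the mollifier, so points of the smaller ball keep
      their whole mollification ball inside \<open>ball x0 R\<close>.\<close>
    have d: "(R - \<sigma>) / 2 > 0" using z by simp
    from mollify_weak_grad[OF u up us g gp gs w p en[of n] d]
    obtain a \<rho> where "real DIM('a) * a \<le> (R - \<sigma>) / 2" and r: "\<rho> \<in> tensor_bumps a" "C1_grad (conv \<rho> u) (\<lambda>x. sgrad (conv \<rho> u) x)"
    "\<forall>x. cball x ((R - \<sigma>) / 2) \<subseteq> ball x0 R \<longrightarrow> sgrad (conv \<rho> u) x = conv \<rho> g x"
    "Lpn p (\<lambda>x. conv \<rho> u x - u x) < ennreal (en n)" "Lpn p (\<lambda>x. conv \<rho> g x - g x) < ennreal (en n)"
      .
    have [measurable]: "\<rho> \<in> borel_measurable borel"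
      by (rule borel_measurable_continuous_onI[OF tensor_bumps_continuous[OF r(1)]])
    have "sgrad (conv \<rho> u) x = conv \<rho> g x" if "x \<in> cball x0 \<sigma>" for x
    proof (rule r(3)[rule_format], rule subsetI)
      fix y assume "y \<in> cball x ((R - \<sigma>) / 2)"
      then have "dist x0 y \<le> \<sigma> + (R - \<sigma>) / 2"
        using that dist_triangle[of x0 y x] unfolding mem_cball by linarith
      then have "dist x0 y < R" using z(3) by (simp add: field_simps)
      then show "y \<in> ball x0 R" by simp
    qed
    moreover have "conv \<rho> g \<in> borel_measurable borel" by measurable
    ultimately show ?thesis using r by blast
  qed
  then have "\<forall>n. \<exists>q. C1_grad (fst q) (fst (snd q)) \<and> snd (snd q) \<in> borel_measurable borel \<and> (\<forall>x\<in>cball x0 \<sigma>. fst (snd q) x = snd (snd q) x) \<and>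
      Lpn p (\<lambda>x. fst q x - u x) < ennreal (en n) \<and> Lpn p (\<lambda>x. snd (snd q) x - g x) < ennreal (en n)"
    unfolding split_paired_Ex by simp
  from choice[OF this] obtain q where q: "\<And>n. C1_grad (fst (q n)) (fst (snd (q n))) \<and> snd (snd (q n)) \<in> borel_measurable borel \<and>
      (\<forall>x\<in>cball x0 \<sigma>. fst (snd (q n)) x = snd (snd (q n)) x) \<and>
      Lpn p (\<lambda>x. fst (q n) x - u x) < ennreal (en n) \<and> Lpn p (\<lambda>x. snd (snd (q n)) x - g x) < ennreal (en n)"
    by (elim exE) (rule that, erule spec)
  define v where "v n = fst (q n)" for n
  define Dv where "Dv n = fst (snd (q n))" for n
  define gm where "gm n = snd (snd (q n))" for n
  have v: "C1_grad (v n) (Dv n)" and gm[measurable]: "gm n \<in> borel_measurable borel"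
    and vg: "x \<in> cball x0 \<sigma> \<Longrightarrow> Dv n x = gm n x"
    and vu: "Lpn p (\<lambda>x. v n x - u x) < ennreal (en n)" and gg: "Lpn p (\<lambda>x. gm n x - g x) < ennreal (en n)" for n x
    using q[of n] by (simp_all add: v_def Dv_def gm_def)
  have [measurable]: "v n \<in> borel_measurable borel" for n using C1_grad_measurable[OF v] by auto
  have E0: "(\<lambda>n. ennreal (en n)) \<longlonglongrightarrow> 0" using tendsto_ennrealI[OF en0] by simp
  have vu0: "(\<lambda>n. Lpn p (\<lambda>x. v n x - u x)) \<longlonglongrightarrow> 0"
    by (rule tendsto_sandwich[OF _ _ tendsto_const E0]) (auto intro!: always_eventually less_imp_le vu)
  have gg0: "(\<lambda>n. Lpn p (\<lambda>x. gm n x - g x)) \<longlonglongrightarrow> 0"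
    by (rule tendsto_sandwich[OF _ _ tendsto_const E0]) (auto intro!: always_eventually less_imp_le gg)
  obtain r where r: "strict_mono r" "AE x in lborel. (\<lambda>n. v (r n) x - u x) \<longlonglongrightarrow> 0"
  proof (rule Lpn_tendsto_AE_subseq[of "\<lambda>n x. v n x - u x" p])
    show "Lpn p (\<lambda>x. v n x - u x) < \<infinity>" for n by (rule less_trans[OF vu]) simp
    show "(\<lambda>x. v n x - u x) \<in> borel_measurable borel" for n by measurable
    show "p > 0" using p by simp
  qed (use vu0 in blast)+
  define h where "h n x = F (v n x) * \<zeta> x" for n x
  define H where "H n x = (F' (v n x) * \<zeta> x) *\<^sub>R Dv n x + F (v n x) *\<^sub>R D\<zeta> x" for n x
  have hH: "C1_grad (h n) (H n)" for n unfolding h_def[abs_def] H_def[abs_def] by (rule C1_grad_chain_mult[OF v z(1) F(1,2)])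
  \<comment> \<open>\<zeta> vanishes off the smaller ball, so the true gradient of v_n may be
    replaced everywhere by the mollified g.\<close>
  have Heq: "H n x = (F' (v n x) * \<zeta> x) *\<^sub>R gm n x + F (v n x) *\<^sub>R D\<zeta> x" for n x
    using vg[of x n] z(2)[of x] by (cases "x \<in> cball x0 \<sigma>") (auto simp: H_def)
  define T1 where "T1 n x = ((F' (u x) - F' (v n x)) * \<zeta> x) *\<^sub>R g x" for n x
  define T2 where "T2 n x = (F' (v n x) * \<zeta> x) *\<^sub>R (g x - gm n x)" for n x
  define T3 where "T3 n x = (F (u x) - F (v n x)) *\<^sub>R D\<zeta> x" for n x
  have [measurable]: "T1 n \<in> borel_measurable borel" "T2 n \<in> borel_measurable borel" "T3 n \<in> borel_measurable borel" for n
    unfolding T1_def[abs_def] T2_def[abs_def] T3_def[abs_def] by measurable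
  have T1: "(\<lambda>n. Lpn p (T1 (r n))) \<longlonglongrightarrow> 0"
  proof (rule Lpn_dominated[where g = "\<lambda>x. M1 *\<^sub>R g x"])
    show "norm (T1 (r n) x) \<le> norm (M1 *\<^sub>R g x)" for n x
    proof -
      have "\<bar>F' (u x) - F' (v (r n) x)\<bar> \<le> 1" using F(3,4)[of "u x"] F(3,4)[of "v (r n) x"] by linarith
      then have "\<bar>F' (u x) - F' (v (r n) x)\<bar> * \<bar>\<zeta> x\<bar> \<le> 1 * M1" using M1(2)[of x] by (intro mult_mono) auto
      then show ?thesis using M1(1) by (simp add: T1_def abs_mult mult_right_mono)
    qed
    show "Lpn p (\<lambda>x. M1 *\<^sub>R g x) < \<infinity>" using gp by (simp add: Lpn_scale ennreal_mult_less_top)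
    show "AE x in lborel. (\<lambda>n. T1 (r n) x) \<longlonglongrightarrow> 0"
      using r(2)
    proof eventually_elim
      fix x assume "(\<lambda>n. v (r n) x - u x) \<longlonglongrightarrow> 0"
      then have "(\<lambda>n. v (r n) x) \<longlonglongrightarrow> u x" by (simp add: LIM_zero_iff)
      moreover have "isCont F' (u x)" using F(2) by (simp add: continuous_on_eq_continuous_at)
      ultimately have "(\<lambda>n. F' (v (r n) x)) \<longlonglongrightarrow> F' (u x)" by (rule isCont_tendsto_compose[rotated])
      then have "(\<lambda>n. T1 (r n) x) \<longlonglongrightarrow> ((F' (u x) - F' (u x)) * \<zeta> x) *\<^sub>R g x"
        unfolding T1_def by (intro tendsto_intros)
      then show "(\<lambda>n. T1 (r n) x) \<longlonglongrightarrow> 0" by simp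
    qed
  qed (use p in auto)
  have T2: "Lpn p (T2 n) \<le> ennreal (M1 powr p) * Lpn p (\<lambda>x. gm n x - g x)" for n
  proof (rule Lpn_mult_bound)
    show "norm (T2 n x) \<le> M1 * norm (gm n x - g x)" for x
      using mult_mono[of "F' (v n x)" 1 "\<bar>\<zeta> x\<bar>" M1] M1 F(3,4)[of "v n x"]
      by (simp add: T2_def abs_mult norm_minus_commute mult_right_mono)
  qed (use M1 p in auto)
  have T3: "Lpn p (T3 n) \<le> ennreal (M2 powr p) * Lpn p (\<lambda>x. v n x - u x)" for n
  proof (rule Lpn_mult_bound)
    show "norm (T3 n x) \<le> M2 * norm (v n x - u x)" for x
      using mult_mono[OF FL[of "u x" "v n x"] M2(2)[of x]] by (simp add: T3_def mult.commute abs_minus_commute)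
  qed (use M2 p in auto)
  have h3: "Lpn p (\<lambda>x. F (u x) * \<zeta> x - h n x) \<le> ennreal (M1 powr p) * Lpn p (\<lambda>x. v n x - u x)" for n
  proof (rule Lpn_mult_bound)
    show "norm (F (u x) * \<zeta> x - h n x) \<le> M1 * norm (v n x - u x)" for x
    proof -
      have "F (u x) * \<zeta> x - h n x = (F (u x) - F (v n x)) * \<zeta> x" by (simp add: h_def left_diff_distrib)
      then show ?thesis using mult_mono[OF FL[of "u x" "v n x"] M1(2)[of x]]
        by (simp add: abs_mult mult.commute abs_minus_commute)
    qed
  qed (use M1 p in auto)
  let ?G = "\<lambda>x. (F' (u x) * \<zeta> x) *\<^sub>R g x + F (u x) *\<^sub>R D\<zeta> x"
  have Gd: "?G x - H n x = T1 n x + (T2 n x + T3 n x)" for n x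
    unfolding Heq T1_def T2_def T3_def by (simp add: algebra_simps)
  have G3: "Lpn p (\<lambda>x. ?G x - H n x) \<le> ennreal (2 powr p) * (Lpn p (T1 n) + ennreal (2 powr p) *
      (ennreal (M1 powr p) * Lpn p (\<lambda>x. gm n x - g x) + ennreal (M2 powr p) * Lpn p (\<lambda>x. v n x - u x)))" for n
  proof -
    have "Lpn p (\<lambda>x. ?G x - H n x) \<le> ennreal (2 powr p) * (Lpn p (T1 n) + Lpn p (\<lambda>x. T2 n x + T3 n x))"
      unfolding Gd using p by (intro Lpn_add) auto
    also have "Lpn p (\<lambda>x. T2 n x + T3 n x) \<le> ennreal (2 powr p) * (Lpn p (T2 n) + Lpn p (T3 n))"
      using p by (intro Lpn_add) auto
    also have "\<dots> \<le> ennreal (2 powr p) * (ennreal (M1 powr p) * Lpn p (\<lambda>x. gm n x - g x) + ennreal (M2 powr p) * Lpn p (\<lambda>x. v n x - u x))"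
      using T2 T3 by (intro mult_left_mono add_mono) auto
    finally show ?thesis by (simp add: mult_left_mono add_left_mono)
  qed
  have vr0: "(\<lambda>n. Lpn p (\<lambda>x. v (r n) x - u x)) \<longlonglongrightarrow> 0" and gr0: "(\<lambda>n. Lpn p (\<lambda>x. gm (r n) x - g x)) \<longlonglongrightarrow> 0"
    using LIMSEQ_subseq_LIMSEQ[OF vu0 r(1)] LIMSEQ_subseq_LIMSEQ[OF gg0 r(1)] by (auto simp: o_def)
  have L1: "(\<lambda>n. ennreal (M1 powr p) * Lpn p (\<lambda>x. v (r n) x - u x)) \<longlonglongrightarrow> ennreal (M1 powr p) * 0"
    by (intro ennreal_tendsto_cmult vr0) auto
  have L2: "(\<lambda>n. ennreal (2 powr p) * (Lpn p (T1 (r n)) + ennreal (2 powr p) *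
      (ennreal (M1 powr p) * Lpn p (\<lambda>x. gm (r n) x - g x) + ennreal (M2 powr p) * Lpn p (\<lambda>x. v (r n) x - u x))))
      \<longlonglongrightarrow> ennreal (2 powr p) * (0 + ennreal (2 powr p) * (ennreal (M1 powr p) * 0 + ennreal (M2 powr p) * 0))"
    by (intro ennreal_tendsto_cmult tendsto_add vr0 gr0 T1) auto
  have h0: "(\<lambda>n. Lpn p (\<lambda>x. F (u x) * \<zeta> x - h (r n) x)) \<longlonglongrightarrow> 0"
    by (rule tendsto_sandwich[OF _ _ tendsto_const L1[unfolded mult_zero_right]]) (auto intro!: always_eventually h3)
  have G0: "(\<lambda>n. Lpn p (\<lambda>x. ?G x - H (r n) x)) \<longlonglongrightarrow> 0"
    by (rule tendsto_sandwich[OF _ _ tendsto_const L2[unfolded mult_zero_right add_0_left mult_zero_right]]) (auto intro!: always_eventually G3)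
  show ?thesis
    unfolding W1p_approx_def
  proof (intro conjI allI impI)
    fix e :: real assume e: "e > 0"
    have "\<forall>\<^sub>F n in sequentially. Lpn p (\<lambda>x. F (u x) * \<zeta> x - h (r n) x) < ennreal e \<and> Lpn p (\<lambda>x. ?G x - H (r n) x) < ennreal e"
      using e by (intro eventually_conj order_tendstoD(2)[OF h0] order_tendstoD(2)[OF G0]) auto
    then obtain n where "Lpn p (\<lambda>x. F (u x) * \<zeta> x - h (r n) x) < ennreal e" "Lpn p (\<lambda>x. ?G x - H (r n) x) < ennreal e"
      by (auto simp: eventually_sequentially)
    then show "\<exists>h D. C1_grad h D \<and> (\<forall>x. x \<notin> cball x0 \<sigma> \<longrightarrow> h x = 0) \<and>
        Lpn p (\<lambda>x. F (u x) * \<zeta> x - h x) < ennreal e \<and> Lpn p (\<lambda>x. ?G x - D x) < ennreal e"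
      using hH[of "r n"] z(2) by (intro exI[of _ "h (r n)"] exI[of _ "H (r n)"]) (auto simp: h_def)
  qed measurable
qed

text \<open>Squaring removes the kink of the positive part; both the regularised truncation and the
  cutoff profile are built from this function.\<close>

lemma sq_pos_part_derivative:
  "((\<lambda>t::real. (max 0 (t - k))\<^sup>2) has_real_derivative 2 * max 0 (t - k)) (at t)"
proof -
  consider "t > k" | "t < k" | "t = k" by linarith
  then show ?thesis
  proof cases
    case 1
    have "((\<lambda>t. (t - k)\<^sup>2) has_real_derivative 2 * max 0 (t - k)) (at t)"
      using 1 by (auto intro!: derivative_eq_intros)
    then show ?thesis
      by (rule has_field_derivative_transform_within_open[of _ _ _ "{k<..}"]) (use 1 in auto)
  next
    case 2
    have "((\<lambda>t. 0) has_real_derivative 2 * max 0 (t - k)) (at t)" using 2 by auto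
    then show ?thesis
      by (rule has_field_derivative_transform_within_open[of _ _ _ "{..<k}"]) (use 2 in auto)
  next
    case 3
    have "((\<lambda>h. ((max 0 (t + h - k))\<^sup>2 - (max 0 (t - k))\<^sup>2) / h) \<longlongrightarrow> 0) (at 0)"
    proof (rule Lim_null_comparison[of _ "\<lambda>h. \<bar>h\<bar>"])
      show "\<forall>\<^sub>F h in at 0. norm (((max 0 (t + h - k))\<^sup>2 - (max 0 (t - k))\<^sup>2) / h) \<le> \<bar>h\<bar>"
        by (rule always_eventually) (auto simp: 3 max_def power2_eq_square abs_mult)
    qed (auto intro!: tendsto_eq_intros)
    then show ?thesis using 3 by (simp add: DERIV_def)
  qed
qed

text \<open>With m = (t - k)_+, the functions sqrt(m^2 + e^2) - e are C^1, stay within e of m and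
  have slope in [0, 1]. Their slopes converge at every t, with value 0 at t = k, so the limit
  gradient comes out as 0 on the level set u = k without a separate argument.\<close>

theorem W1p_approx_truncation:
  fixes u :: "'a::euclidean_space \<Rightarrow> real"
  assumes u[measurable]: "u \<in> borel_measurable borel" and up: "Lpn p u < \<infinity>" and us: "\<And>x. x \<notin> cball x0 R \<Longrightarrow> u x = 0"
    and g[measurable]: "g \<in> borel_measurable borel" and gp: "Lpn p g < \<infinity>" and gs: "\<And>x. x \<notin> cball x0 R \<Longrightarrow> g x = 0"
    and w: "wgrad_on (ball x0 R) u g" and p: "p > 1"
    and z: "C1_grad \<zeta> D\<zeta>" "\<And>x. x \<notin> cball x0 \<sigma> \<Longrightarrow> \<zeta> x = 0" "\<sigma> < R"
  shows "W1p_approx p x0 \<sigma> (\<lambda>x. max 0 (u x - k) * \<zeta> x)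
     (\<lambda>x. (of_bool (u x > k) * \<zeta> x) *\<^sub>R g x + max 0 (u x - k) *\<^sub>R D\<zeta> x)"
proof -
  have zc: "continuous_on UNIV \<zeta>" "continuous_on UNIV D\<zeta>" using z C1_grad_continuous by (auto simp: C1_grad_def)
  note [measurable] = borel_measurable_continuous_onI[OF zc(1)] borel_measurable_continuous_onI[OF zc(2)]
  have Dzs: "D\<zeta> x = 0" if "x \<notin> cball x0 \<sigma>" for x using C1_grad_outside_support[OF z(1,2) that] .
  obtain M1 where M1: "M1 > 0" "\<And>x. norm (\<zeta> x) \<le> M1" using cball_support_bounded[OF zc(1) z(2)] by blast
  obtain M2 where M2: "M2 > 0" "\<And>x. norm (D\<zeta> x) \<le> M2" using cball_support_bounded[OF zc(2) Dzs] by blast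
  define en where "en n = 1 / (real n + 1)" for n
  have en: "en n > 0" for n by (simp add: en_def)
  have en0: "en \<longlonglongrightarrow> 0" unfolding en_def[abs_def]
      using LIMSEQ_Suc[OF lim_1_over_n[where 'a=real]] by (simp add: add.commute)
  define m where "m t = max 0 (t - k)" for t
  define F where "F n t = sqrt ((m t)\<^sup>2 + (en n)\<^sup>2) - en n" for n t
  define F' where "F' n t = m t / sqrt ((m t)\<^sup>2 + (en n)\<^sup>2)" for n t
  have m0: "m t \<ge> 0" for t by (simp add: m_def)
  have pos: "(m t)\<^sup>2 + (en n)\<^sup>2 > 0" for n t using en[of n] by (simp add: add_nonneg_pos)
  have mc: "continuous_on UNIV m" unfolding m_def[abs_def] by (intro continuous_intros)
  have Fd: "(F n has_real_derivative F' n t) (at t)" for n t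
  proof -
    have 1: "((\<lambda>t. (m t)\<^sup>2 + (en n)\<^sup>2) has_real_derivative 2 * m t + 0) (at t)"
      unfolding m_def by (intro DERIV_add DERIV_const sq_pos_part_derivative)
    from DERIV_diff[OF DERIV_chain2[OF DERIV_real_sqrt[OF pos[of t n]] 1] DERIV_const[of "en n"]]
    have 2: "((\<lambda>t. sqrt ((m t)\<^sup>2 + (en n)\<^sup>2) - en n) has_real_derivative
        (inverse (sqrt ((m t)\<^sup>2 + (en n)\<^sup>2)) / 2) * (2 * m t + 0) - 0) (at t)" .
    show ?thesis unfolding F_def[abs_def] F'_def using 2 by (rule DERIV_cong) (simp only: divide_inverse, algebra)
  qed
  have F'c: "continuous_on UNIV (F' n)" for n
    unfolding F'_def[abs_def] using pos[of _ n] by (intro continuous_intros mc) (auto simp: less_imp_neq[symmetric])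
  have F'01: "0 \<le> F' n t" "F' n t \<le> 1" for n t
  proof -
    have "m t = sqrt ((m t)\<^sup>2)" using m0 by simp
    also have "\<dots> \<le> sqrt ((m t)\<^sup>2 + (en n)\<^sup>2)" by (intro real_sqrt_le_mono) simp
    finally show "F' n t \<le> 1" using pos[of t n] by (simp add: F'_def)
    show "0 \<le> F' n t" using m0 by (simp add: F'_def)
  qed
  have Fm: "\<bar>m t - F n t\<bar> \<le> en n" for n t
  proof -
    have "m t = sqrt ((m t)\<^sup>2)" using m0 by simp
    also have "\<dots> \<le> sqrt ((m t)\<^sup>2 + (en n)\<^sup>2)" by (intro real_sqrt_le_mono) simp
    finally have "m t \<le> sqrt ((m t)\<^sup>2 + (en n)\<^sup>2)" .
    moreover have "sqrt ((m t)\<^sup>2 + (en n)\<^sup>2) \<le> m t + en n"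
      using m0[of t] en[of n] by (intro real_le_lsqrt) (auto simp: power2_sum)
    ultimately show ?thesis using en[of n] by (auto simp: F_def)
  qed
  have F'lim: "(\<lambda>n. F' n t) \<longlonglongrightarrow> of_bool (t > k)" for t
  proof (cases "t > k")
    case True
    have "(\<lambda>n. m t / sqrt ((m t)\<^sup>2 + (en n)\<^sup>2)) \<longlonglongrightarrow> m t / sqrt ((m t)\<^sup>2 + 0\<^sup>2)"
      using True by (intro tendsto_intros en0) (auto simp: m_def)
    then show ?thesis using True by (simp add: F'_def m_def)
  qed (simp_all add: F'_def m_def)
  have mm[measurable]: "m \<in> borel_measurable borel" by (rule borel_measurable_continuous_onI[OF mc])
  have [measurable]: "F n \<in> borel_measurable borel" "F' n \<in> borel_measurable borel" for n
    using DERIV_continuous_on[OF Fd] F'c by (auto intro!: borel_measurable_continuous_onI)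
  have [measurable]: "(\<lambda>x. of_bool (u x > k) :: real) \<in> borel_measurable borel" by measurable
  define G where "G = (\<lambda>x. (of_bool (u x > k) * \<zeta> x) *\<^sub>R g x + m (u x) *\<^sub>R D\<zeta> x)"
  define Gn where "Gn n = (\<lambda>x. (F' n (u x) * \<zeta> x) *\<^sub>R g x + F n (u x) *\<^sub>R D\<zeta> x)" for n
  define T1 where "T1 n = (\<lambda>x. ((of_bool (u x > k) - F' n (u x)) * \<zeta> x) *\<^sub>R g x)" for n
  define T2 where "T2 n = (\<lambda>x. (m (u x) - F n (u x)) *\<^sub>R D\<zeta> x)" for n
  have Gm[measurable]: "G \<in> borel_measurable borel" "T1 n \<in> borel_measurable borel" "T2 n \<in> borel_measurable borel" for n
    unfolding G_def T1_def T2_def by measurable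
  have Gd: "G x - Gn n x = T1 n x + T2 n x" for n x
    unfolding G_def Gn_def T1_def T2_def by (simp add: algebra_simps)
  have T1: "(\<lambda>n. Lpn p (T1 n)) \<longlonglongrightarrow> 0"
  proof (rule Lpn_dominated[where g = "\<lambda>x. M1 *\<^sub>R g x"])
    show "norm (T1 n x) \<le> norm (M1 *\<^sub>R g x)" for n x
    proof -
      have "\<bar>of_bool (u x > k) - F' n (u x)\<bar> \<le> 1" using F'01[of n "u x"] by (cases "u x > k") auto
      then have "\<bar>of_bool (u x > k) - F' n (u x)\<bar> * \<bar>\<zeta> x\<bar> \<le> 1 * M1" using M1(2)[of x] by (intro mult_mono) auto
      then show ?thesis using M1(1) by (simp add: T1_def abs_mult mult_right_mono)
    qed
    show "Lpn p (\<lambda>x. M1 *\<^sub>R g x) < \<infinity>" using gp by (simp add: Lpn_scale ennreal_mult_less_top)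
    have "(\<lambda>n. T1 n x) \<longlonglongrightarrow> ((of_bool (u x > k) - of_bool (u x > k)) * \<zeta> x) *\<^sub>R g x" for x
      unfolding T1_def by (intro tendsto_intros F'lim)
    then show "AE x in lborel. (\<lambda>n. T1 n x) \<longlonglongrightarrow> 0" by simp
  qed (use p in auto)
  define V where "V = emeasure lborel (cball x0 \<sigma>)"
  have V: "V < \<infinity>" unfolding V_def by (rule emeasure_lborel_cball_finite)
  have small: "(\<lambda>n. ennreal ((en n * M) powr p) * V) \<longlonglongrightarrow> 0" if "M \<ge> 0" for M
  proof -
    have "(\<lambda>n. (en n * M) powr p) \<longlonglongrightarrow> (0 * M) powr p"
      using p en that by (intro tendsto_powr' tendsto_intros en0) (auto intro!: always_eventually simp: less_imp_le)
    then have "(\<lambda>n. ennreal ((en n * M) powr p)) \<longlonglongrightarrow> ennreal 0" using p by (intro tendsto_ennrealI) simp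
    then have "(\<lambda>n. V * ennreal ((en n * M) powr p)) \<longlonglongrightarrow> V * ennreal 0"
      using V by (intro ennreal_tendsto_cmult) auto
    then show ?thesis by (simp add: mult.commute)
  qed
  have T2: "(\<lambda>n. Lpn p (T2 n)) \<longlonglongrightarrow> 0"
  proof (rule tendsto_sandwich[OF _ _ tendsto_const small[OF less_imp_le[OF M2(1)]]])
    have "Lpn p (T2 n) \<le> ennreal ((en n * M2) powr p) * V" for n
      unfolding V_def
    proof (rule Lpn_bound_on)
      show "norm (T2 n x) \<le> en n * M2" for x
        using mult_mono[OF Fm[of "u x" n] M2(2)[of x]] en[of n] by (simp add: T2_def)
    qed (use p Dzs in \<open>auto simp: T2_def\<close>)
    then show "\<forall>\<^sub>F n in sequentially. Lpn p (T2 n) \<le> ennreal ((en n * M2) powr p) * V" by simp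
  qed auto
  have f0: "(\<lambda>n. Lpn p (\<lambda>x. m (u x) * \<zeta> x - F n (u x) * \<zeta> x)) \<longlonglongrightarrow> 0"
  proof (rule tendsto_sandwich[OF _ _ tendsto_const small[OF less_imp_le[OF M1(1)]]])
    have "Lpn p (\<lambda>x. m (u x) * \<zeta> x - F n (u x) * \<zeta> x) \<le> ennreal ((en n * M1) powr p) * V" for n
      unfolding V_def
    proof (rule Lpn_bound_on)
      show "norm (m (u x) * \<zeta> x - F n (u x) * \<zeta> x) \<le> en n * M1" for x
        using mult_mono[OF Fm[of "u x" n] M1(2)[of x]] en[of n] by (simp add: left_diff_distrib[symmetric] abs_mult)
    qed (use p z(2) in auto)
    then show "\<forall>\<^sub>F n in sequentially. Lpn p (\<lambda>x. m (u x) * \<zeta> x - F n (u x) * \<zeta> x) \<le> ennreal ((en n * M1) powr p) * V" by simp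
  qed auto
  have "(\<lambda>n. ennreal (2 powr p) * (Lpn p (T1 n) + Lpn p (T2 n))) \<longlonglongrightarrow> ennreal (2 powr p) * (0 + 0)"
    by (intro ennreal_tendsto_cmult tendsto_add T1 T2) auto
  then have TT: "(\<lambda>n. ennreal (2 powr p) * (Lpn p (T1 n) + Lpn p (T2 n))) \<longlonglongrightarrow> 0" by simp
  have G0: "(\<lambda>n. Lpn p (\<lambda>x. G x - Gn n x)) \<longlonglongrightarrow> 0"
  proof (rule tendsto_sandwich[OF _ _ tendsto_const TT])
    show "\<forall>\<^sub>F n in sequentially. Lpn p (\<lambda>x. G x - Gn n x) \<le> ennreal (2 powr p) * (Lpn p (T1 n) + Lpn p (T2 n))"
      unfolding Gd using p by (intro always_eventually allI Lpn_add) auto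
  qed auto
  have "W1p_approx p x0 \<sigma> (\<lambda>x. m (u x) * \<zeta> x) G"
  proof (rule W1p_approx_closed)
    fix e :: real assume e: "e > 0"
    have "\<forall>\<^sub>F n in sequentially. Lpn p (\<lambda>x. m (u x) * \<zeta> x - F n (u x) * \<zeta> x) < ennreal e \<and> Lpn p (\<lambda>x. G x - Gn n x) < ennreal e"
      using e by (intro eventually_conj order_tendstoD(2)[OF f0] order_tendstoD(2)[OF G0]) auto
    then obtain n where n: "Lpn p (\<lambda>x. m (u x) * \<zeta> x - F n (u x) * \<zeta> x) < ennreal e" "Lpn p (\<lambda>x. G x - Gn n x) < ennreal e"
      by (auto simp: eventually_sequentially)
    have "W1p_approx p x0 \<sigma> (\<lambda>x. F n (u x) * \<zeta> x) (Gn n)"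
      unfolding Gn_def by (rule W1p_approx_chain[OF u up us g gp gs w p z Fd F'c F'01])
    with n show "\<exists>f' G'. W1p_approx p x0 \<sigma> f' G' \<and> Lpn p (\<lambda>x. m (u x) * \<zeta> x - f' x) < ennreal e \<and> Lpn p (\<lambda>x. G x - G' x) < ennreal e"
      by blast
  qed (use p in auto)
  then show ?thesis by (simp add: G_def m_def)
qed


section \<open>The Faber--Krahn inequality\<close>

text \<open>Fundamental theorem along the segment from x to x + v, Jensen on [0, 1], and Tonelli
  with translation invariance in x.\<close>

lemma C1_grad_translation_Lp:
  fixes h :: "'a::euclidean_space \<Rightarrow> real"
  assumes C: "C1_grad h D" and p: "p > 1"
  shows "Lpn p (\<lambda>x. h (x + v) - h x) \<le> ennreal (norm v powr p) * Lpn p D"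
proof -
  have Dc: "continuous_on UNIV D" using C by (simp add: C1_grad_def)
  have [measurable]: "D \<in> borel_measurable borel" using C1_grad_measurable[OF C] by simp
  have pt: "ennreal (norm (h (x + v) - h x) powr p) \<le>
     (\<integral>\<^sup>+t. ennreal (indicat_real {0..1::real} t) * ennreal (norm (D (x + t *\<^sub>R v)) powr p * norm v powr p) \<partial>lborel)" for x
  proof -
    let ?F = "\<lambda>t. D (x + t *\<^sub>R v) \<bullet> v"
    have Fc: "continuous_on UNIV ?F"
      by (intro continuous_intros continuous_on_compose2[OF Dc]) auto
    have eq: "(\<integral>t. indicat_real {0..1::real} t *\<^sub>R ?F t \<partial>lborel) = h (x + v) - h x"
      using integral_FTC_Icc_real[of 0 1 "\<lambda>t. h (x + t *\<^sub>R v)" ?F] C1_grad_line[OF C, of x v _ UNIV] Fc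
      by (simp add: mult.commute continuous_on_eq_continuous_at)
    have "ennreal (norm (\<integral>t. indicat_real {0..1::real} t *\<^sub>R ?F t \<partial>lborel) powr p)
        \<le> (\<integral>\<^sup>+t. ennreal (indicat_real {0..1::real} t * norm (?F t) powr p) \<partial>lborel)"
      by (rule Jensen_powr) (use p borel_measurable_continuous_onI[OF Fc] in auto)
    also have "\<dots> \<le> (\<integral>\<^sup>+t. ennreal (indicat_real {0..1::real} t) * ennreal (norm (D (x + t *\<^sub>R v)) powr p * norm v powr p) \<partial>lborel)"
    proof (rule nn_integral_mono)
      fix t
      have "norm (?F t) powr p \<le> (norm (D (x + t *\<^sub>R v)) * norm v) powr p"
        using p by (intro powr_mono2) (auto intro: Cauchy_Schwarz_ineq2)
      then have "indicat_real {0..1::real} t * norm (?F t) powr p \<le> indicat_real {0..1::real} t * (norm (D (x + t *\<^sub>R v)) powr p * norm v powr p)"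
        by (intro mult_left_mono) (auto simp: powr_mult)
      then show "ennreal (indicat_real {0..1::real} t * norm (?F t) powr p)
        \<le> ennreal (indicat_real {0..1::real} t) * ennreal (norm (D (x + t *\<^sub>R v)) powr p * norm v powr p)"
        by (subst ennreal_mult[symmetric]) (auto intro!: ennreal_leI)
    qed
    finally show ?thesis unfolding eq .
  qed
  have "Lpn p (\<lambda>x. h (x + v) - h x) \<le> (\<integral>\<^sup>+x. \<integral>\<^sup>+t. ennreal (indicat_real {0..1::real} t) * ennreal (norm (D (x + t *\<^sub>R v)) powr p * norm v powr p) \<partial>lborel \<partial>lborel)"
    unfolding Lpn_def by (intro nn_integral_mono pt)
  also have "\<dots> = (\<integral>\<^sup>+t. \<integral>\<^sup>+x. ennreal (indicat_real {0..1::real} t) * ennreal (norm (D (x + t *\<^sub>R v)) powr p * norm v powr p) \<partial>lborel \<partial>lborel)"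
    by (rule lborel_pair.Fubini'[symmetric]) simp
  also have "\<dots> = (\<integral>\<^sup>+t. ennreal (indicat_real {0..1::real} t) * (ennreal (norm v powr p) * Lpn p D) \<partial>lborel)"
  proof (rule nn_integral_cong)
    fix t
    have "(\<integral>\<^sup>+x. ennreal (norm (D (x + t *\<^sub>R v)) powr p) \<partial>lborel) = Lpn p D"
      unfolding Lpn_def using nn_integral_lborel_shift[of "\<lambda>x. ennreal (norm (D x) powr p)" "t *\<^sub>R v"] by (simp add: add.commute)
    moreover have "(\<integral>\<^sup>+x. ennreal (indicat_real {0..1::real} t) * ennreal (norm (D (x + t *\<^sub>R v)) powr p * norm v powr p) \<partial>lborel)
       = ennreal (indicat_real {0..1::real} t) * (ennreal (norm v powr p) * (\<integral>\<^sup>+x. ennreal (norm (D (x + t *\<^sub>R v)) powr p) \<partial>lborel))"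
      by (simp add: nn_integral_cmult ennreal_mult' mult.commute[of _ "norm v powr p"])
    ultimately show "(\<integral>\<^sup>+x. ennreal (indicat_real {0..1::real} t) * ennreal (norm (D (x + t *\<^sub>R v)) powr p * norm v powr p) \<partial>lborel)
       = ennreal (indicat_real {0..1::real} t) * (ennreal (norm v powr p) * Lpn p D)" by simp
  qed
  also have "\<dots> = ennreal (norm v powr p) * Lpn p D"
    by (simp add: nn_integral_multc ennreal_indicator)
  finally show ?thesis .
qed

lemma Lpn_shift:
  fixes f :: "'a::euclidean_space \<Rightarrow> 'b::euclidean_space"
  assumes [measurable]: "f \<in> borel_measurable borel"
  shows "Lpn p (\<lambda>x. f (x + v)) = Lpn p f"
  unfolding Lpn_def using nn_integral_lborel_shift[of "\<lambda>x. ennreal (norm (f x) powr p)" v] by (simp add: add.commute)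

lemma Lpn_minus_commute:
  fixes f g :: "'a::euclidean_space \<Rightarrow> 'b::euclidean_space"
  shows "Lpn p (\<lambda>x. f x - g x) = Lpn p (\<lambda>x. g x - f x)"
  unfolding Lpn_def by (simp add: norm_minus_commute)

lemma W1p_approx_finite:
  assumes "W1p_approx p x0 R f G" "p > 1"
  shows "Lpn p f < \<infinity>" "Lpn p G < \<infinity>"
proof -
  obtain h D where hD: "C1_grad h D" "\<And>x. x \<notin> cball x0 R \<Longrightarrow> h x = 0"
      "Lpn p (\<lambda>x. f x - h x) < ennreal 1" "Lpn p (\<lambda>x. G x - D x) < ennreal 1"
    and m: "f \<in> borel_measurable borel" "G \<in> borel_measurable borel"
    using assms(1) unfolding W1p_approx_def by (metis zero_less_one)
  note hm = C1_grad_measurable[OF hD(1)]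
  have c: "continuous_on UNIV h" "continuous_on UNIV D" using hD(1) C1_grad_continuous by (auto simp: C1_grad_def)
  have Ds: "D x = 0" if "x \<notin> cball x0 R" for x using C1_grad_outside_support[OF hD(1,2) that] .
  obtain M where M: "\<And>x. norm (h x) \<le> M" using cball_support_bounded[OF c(1) hD(2)] by blast
  obtain M' where M': "\<And>x. norm (D x) \<le> M'" using cball_support_bounded[OF c(2) Ds] by blast
  have V: "emeasure lborel (cball x0 R) < \<infinity>" by (rule emeasure_lborel_cball_finite)
  have h1: "Lpn p h < \<infinity>"
  proof (rule le_less_trans)
    show "Lpn p h \<le> ennreal (M powr p) * emeasure lborel (cball x0 R)"
      using assms(2) hD(2) M by (intro Lpn_bound_on) auto
    show "ennreal (M powr p) * emeasure lborel (cball x0 R) < \<infinity>" using V by (simp add: ennreal_mult_less_top)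
  qed
  have D1: "Lpn p D < \<infinity>"
  proof (rule le_less_trans)
    show "Lpn p D \<le> ennreal (M' powr p) * emeasure lborel (cball x0 R)"
      using assms(2) Ds M' by (intro Lpn_bound_on) auto
    show "ennreal (M' powr p) * emeasure lborel (cball x0 R) < \<infinity>" using V by (simp add: ennreal_mult_less_top)
  qed
  have "Lpn p f \<le> ennreal (2 powr p) * (Lpn p (\<lambda>x. f x - h x) + Lpn p h)"
    using Lpn_add[of "\<lambda>x. f x - h x" h p] m hm assms by simp
  also have "\<dots> < \<infinity>" using hD(3) h1 by (auto simp: ennreal_mult_less_top intro: less_trans)
  finally show "Lpn p f < \<infinity>" .
  have "Lpn p G \<le> ennreal (2 powr p) * (Lpn p (\<lambda>x. G x - D x) + Lpn p D)"
    using Lpn_add[of "\<lambda>x. G x - D x" D p] m hm assms by simp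
  also have "\<dots> < \<infinity>" using hD(4) D1 by (auto simp: ennreal_mult_less_top intro: less_trans)
  finally show "Lpn p G < \<infinity>" .
qed

text \<open>C^1 approximants transfer the classical estimate up to errors e that are sent to 0.
  Three uses of the quasi-triangle inequality contribute 2^p each, hence (8 |v|)^p.\<close>

lemma W1p_approx_translation:
  fixes f :: "'a::euclidean_space \<Rightarrow> real"
  assumes W: "W1p_approx p x0 R f G" and p: "p > 1"
  shows "Lpn p (\<lambda>x. f (x + v) - f x) \<le> ennreal ((8 * norm v) powr p) * Lpn p G"
proof -
  have m[measurable]: "f \<in> borel_measurable borel" "G \<in> borel_measurable borel" using W by (auto simp: W1p_approx_def)
  define c where "c = ennreal (2 powr p)"
  define N where "N = ennreal (norm v powr p)"
  have est: "Lpn p (\<lambda>x. f (x + v) - f x) \<le> c * (ennreal e + c * (N * (c * (ennreal e + Lpn p G)) + ennreal e))" if e: "e > 0" for e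
  proof -
    obtain h D where hD: "C1_grad h D" "Lpn p (\<lambda>x. f x - h x) < ennreal e" "Lpn p (\<lambda>x. G x - D x) < ennreal e"
      using W e unfolding W1p_approx_def by blast
    note [measurable] = C1_grad_measurable[OF hD(1)]
    have DG: "Lpn p D \<le> c * (ennreal e + Lpn p G)"
    proof -
      have "Lpn p D \<le> c * (Lpn p (\<lambda>x. D x - G x) + Lpn p G)"
        unfolding c_def using Lpn_add[of "\<lambda>x. D x - G x" G p] p by simp
      also have "\<dots> \<le> c * (ennreal e + Lpn p G)"
        using hD(3) Lpn_minus_commute[of p D G] by (intro mult_left_mono add_right_mono) auto
      finally show ?thesis .
    qed
    have "Lpn p (\<lambda>x. f (x + v) - f x) = Lpn p (\<lambda>x. (f (x + v) - h (x + v)) + ((h (x + v) - h x) + (h x - f x)))" by simp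
    also have "\<dots> \<le> c * (Lpn p (\<lambda>x. f (x + v) - h (x + v)) + Lpn p (\<lambda>x. (h (x + v) - h x) + (h x - f x)))"
      unfolding c_def using p by (intro Lpn_add) auto
    also have "Lpn p (\<lambda>x. f (x + v) - h (x + v)) = Lpn p (\<lambda>x. f x - h x)"
      using Lpn_shift[of "\<lambda>x. f x - h x" p v] by simp
    also have "c * (Lpn p (\<lambda>x. f x - h x) + Lpn p (\<lambda>x. (h (x + v) - h x) + (h x - f x)))
      \<le> c * (ennreal e + c * (Lpn p (\<lambda>x. h (x + v) - h x) + Lpn p (\<lambda>x. h x - f x)))"
      using p hD(2) unfolding c_def by (intro mult_left_mono add_mono Lpn_add) auto
    also have "\<dots> \<le> c * (ennreal e + c * (N * (c * (ennreal e + Lpn p G)) + ennreal e))"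
    proof (intro mult_left_mono add_mono)
      have "Lpn p (\<lambda>x. h (x + v) - h x) \<le> N * Lpn p D" unfolding N_def by (rule C1_grad_translation_Lp[OF hD(1) p])
      also have "\<dots> \<le> N * (c * (ennreal e + Lpn p G))" by (intro mult_left_mono DG) auto
      finally show "Lpn p (\<lambda>x. h (x + v) - h x) \<le> N * (c * (ennreal e + Lpn p G))" .
      show "Lpn p (\<lambda>x. h x - f x) \<le> ennreal e" using hD(2) Lpn_minus_commute[of p h f] by simp
    qed auto
    finally show ?thesis .
  qed
  have fin: "c < \<infinity>" "N < \<infinity>" by (auto simp: c_def N_def)
  have "(\<lambda>n. ennreal (1 / (real n + 1))) \<longlonglongrightarrow> ennreal 0"
    using LIMSEQ_Suc[OF lim_1_over_n[where 'a=real]] by (intro tendsto_ennrealI) (simp add: add.commute)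
  then have "(\<lambda>n. c * (ennreal (1 / (real n + 1)) + c * (N * (c * (ennreal (1 / (real n + 1)) + Lpn p G)) + ennreal (1 / (real n + 1)))))
     \<longlonglongrightarrow> c * (ennreal 0 + c * (N * (c * (ennreal 0 + Lpn p G)) + ennreal 0))"
    using fin by (intro ennreal_tendsto_cmult tendsto_add tendsto_const) auto
  then have "Lpn p (\<lambda>x. f (x + v) - f x) \<le> c * (ennreal 0 + c * (N * (c * (ennreal 0 + Lpn p G)) + ennreal 0))"
    by (rule LIMSEQ_le_const) (auto intro!: exI[of _ 0] est)
  also have "\<dots> = (c * c * c * N) * Lpn p G" by (simp add: mult_ac)
  also have "c * c * c * N = ennreal ((8 * norm v) powr p)"
    unfolding c_def N_def by (simp add: ennreal_mult[symmetric] powr_mult[symmetric])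
  finally show ?thesis .
qed

text \<open>The factor 2 is the reciprocal of the fraction of \<open>ball 0 r\<close> known to lead
  out of E, and (8 r)^p bounds the translation constant over that ball.\<close>

theorem Faber_Krahn:
  fixes f :: "'a::euclidean_space \<Rightarrow> real"
  assumes W: "W1p_approx p x0 R f G" and p: "p > 1"
    and E[measurable]: "E \<in> sets borel" and Es: "\<And>x. x \<notin> E \<Longrightarrow> f x = 0"
    and r: "r > 0" and mE: "2 * emeasure lborel E \<le> emeasure lborel (ball (0::'a) r)"
  shows "Lpn p f \<le> ennreal (2 * (8 * r) powr p) * Lpn p G"
proof -
  have m[measurable]: "f \<in> borel_measurable borel" "G \<in> borel_measurable borel" using W by (auto simp: W1p_approx_def)
  define b where "b = measure lborel (ball (0::'a) r)"
  have Bf: "emeasure lborel (ball (0::'a) r) < \<infinity>" by (rule emeasure_lborel_ball_finite)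
  have b: "emeasure lborel (ball (0::'a) r) = ennreal b"
    unfolding b_def by (rule emeasure_eq_ennreal_measure) (use Bf in auto)
  have bpos: "b > 0" unfolding b_def using r by (simp add: content_ball_pos)
  define e where "e = measure lborel E"
  have Ef: "emeasure lborel E < \<infinity>"
  proof -
    have "emeasure lborel E \<le> 2 * emeasure lborel E" by (simp add: mult_2)
    then show ?thesis using mE Bf by (meson le_less_trans)
  qed
  have e: "emeasure lborel E = ennreal e"
    unfolding e_def by (rule emeasure_eq_ennreal_measure) (use Ef in auto)
  have eb: "2 * e \<le> b"
  proof -
    have "ennreal (2 * e) \<le> ennreal b" using mE unfolding e b by (simp add: ennreal_mult' e_def)
    then show ?thesis using bpos by (simp add: ennreal_le_iff)
  qed
  define I where "I = indicat_real (ball (0::'a) r)"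
  have Im[measurable]: "I \<in> borel_measurable borel" unfolding I_def by (intro borel_measurable_indicator) auto
  \<comment> \<open>Whatever x is, the v in the ball with x + v outside E have measure at least b -
    e \<ge> b / 2, and there f(x + v) = 0, so the integrand is exactly |f(x)|^p.\<close>
  have pt: "ennreal (b / 2) * ennreal (norm (f x) powr p) \<le> (\<integral>\<^sup>+v. ennreal (I v) * ennreal (norm (f (x + v) - f x) powr p) \<partial>lborel)" for x
  proof -
    have shm: "(\<lambda>v. x + v) -` E \<in> sets borel" using measurable_sets_borel[OF _ E, of "\<lambda>v. x + v"] by simp
    have "emeasure lborel E = emeasure (distr lborel borel ((+) x)) E" by (simp add: lborel_distr_plus)
    then have A: "emeasure lborel ((\<lambda>v. x + v) -` E) = ennreal e"
      using E e by (simp add: emeasure_distr)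
    let ?S = "ball (0::'a) r - (\<lambda>v. x + v) -` E"
    have Sm: "?S \<in> sets borel" using shm by auto
    have "ennreal b \<le> emeasure lborel (?S \<union> (\<lambda>v. x + v) -` E)"
      unfolding b[symmetric] using shm Sm by (intro emeasure_mono) auto
    also have "\<dots> \<le> emeasure lborel ?S + ennreal e"
      unfolding A[symmetric] using shm Sm by (intro emeasure_subadditive) auto
    finally have S1: "ennreal b \<le> emeasure lborel ?S + ennreal e" .
    have Sf: "emeasure lborel ?S < \<infinity>"
      using emeasure_mono[of ?S "ball 0 r" lborel] Bf by (auto intro: le_less_trans)
    define s where "s = measure lborel ?S"
    have s: "emeasure lborel ?S = ennreal s"
      unfolding s_def by (rule emeasure_eq_ennreal_measure) (use Sf in auto)
    have s0: "s \<ge> 0" "e \<ge> 0" by (auto simp: s_def e_def)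
    have "ennreal b \<le> ennreal (s + e)" using S1 s0 unfolding s by simp
    then have "b \<le> s + e" using s0 by (subst (asm) ennreal_le_iff) auto
    then have bs: "ennreal (b / 2) \<le> emeasure lborel ?S" unfolding s using eb by (intro ennreal_leI) linarith
    have "ennreal (b / 2) * ennreal (norm (f x) powr p) \<le> emeasure lborel ?S * ennreal (norm (f x) powr p)"
      by (intro mult_right_mono bs) auto
    also have "\<dots> = (\<integral>\<^sup>+v. ennreal (norm (f x) powr p) * indicator ?S v \<partial>lborel)"
      using Sm by (simp add: nn_integral_cmult_indicator mult.commute)
    also have "\<dots> \<le> (\<integral>\<^sup>+v. ennreal (I v) * ennreal (norm (f (x + v) - f x) powr p) \<partial>lborel)"
    proof (rule nn_integral_mono)
      fix v
      show "ennreal (norm (f x) powr p) * indicator ?S v \<le> ennreal (I v) * ennreal (norm (f (x + v) - f x) powr p)"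
        using Es[of "x + v"] by (cases "v \<in> ?S") (auto simp: I_def)
    qed
    finally show ?thesis .
  qed
  have "ennreal (b / 2) * Lpn p f = (\<integral>\<^sup>+x. ennreal (b / 2) * ennreal (norm (f x) powr p) \<partial>lborel)"
    unfolding Lpn_def by (rule nn_integral_cmult[symmetric]) simp
  also have "\<dots> \<le> (\<integral>\<^sup>+x. \<integral>\<^sup>+v. ennreal (I v) * ennreal (norm (f (x + v) - f x) powr p) \<partial>lborel \<partial>lborel)"
    by (intro nn_integral_mono pt)
  also have "\<dots> = (\<integral>\<^sup>+v. \<integral>\<^sup>+x. ennreal (I v) * ennreal (norm (f (x + v) - f x) powr p) \<partial>lborel \<partial>lborel)"
    by (rule lborel_pair.Fubini'[symmetric]) simp
  also have "\<dots> = (\<integral>\<^sup>+v. ennreal (I v) * Lpn p (\<lambda>x. f (x + v) - f x) \<partial>lborel)"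
    unfolding Lpn_def by (simp add: nn_integral_cmult)
  also have "\<dots> \<le> (\<integral>\<^sup>+v. (ennreal ((8 * r) powr p) * Lpn p G) * indicator (ball (0::'a) r) v \<partial>lborel)"
  proof (rule nn_integral_mono)
    fix v :: 'a
    show "ennreal (I v) * Lpn p (\<lambda>x. f (x + v) - f x) \<le> (ennreal ((8 * r) powr p) * Lpn p G) * indicator (ball (0::'a) r) v"
    proof (cases "v \<in> ball 0 r")
      case True
      have "Lpn p (\<lambda>x. f (x + v) - f x) \<le> ennreal ((8 * norm v) powr p) * Lpn p G"
        by (rule W1p_approx_translation[OF W p])
      also have "\<dots> \<le> ennreal ((8 * r) powr p) * Lpn p G"
        using True p by (intro mult_right_mono ennreal_leI powr_mono2) auto
      finally show ?thesis using True by (simp add: I_def)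
    qed (simp add: I_def)
  qed
  also have "\<dots> = (ennreal ((8 * r) powr p) * Lpn p G) * ennreal b"
    using b by (simp add: nn_integral_cmult_indicator)
  finally have main: "ennreal (b / 2) * Lpn p f \<le> (ennreal ((8 * r) powr p) * Lpn p G) * ennreal b" .
  have "Lpn p f = ennreal (2 / b) * (ennreal (b / 2) * Lpn p f)"
    using bpos by (simp add: mult.assoc[symmetric] ennreal_mult[symmetric])
  also have "\<dots> \<le> ennreal (2 / b) * ((ennreal ((8 * r) powr p) * Lpn p G) * ennreal b)"
    using main by (intro mult_left_mono) auto
  also have "\<dots> = (ennreal (2 / b) * ennreal b * ennreal ((8 * r) powr p)) * Lpn p G" by (simp add: mult_ac)
  also have "ennreal (2 / b) * ennreal b * ennreal ((8 * r) powr p) = ennreal (2 * (8 * r) powr p)"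
    using bpos by (simp add: ennreal_mult[symmetric]) (simp add: ennreal_mult')
  finally show ?thesis .
qed


section \<open>Membership in W01p\<close>

text \<open>Passage between the set integrals over \<open>lebesgue\<close> used in the definitions
  and Borel integrals over the whole space, for functions extended by zero.\<close>

lemma set_lebesgue_borel:
  fixes F :: "'a::euclidean_space \<Rightarrow> 'b::euclidean_space"
  assumes "F \<in> borel_measurable borel" "\<And>x. x \<notin> U \<Longrightarrow> F x = 0"
  shows "set_integrable lebesgue U F \<longleftrightarrow> integrable lborel F" "(LINT x:U|lebesgue. F x) = (\<integral>x. F x \<partial>lborel)"
    "set_borel_measurable lebesgue U F"
proof -
  have eq: "(\<lambda>x. indicator U x *\<^sub>R F x) = F" using assms(2) by (auto simp: indicator_def)
  have m: "F \<in> borel_measurable lborel" using assms by simp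
  show "set_integrable lebesgue U F \<longleftrightarrow> integrable lborel F"
    unfolding set_integrable_def eq by (rule integrable_completion[OF m])
  show "(LINT x:U|lebesgue. F x) = (\<integral>x. F x \<partial>lborel)"
    unfolding set_lebesgue_integral_def eq by (rule integral_completion[OF m])
  show "set_borel_measurable lebesgue U F"
    unfolding set_borel_measurable_def eq using m by (rule measurable_completion)
qed

text \<open>For every t > 0, |f| \<le> t + t^(1-p) |f|^p: a small t controls the first part on the
  ball, and d is adapted to t for the second. This stands in for Hoelder's inequality.\<close>

lemma L1_small_of_Lp_small:
  fixes x0 :: "'a::euclidean_space"
  assumes p: "p > 1" and e: "e > 0"
  obtains d where "d > 0" "\<And>f :: 'a \<Rightarrow> 'b::euclidean_space. f \<in> borel_measurable borel \<Longrightarrow> (\<And>x. x \<notin> cball x0 R \<Longrightarrow> f x = 0) \<Longrightarrow>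
      Lpn p f < ennreal d \<Longrightarrow> integrable lborel f \<and> (\<integral>x. norm (f x) \<partial>lborel) < e"
proof -
  define V where "V = measure lborel (cball x0 R)"
  have V0: "V \<ge> 0" by (simp add: V_def)
  have V: "emeasure lborel (cball x0 R) = ennreal V"
    unfolding V_def by (rule emeasure_eq_ennreal_measure) (use emeasure_lborel_cball_finite[of x0 R] in auto)
  define t where "t = e / (2 * (V + 1))"
  have t: "t > 0" using e V0 by (simp add: t_def)
  define d where "d = t powr (p - 1) * (e / 2)"
  have d: "d > 0" using t e by (simp add: d_def)
  have main: "integrable lborel f \<and> (\<integral>x. norm (f x) \<partial>lborel) < e"
    if f[measurable]: "f \<in> borel_measurable borel" and fs: "\<And>x. x \<notin> cball x0 R \<Longrightarrow> f x = 0" and fd: "Lpn p f < ennreal d" for f :: "'a \<Rightarrow> 'b"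
  proof -
    have i: "integrable lborel f"
    proof (rule Lp_compact_integrable[OF f _ fs])
      show "Lpn p f < \<infinity>" by (rule less_trans[OF fd]) simp
    qed (use p in auto)
    have "(\<integral>\<^sup>+x. ennreal (norm (f x)) \<partial>lborel) \<le> (\<integral>\<^sup>+x. ennreal t * indicator (cball x0 R) x + ennreal (t powr (1 - p)) * ennreal (norm (f x) powr p) \<partial>lborel)"
    proof (rule nn_integral_mono)
      fix x
      show "ennreal (norm (f x)) \<le> ennreal t * indicator (cball x0 R) x + ennreal (t powr (1 - p)) * ennreal (norm (f x) powr p)"
      proof (cases "x \<in> cball x0 R")
        case True
        have "norm (f x) \<le> t + t powr (1 - p) * norm (f x) powr p"
        proof (cases "norm (f x) \<le> t")
          case True then show ?thesis by (simp add: add_increasing2)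
        next
          case False
          then have n: "norm (f x) > 0" using t by linarith
          have "t powr (p - 1) \<le> norm (f x) powr (p - 1)" using False t p by (intro powr_mono2) auto
          then have "t powr (1 - p) * t powr (p - 1) \<le> t powr (1 - p) * norm (f x) powr (p - 1)"
            by (intro mult_left_mono) auto
          then have "1 \<le> t powr (1 - p) * norm (f x) powr (p - 1)"
            using t by (simp add: powr_add[symmetric])
          then have "norm (f x) * 1 \<le> norm (f x) * (t powr (1 - p) * norm (f x) powr (p - 1))" by (intro mult_left_mono) auto
          also have "norm (f x) * (t powr (1 - p) * norm (f x) powr (p - 1)) = t powr (1 - p) * norm (f x) powr p"
            using n by (simp add: powr_diff)
          finally show ?thesis using t by simp
        qed
        then have "ennreal (norm (f x)) \<le> ennreal (t + t powr (1 - p) * norm (f x) powr p)" by (rule ennreal_leI)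
        then show ?thesis using True t by (simp add: ennreal_mult')
      qed (use fs in simp)
    qed
    also have "\<dots> = ennreal t * ennreal V + ennreal (t powr (1 - p)) * Lpn p f"
      by (subst nn_integral_add) (auto simp: nn_integral_cmult nn_integral_cmult_indicator Lpn_def V intro!: borel_measurable_indicator borel_measurable_times_ennreal)
    also have "\<dots> \<le> ennreal t * ennreal V + ennreal (t powr (1 - p)) * ennreal d"
      using fd by (intro add_left_mono mult_left_mono) auto
    also have "\<dots> = ennreal (t * V + t powr (1 - p) * d)"
      using t V0 d by (simp add: ennreal_mult')
    also have "t powr (1 - p) * d = e / 2" using t by (simp add: d_def powr_diff field_simps)
    finally have "ennreal (\<integral>x. norm (f x) \<partial>lborel) \<le> ennreal (t * V + e / 2)"
      using i by (subst (asm) nn_integral_eq_integral) auto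
    then have "(\<integral>x. norm (f x) \<partial>lborel) \<le> t * V + e / 2" using t V0 e by (subst (asm) ennreal_le_iff) auto
    also have "t * V < e / 2" using e V0 by (simp add: t_def field_simps)
    finally show ?thesis using i by simp
  qed
  show ?thesis using that[of d] d main by blast
qed

text \<open>On the ball \<phi> and its derivative are bounded by some M, so each side changes by at
  most M e when (f, G) is replaced by a C^1 pair that is e-close in L^1, and for that pair the
  identity is classical.\<close>

lemma W1p_approx_integration_by_parts:
  fixes f :: "'a::euclidean_space \<Rightarrow> real"
  assumes W: "W1p_approx p x0 \<sigma> f G" and p: "p > 1" and fs: "\<And>x. x \<notin> cball x0 \<sigma> \<Longrightarrow> f x = 0"
    and Gs: "\<And>x. x \<notin> cball x0 \<sigma> \<Longrightarrow> G x = 0" and \<phi>: "smooth_fun \<phi>" and i: "i \<in> Basis"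
  shows "integrable lborel (\<lambda>x. f x * partial \<phi> i x)" "integrable lborel (\<lambda>x. (G x \<bullet> i) * \<phi> x)"
    "(\<integral>x. f x * partial \<phi> i x \<partial>lborel) = - (\<integral>x. (G x \<bullet> i) * \<phi> x \<partial>lborel)"
proof -
  have m[measurable]: "f \<in> borel_measurable borel" "G \<in> borel_measurable borel" using W by (auto simp: W1p_approx_def)
  note c = smooth_funD(1,2)[OF \<phi> i]
  note [measurable] = borel_measurable_continuous_onI[OF c(1)] borel_measurable_continuous_onI[OF c(2)]
  have "bounded (\<phi> ` cball x0 \<sigma> \<union> partial \<phi> i ` cball x0 \<sigma>)"
    using c by (auto intro!: compact_imp_bounded compact_continuous_image intro: continuous_on_subset)
  then obtain M where M: "M > 0" "\<And>x. x \<in> cball x0 \<sigma> \<Longrightarrow> \<bar>\<phi> x\<bar> \<le> M" "\<And>x. x \<in> cball x0 \<sigma> \<Longrightarrow> \<bar>partial \<phi> i x\<bar> \<le> M"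
    unfolding bounded_pos by force
  have fi: "integrable lborel f" and Gi: "integrable lborel G"
    using Lp_compact_integrable[OF m(1) W1p_approx_finite(1)[OF W p] fs] Lp_compact_integrable[OF m(2) W1p_approx_finite(2)[OF W p] Gs] p by auto
  have b1: "\<bar>k x * partial \<phi> i x\<bar> \<le> M * norm (k x)" if "\<And>x. x \<notin> cball x0 \<sigma> \<Longrightarrow> k x = 0" for k :: "'a \<Rightarrow> real" and x
    using that[of x] M(3)[of x] by (cases "x \<in> cball x0 \<sigma>") (auto simp: abs_mult mult.commute[of M] intro!: mult_left_mono)
  have b2: "\<bar>(k x \<bullet> i) * \<phi> x\<bar> \<le> M * norm (k x)" if "\<And>x. x \<notin> cball x0 \<sigma> \<Longrightarrow> k x = 0" for k :: "'a \<Rightarrow> 'a" and x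
  proof (cases "x \<in> cball x0 \<sigma>")
    case True
    have "\<bar>k x \<bullet> i\<bar> * \<bar>\<phi> x\<bar> \<le> norm (k x) * M" using M(2)[OF True] Basis_le_norm[OF i, of "k x"] by (intro mult_mono) auto
    then show ?thesis by (simp add: abs_mult mult.commute)
  qed (use that in simp)
  have i1: "integrable lborel (\<lambda>x. k x * partial \<phi> i x)" if "integrable lborel k" "\<And>x. x \<notin> cball x0 \<sigma> \<Longrightarrow> k x = 0" for k :: "'a \<Rightarrow> real"
  proof (rule Bochner_Integration.integrable_bound[of _ "\<lambda>x. M * norm (k x)"])
    show "integrable lborel (\<lambda>x. M * norm (k x))" using that by auto
    show "(\<lambda>x. k x * partial \<phi> i x) \<in> borel_measurable lborel" using that(1) by measurable
    show "AE x in lborel. norm (k x * partial \<phi> i x) \<le> norm (M * norm (k x))"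
      using b1[OF that(2)] M(1) by (intro AE_I2) (simp add: abs_mult)
  qed
  have i2: "integrable lborel (\<lambda>x. (k x \<bullet> i) * \<phi> x)" if "integrable lborel k" "\<And>x. x \<notin> cball x0 \<sigma> \<Longrightarrow> k x = 0" for k :: "'a \<Rightarrow> 'a"
  proof (rule Bochner_Integration.integrable_bound[of _ "\<lambda>x. M * norm (k x)"])
    show "integrable lborel (\<lambda>x. M * norm (k x))" using that by auto
    show "(\<lambda>x. (k x \<bullet> i) * \<phi> x) \<in> borel_measurable lborel" using that(1) by measurable
    show "AE x in lborel. norm ((k x \<bullet> i) * \<phi> x) \<le> norm (M * norm (k x))"
      using b2[OF that(2)] M(1) by (intro AE_I2) (simp add: abs_mult)
  qed
  show I1: "integrable lborel (\<lambda>x. f x * partial \<phi> i x)" by (rule i1[OF fi fs])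
  show I2: "integrable lborel (\<lambda>x. (G x \<bullet> i) * \<phi> x)" by (rule i2[OF Gi Gs])
  let ?d = "(\<integral>x. f x * partial \<phi> i x \<partial>lborel) + (\<integral>x. (G x \<bullet> i) * \<phi> x \<partial>lborel)"
  have small: "\<bar>?d\<bar> \<le> 2 * M * e" if e: "e > 0" for e
  proof -
    obtain d1 where d1: "d1 > 0" "\<And>f :: 'a \<Rightarrow> real. f \<in> borel_measurable borel \<Longrightarrow> (\<And>x. x \<notin> cball x0 \<sigma> \<Longrightarrow> f x = 0) \<Longrightarrow>
      Lpn p f < ennreal d1 \<Longrightarrow> integrable lborel f \<and> (\<integral>x. norm (f x) \<partial>lborel) < e"
      using L1_small_of_Lp_small[OF p e, of x0 \<sigma>] by blast
    obtain d2 where d2: "d2 > 0" "\<And>f :: 'a \<Rightarrow> 'a. f \<in> borel_measurable borel \<Longrightarrow> (\<And>x. x \<notin> cball x0 \<sigma> \<Longrightarrow> f x = 0) \<Longrightarrow>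
      Lpn p f < ennreal d2 \<Longrightarrow> integrable lborel f \<and> (\<integral>x. norm (f x) \<partial>lborel) < e"
      using L1_small_of_Lp_small[OF p e, of x0 \<sigma>] by blast
    define d where "d = min d1 d2"
    have "d > 0" using d1 d2 by (simp add: d_def)
    then obtain h D where hD: "C1_grad h D" "\<forall>x. x \<notin> cball x0 \<sigma> \<longrightarrow> h x = 0"
        "Lpn p (\<lambda>x. f x - h x) < ennreal d" "Lpn p (\<lambda>x. G x - D x) < ennreal d"
      using W unfolding W1p_approx_def by blast
    have hs: "\<And>x. x \<notin> cball x0 \<sigma> \<Longrightarrow> h x = 0" using hD(2) by blast
    have Ds: "D x = 0" if "x \<notin> cball x0 \<sigma>" for x using C1_grad_outside_support[OF hD(1) hs that] .
    note hm[measurable] = C1_grad_measurable[OF hD(1)]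
    have dd: "ennreal d \<le> ennreal d1" "ennreal d \<le> ennreal d2" by (auto simp: d_def intro!: ennreal_leI)
    have s1: "integrable lborel (\<lambda>x. f x - h x)" "(\<integral>x. norm (f x - h x) \<partial>lborel) < e"
      using d1(2)[of "\<lambda>x. f x - h x"] fs hs less_le_trans[OF hD(3) dd(1)] by auto
    have s2: "integrable lborel (\<lambda>x. G x - D x)" "(\<integral>x. norm (G x - D x) \<partial>lborel) < e"
      using d2(2)[of "\<lambda>x. G x - D x"] Gs Ds less_le_trans[OF hD(4) dd(2)] by auto
    have Dc: "continuous_on UNIV D" using hD(1) by (simp add: C1_grad_def)
    note hi = compact_support_integrable[OF C1_grad_continuous[OF hD(1)] hs compact_cball]
      compact_support_integrable[OF Dc Ds compact_cball]
    have ibp: "(\<integral>x. h x * partial \<phi> i x \<partial>lborel) = - (\<integral>x. (D x \<bullet> i) * \<phi> x \<partial>lborel)"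
      by (rule C1_grad_integration_by_parts[OF hD(1) hs \<phi> i])
    have A: "\<bar>(\<integral>x. (f x - h x) * partial \<phi> i x \<partial>lborel)\<bar> \<le> M * e"
    proof -
      have "\<bar>(\<integral>x. (f x - h x) * partial \<phi> i x \<partial>lborel)\<bar> \<le> (\<integral>x. \<bar>(f x - h x) * partial \<phi> i x\<bar> \<partial>lborel)" by (rule integral_abs_bound)
      also have "\<dots> \<le> (\<integral>x. M * norm (f x - h x) \<partial>lborel)"
        using s1 i1[of "\<lambda>x. f x - h x"] b1[of "\<lambda>x. f x - h x"] fs hs by (intro integral_mono) auto
      also have "\<dots> \<le> M * e" using s1 M(1) by simp
      finally show ?thesis .
    qed
    have B: "\<bar>(\<integral>x. ((G x - D x) \<bullet> i) * \<phi> x \<partial>lborel)\<bar> \<le> M * e"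
    proof -
      have "\<bar>(\<integral>x. ((G x - D x) \<bullet> i) * \<phi> x \<partial>lborel)\<bar> \<le> (\<integral>x. \<bar>((G x - D x) \<bullet> i) * \<phi> x\<bar> \<partial>lborel)" by (rule integral_abs_bound)
      also have "\<dots> \<le> (\<integral>x. M * norm (G x - D x) \<partial>lborel)"
      proof (rule integral_mono)
        show "integrable lborel (\<lambda>x. \<bar>((G x - D x) \<bullet> i) * \<phi> x\<bar>)"
          by (rule integrable_abs[OF i2]) (use s2 Gs Ds in auto)
        show "\<bar>((G x - D x) \<bullet> i) * \<phi> x\<bar> \<le> M * norm (G x - D x)" for x
          by (rule b2[of "\<lambda>x. G x - D x"]) (use Gs Ds in auto)
      qed (use s2 in auto)
      also have "\<dots> \<le> M * e" using s2 M(1) by simp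
      finally show ?thesis .
    qed
    have "(\<integral>x. (f x - h x) * partial \<phi> i x \<partial>lborel) = (\<integral>x. f x * partial \<phi> i x \<partial>lborel) - (\<integral>x. h x * partial \<phi> i x \<partial>lborel)"
      unfolding left_diff_distrib by (rule Bochner_Integration.integral_diff[OF I1 i1[OF hi(1) hs]])
    moreover have "(\<integral>x. ((G x - D x) \<bullet> i) * \<phi> x \<partial>lborel) = (\<integral>x. (G x \<bullet> i) * \<phi> x \<partial>lborel) - (\<integral>x. (D x \<bullet> i) * \<phi> x \<partial>lborel)"
      unfolding inner_diff_left left_diff_distrib by (rule Bochner_Integration.integral_diff[OF I2 i2[OF hi(2) Ds]])
    ultimately show ?thesis using A B ibp by linarith
  qed
  have "\<bar>?d\<bar> \<le> 0"
  proof (rule field_le_epsilon)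
    fix e :: real assume "e > 0"
    then show "\<bar>?d\<bar> \<le> 0 + e" using small[of "e / (2 * M)"] M(1) by simp
  qed
  then show "(\<integral>x. f x * partial \<phi> i x \<partial>lborel) = - (\<integral>x. (G x \<bullet> i) * \<phi> x \<partial>lborel)" by linarith
qed

text \<open>Mollifying the C^1 approximant makes it smooth, at the cost of a support larger by at
  most half of \<tau> - \<sigma>.\<close>

lemma W1p_approx_test_fun:
  fixes f :: "'a::euclidean_space \<Rightarrow> real"
  assumes W: "W1p_approx p x0 \<sigma> f G" and p: "p > 1" and st: "\<sigma> < \<tau>" and e: "e > 0"
  obtains \<psi> where "test_fun (ball x0 \<tau>) \<psi>" "\<psi> \<in> borel_measurable borel" "sgrad \<psi> \<in> borel_measurable borel"
    "Lpn p (\<lambda>x. f x - \<psi> x) < ennreal e" "Lpn p (\<lambda>x. G x - sgrad \<psi> x) < ennreal e"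
proof -
  have m[measurable]: "f \<in> borel_measurable borel" "G \<in> borel_measurable borel" using W by (auto simp: W1p_approx_def)
  define e' where "e' = e / (2 * 2 powr p)"
  have e': "e' > 0" using e by (simp add: e'_def)
  obtain h D where hD: "C1_grad h D" "\<forall>x. x \<notin> cball x0 \<sigma> \<longrightarrow> h x = 0"
      "Lpn p (\<lambda>x. f x - h x) < ennreal e'" "Lpn p (\<lambda>x. G x - D x) < ennreal e'"
    using W e' unfolding W1p_approx_def by blast
  have hs: "\<And>x. x \<notin> cball x0 \<sigma> \<Longrightarrow> h x = 0" using hD(2) by blast
  have Ds: "D x = 0" if "x \<notin> cball x0 \<sigma>" for x using C1_grad_outside_support[OF hD(1) hs that] .
  note hm[measurable] = C1_grad_measurable[OF hD(1)]
  have c: "continuous_on UNIV h" "continuous_on UNIV D" using hD(1) C1_grad_continuous by (auto simp: C1_grad_def)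
  \<comment> \<open>h approximates itself with error 0, so the finiteness lemma applies to h and
    D.\<close>
  have W': "W1p_approx p x0 \<sigma> h D"
    unfolding W1p_approx_def using hm hD(1,2) by (auto intro!: exI[of _ h] exI[of _ D] simp: Lpn_def)
  have wg: "wgrad_on UNIV h D"
    unfolding wgrad_on_def test_fun_def using C1_grad_integration_by_parts[OF hD(1) hs] by blast
  have d: "(\<tau> - \<sigma>) / 2 > 0" using st by simp
  from mollify_weak_grad[OF hm(1) W1p_approx_finite(1)[OF W' p] hs hm(2) W1p_approx_finite(2)[OF W' p] Ds wg p e' d]
  obtain a \<rho> where r: "real DIM('a) * a \<le> (\<tau> - \<sigma>) / 2" "\<rho> \<in> tensor_bumps a" "C1_grad (conv \<rho> h) (\<lambda>x. sgrad (conv \<rho> h) x)"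
    "\<forall>x. cball x ((\<tau> - \<sigma>) / 2) \<subseteq> UNIV \<longrightarrow> sgrad (conv \<rho> h) x = conv \<rho> D x"
    "Lpn p (\<lambda>x. conv \<rho> h x - h x) < ennreal e'" "Lpn p (\<lambda>x. conv \<rho> D x - D x) < ennreal e'" .
  have sg: "sgrad (conv \<rho> h) = conv \<rho> D" using r(4) by auto
  note cm = C1_grad_measurable[OF r(3)]
  have hi: "integrable lborel h" by (rule compact_support_integrable[OF c(1) hs compact_cball])
  have "test_fun (ball x0 \<tau>) (conv \<rho> h)"
  proof (rule test_funI[OF smooth_fun_conv[OF r(2) hi]])
    show "conv \<rho> h x = 0" if "x \<notin> cball x0 (\<sigma> + real DIM('a) * a)" for x by (rule conv_support[OF r(2) hs that])
    show "cball x0 (\<sigma> + real DIM('a) * a) \<subseteq> ball x0 \<tau>" using r(1) st by (auto simp: field_simps)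
  qed auto
  moreover have "Lpn p (\<lambda>x. f x - conv \<rho> h x) < ennreal e"
    using Lpn_diff_trans_less[OF m(1) hm(1) cm(1), of p e] p e hD(3) r(5) Lpn_minus_commute[of p h "conv \<rho> h"] by (simp add: e'_def)
  moreover have "Lpn p (\<lambda>x. G x - sgrad (conv \<rho> h) x) < ennreal e"
    using Lpn_diff_trans_less[OF m(2) hm(2) cm(2), of p e] p e hD(4) r(6) Lpn_minus_commute[of p D "conv \<rho> D"] by (simp add: e'_def sg)
  ultimately show ?thesis using that cm by blast
qed

text \<open>Exit from the approximation class into the test functions of
  \<open>weak_subsolution\<close>: integration by parts supplies the weak gradient, and smooth
  approximants of accuracy 1/(k+1) supply the sequence.\<close>

theorem W1p_approx_W01p:
  fixes f :: "'a::euclidean_space \<Rightarrow> real"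
  assumes W: "W1p_approx p x0 \<sigma> f G" and p: "p > 1" and st: "\<sigma> < \<tau>" and fs: "\<And>x. x \<notin> cball x0 \<sigma> \<Longrightarrow> f x = 0"
    and Gs: "\<And>x. x \<notin> cball x0 \<sigma> \<Longrightarrow> G x = 0"
  shows "W01p (ball x0 \<tau>) p f G"
proof -
  have m[measurable]: "f \<in> borel_measurable borel" "G \<in> borel_measurable borel" using W by (auto simp: W1p_approx_def)
  let ?U = "ball x0 \<tau>"
  have out: "x \<notin> cball x0 \<sigma>" if "x \<notin> ?U" for x using that st by auto
  have pf: "integrable lborel (\<lambda>x. \<bar>f x\<bar> powr p)"
    using W1p_approx_finite(1)[OF W p] by (intro integrableI_nonneg) (auto simp: Lpn_def)
  have pG: "integrable lborel (\<lambda>x. norm (G x) powr p)"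
    using W1p_approx_finite(2)[OF W p] by (intro integrableI_nonneg) (auto simp: Lpn_def)
  have wg: "weak_grad ?U f G"
    unfolding weak_grad_def
  proof (intro allI impI ballI)
    fix \<phi> and i :: 'a assume t: "test_fun ?U \<phi>" and i: "i \<in> Basis"
    then have s: "smooth_fun \<phi>" by (simp add: test_fun_def)
    note I = W1p_approx_integration_by_parts[OF W p fs Gs s i]
    note c = smooth_funD(1,2)[OF s i]
    note [measurable] = borel_measurable_continuous_onI[OF c(1)] borel_measurable_continuous_onI[OF c(2)]
    have m1: "(\<lambda>x. f x * partial \<phi> i x) \<in> borel_measurable borel" "(\<lambda>x. (G x \<bullet> i) * \<phi> x) \<in> borel_measurable borel" by measurable
    show "set_integrable lebesgue ?U (\<lambda>x. f x * partial \<phi> i x) \<and> set_integrable lebesgue ?U (\<lambda>x. G x \<bullet> i * \<phi> x) \<and>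
      (LINT x:?U|lebesgue. f x * partial \<phi> i x) = - (LINT x:?U|lebesgue. G x \<bullet> i * \<phi> x)"
      using I set_lebesgue_borel[OF m1(1), of ?U] set_lebesgue_borel[OF m1(2), of ?U] out fs Gs by simp
  qed
  have w1: "W1p ?U p f G"
    unfolding W1p_def using wg pf pG p out fs Gs
      set_lebesgue_borel(3)[OF m(1), of ?U] set_lebesgue_borel(3)[OF m(2), of ?U]
      set_lebesgue_borel(1)[of "\<lambda>x. \<bar>f x\<bar> powr p" ?U] set_lebesgue_borel(1)[of "\<lambda>x. norm (G x) powr p" ?U] by simp
  have "\<exists>\<psi>. test_fun ?U \<psi> \<and> (LINT x:?U|lebesgue. \<bar>\<psi> x - f x\<bar> powr p + norm (sgrad \<psi> x - G x) powr p) \<le> 2 * (1 / (real k + 1))" for k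
  proof -
    have e: "1 / (real k + 1) > 0" by simp
    from W1p_approx_test_fun[OF W p st e] obtain \<psi> where \<psi>: "test_fun (ball x0 \<tau>) \<psi>" 
      and \<psi>m[measurable]: "\<psi> \<in> borel_measurable borel" "sgrad \<psi> \<in> borel_measurable borel"
      and \<psi>e: "Lpn p (\<lambda>x. f x - \<psi> x) < ennreal (1 / (real k + 1))" "Lpn p (\<lambda>x. G x - sgrad \<psi> x) < ennreal (1 / (real k + 1))" .
    \<comment> \<open>The Bochner integral of a non-integrable function is 0, so it is below the
      nonnegative integral in either case.\<close>
    have "ennreal (LINT x:?U|lebesgue. \<bar>\<psi> x - f x\<bar> powr p + norm (sgrad \<psi> x - G x) powr p)
       \<le> (\<integral>\<^sup>+x. ennreal (indicator ?U x *\<^sub>R (\<bar>\<psi> x - f x\<bar> powr p + norm (sgrad \<psi> x - G x) powr p)) \<partial>lebesgue)"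
      unfolding set_lebesgue_integral_def
      using integral_eq_nn_integral[of "\<lambda>x. indicator ?U x *\<^sub>R (\<bar>\<psi> x - f x\<bar> powr p + norm (sgrad \<psi> x - G x) powr p)" lebesgue]
      by (cases "integrable lebesgue (\<lambda>x. indicator ?U x *\<^sub>R (\<bar>\<psi> x - f x\<bar> powr p + norm (sgrad \<psi> x - G x) powr p))")
         (auto simp: not_integrable_integral_eq nn_integral_eq_integral)
    also have "\<dots> \<le> (\<integral>\<^sup>+x. ennreal (norm (f x - \<psi> x) powr p) + ennreal (norm (G x - sgrad \<psi> x) powr p) \<partial>lborel)"
      unfolding nn_integral_completion
    proof (rule nn_integral_mono)
      fix x
      show "ennreal (indicator ?U x *\<^sub>R (\<bar>\<psi> x - f x\<bar> powr p + norm (sgrad \<psi> x - G x) powr p))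
        \<le> ennreal (norm (f x - \<psi> x) powr p) + ennreal (norm (G x - sgrad \<psi> x) powr p)"
        by (cases "x \<in> ?U") (auto simp: norm_minus_commute abs_minus_commute)
    qed
    also have "\<dots> = Lpn p (\<lambda>x. f x - \<psi> x) + Lpn p (\<lambda>x. G x - sgrad \<psi> x)"
      unfolding Lpn_def by (rule nn_integral_add) auto
    also have "\<dots> \<le> ennreal (1 / (real k + 1)) + ennreal (1 / (real k + 1))" using \<psi>e by (intro add_mono) auto
    also have "\<dots> = ennreal (2 * (1 / (real k + 1)))" by (subst ennreal_plus[symmetric]) auto
    finally show ?thesis using \<psi> by (auto simp: ennreal_le_iff)
  qed
  then have "\<forall>k. \<exists>\<psi>. test_fun ?U \<psi> \<and> (LINT x:?U|lebesgue. \<bar>\<psi> x - f x\<bar> powr p + norm (sgrad \<psi> x - G x) powr p) \<le> 2 * (1 / (real k + 1))"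
    by (rule allI)
  from choice[OF this] obtain \<psi> where \<psi>0: "\<And>k. test_fun ?U (\<psi> k) \<and>
      (LINT x:?U|lebesgue. \<bar>\<psi> k x - f x\<bar> powr p + norm (sgrad (\<psi> k) x - G x) powr p) \<le> 2 * (1 / (real k + 1))"
    by (elim exE) (rule that, erule spec)
  then have \<psi>: "\<And>k. test_fun ?U (\<psi> k)"
      "\<And>k. (LINT x:?U|lebesgue. \<bar>\<psi> k x - f x\<bar> powr p + norm (sgrad (\<psi> k) x - G x) powr p) \<le> 2 * (1 / (real k + 1))"
    by simp_all
  have lim: "(\<lambda>k. 2 * (1 / (real k + 1))) \<longlonglongrightarrow> 0"
    using tendsto_mult_right_zero[OF LIMSEQ_Suc[OF lim_1_over_n[where 'a=real]], of 2] by (simp add: add.commute)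
  have "(\<lambda>k. LINT x:?U|lebesgue. \<bar>\<psi> k x - f x\<bar> powr p + norm (sgrad (\<psi> k) x - G x) powr p) \<longlonglongrightarrow> 0"
  proof (rule tendsto_sandwich[OF _ _ tendsto_const lim])
    show "\<forall>\<^sub>F k in sequentially. 0 \<le> (LINT x:?U|lebesgue. \<bar>\<psi> k x - f x\<bar> powr p + norm (sgrad (\<psi> k) x - G x) powr p)"
      unfolding set_lebesgue_integral_def by (intro always_eventually allI integral_nonneg_AE AE_I2) auto
  qed (use \<psi>(2) in \<open>auto intro!: always_eventually\<close>)
  then show ?thesis unfolding W01p_def using w1 \<psi>(1) fs out by blast
qed


section \<open>Kernel integrals and pointwise nonlocal inequalities\<close>

lemma powr_le_two_powr_scaled:
  fixes t r c :: real
  assumes "r > 0" "r \<le> t" "t \<le> 2 * r"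
  shows "t powr c \<le> 2 powr \<bar>c\<bar> * r powr c"
proof -
  have t: "t > 0" using assms by linarith
  have eq: "t = (t / r) * r" using assms by simp
  have "t powr c = (t / r) powr c * r powr c" using powr_mult[of "t / r" r c] assms t by simp
  also have "(t / r) powr c \<le> (t / r) powr \<bar>c\<bar>" using assms by (intro powr_mono) (auto simp: field_simps)
  also have "\<dots> \<le> 2 powr \<bar>c\<bar>" using assms t by (intro powr_mono2) (auto simp: field_simps)
  finally show ?thesis by (simp add: mult_right_mono)
qed

lemma ennreal_le_suminf: "f n \<le> (\<Sum>n. f n :: ennreal)"
  using sum_le_suminf[of f "{n}"] by simp

text \<open>S is covered by annuli on which |z|^c is comparable to r_n^c, each inside a ball of
  volume proportional to r_n^DIM. This replaces polar coordinates and serves both the singularity at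
  0 and the decay at infinity.\<close>

lemma nn_integral_norm_powr_annuli:
  fixes S :: "'a::euclidean_space set"
  assumes r: "\<And>n. r n > 0" and S: "\<And>z. z \<in> S \<Longrightarrow> \<exists>n. r n \<le> norm z \<and> norm z < 2 * r n"
    and sm: "summable (\<lambda>n. r n powr (c + real DIM('a)))"
  shows "(\<integral>\<^sup>+z. ennreal (norm z powr c) * indicator S z \<partial>lborel) < \<infinity>"
proof -
  define w where "w = measure lborel (ball (0::'a) 1)"
  have ball: "emeasure lborel (ball (0::'a) (2 * r n)) = ennreal (w * (2 * r n) ^ DIM('a))" for n
  proof -
    have "measure lborel (ball (0::'a) (2 * r n)) = w * (2 * r n) ^ DIM('a)"
      unfolding w_def using r[of n] by (simp add: content_ball)
    then show ?thesis using emeasure_eq_ennreal_measure[of lborel "ball (0::'a) (2 * r n)"]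
        emeasure_lborel_ball_finite[of "0::'a" "2 * r n"] by simp
  qed
  have "(\<integral>\<^sup>+z. ennreal (norm z powr c) * indicator S z \<partial>lborel)
      \<le> (\<integral>\<^sup>+z. (\<Sum>n. ennreal (2 powr \<bar>c\<bar> * r n powr c) * indicator (ball (0::'a) (2 * r n)) z) \<partial>lborel)"
  proof (rule nn_integral_mono)
    fix z :: 'a
    let ?f = "\<lambda>n. ennreal (2 powr \<bar>c\<bar> * r n powr c) * indicator (ball (0::'a) (2 * r n)) z :: ennreal"
    show "ennreal (norm z powr c) * indicator S z \<le> (\<Sum>n. ?f n)"
    proof (cases "z \<in> S")
      case True
      then obtain n where n: "r n \<le> norm z" "norm z < 2 * r n" using S by blast
      have "ennreal (norm z powr c) \<le> ?f n"
        using n r[of n] powr_le_two_powr_scaled[of "r n" "norm z" c] by (auto intro!: ennreal_leI)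
      also have "?f n \<le> (\<Sum>n. ?f n)" by (rule ennreal_le_suminf)
      finally show ?thesis using True by simp
    qed simp
  qed
  also have "\<dots> = (\<Sum>n. \<integral>\<^sup>+z. ennreal (2 powr \<bar>c\<bar> * r n powr c) * indicator (ball (0::'a) (2 * r n)) z \<partial>lborel)"
    by (rule nn_integral_suminf, intro borel_measurable_times_ennreal borel_measurable_const borel_measurable_indicator) simp
  also have "\<dots> = (\<Sum>n. ennreal (2 powr \<bar>c\<bar> * w * 2 ^ DIM('a) * r n powr (c + real DIM('a))))"
  proof (intro suminf_cong)
    fix n
    have "(\<integral>\<^sup>+z. ennreal (2 powr \<bar>c\<bar> * r n powr c) * indicator (ball (0::'a) (2 * r n)) z \<partial>lborel)
       = ennreal (2 powr \<bar>c\<bar> * r n powr c) * ennreal (w * (2 * r n) ^ DIM('a))"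
      by (simp add: nn_integral_cmult_indicator ball)
    also have "\<dots> = ennreal (2 powr \<bar>c\<bar> * r n powr c * (w * (2 * r n) ^ DIM('a)))"
      by (rule ennreal_mult[symmetric]) (use r[of n] in \<open>auto simp: w_def\<close>)
    also have "2 powr \<bar>c\<bar> * r n powr c * (w * (2 * r n) ^ DIM('a)) = 2 powr \<bar>c\<bar> * w * 2 ^ DIM('a) * r n powr (c + real DIM('a))"
      using r[of n] by (simp add: powr_add powr_realpow power_mult_distrib)
    finally show "(\<integral>\<^sup>+z. ennreal (2 powr \<bar>c\<bar> * r n powr c) * indicator (ball (0::'a) (2 * r n)) z \<partial>lborel)
       = ennreal (2 powr \<bar>c\<bar> * w * 2 ^ DIM('a) * r n powr (c + real DIM('a)))" .
  qed
  also have "\<dots> = ennreal (\<Sum>n. 2 powr \<bar>c\<bar> * w * 2 ^ DIM('a) * r n powr (c + real DIM('a)))"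
  proof (rule suminf_ennreal2)
    show "summable (\<lambda>n. 2 powr \<bar>c\<bar> * w * 2 ^ DIM('a) * r n powr (c + real DIM('a)))" by (intro summable_mult sm)
  qed (simp add: w_def)
  also have "\<dots> < \<infinity>" by simp
  finally show ?thesis .
qed

lemma dyadic_floor:
  assumes "(t::real) \<ge> 1"
  obtains n :: nat where "2 ^ n \<le> t" "t < 2 * 2 ^ n"
proof -
  define n where "n = nat \<lfloor>log 2 t\<rfloor>"
  have l: "log 2 t \<ge> 0" using assms by simp
  have "real n \<le> log 2 t" "log 2 t < real n + 1" using l unfolding n_def by linarith+
  then have "2 powr real n \<le> t" "t < 2 powr (real n + 1)"
    using assms by (auto simp: le_log_iff log_less_iff)
  then show ?thesis using that[of n] by (simp add: powr_add powr_realpow)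
qed

text \<open>Radii 2^(-n) give a geometric series of ratio 2^(-a). The case a = p (1 - s) is the
  kernel bound times |z|^p, i.e. the near-diagonal energy of a Lipschitz cutoff.\<close>

lemma nn_integral_norm_powr_near:
  assumes "a > 0"
  shows "(\<integral>\<^sup>+z. ennreal (norm z powr (a - real DIM('a))) * indicator (ball (0::'a::euclidean_space) 2 - {0}) z \<partial>lborel) < \<infinity>"
proof (rule nn_integral_norm_powr_annuli[where r = "\<lambda>n. 1 / 2 ^ n"])
  fix z :: 'a assume z: "z \<in> ball 0 2 - {0}"
  show "\<exists>n. 1 / 2 ^ n \<le> norm z \<and> norm z < 2 * (1 / 2 ^ n)"
  proof (cases "norm z \<ge> 1")
    case True then show ?thesis using z by (intro exI[of _ 0]) auto
  next
    case False
    define n where "n = nat \<lceil>- log 2 (norm z)\<rceil>"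
    have l: "- log 2 (norm z) > 0" using False z by simp
    have "- log 2 (norm z) \<le> real n" "real n < - log 2 (norm z) + 1" using l unfolding n_def by linarith+
    then have "- real n \<le> log 2 (norm z)" "log 2 (norm z) < 1 - real n" by linarith+
    then have "2 powr (- real n) \<le> norm z" "norm z < 2 powr (1 - real n)"
      using z by (auto simp: le_log_iff log_less_iff)
    then show ?thesis by (intro exI[of _ n]) (auto simp: powr_minus powr_diff powr_realpow field_simps)
  qed
next
  have "(1 / 2 ^ n) powr (a - real DIM('a) + real DIM('a)) = (2 powr - a) ^ n" for n :: nat
    by (simp add: powr_divide powr_realpow[symmetric] powr_powr powr_minus field_simps)
  moreover have "summable (\<lambda>n. (2 powr - a) ^ n)" using assms by (intro summable_geometric) (simp add: powr_minus_divide)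
  ultimately show "summable (\<lambda>n. (1 / 2 ^ n) powr (a - real DIM('a) + real DIM('a)))" by simp
qed simp

text \<open>Radii \<rho> 2^n give a geometric series of the same ratio; the case a = p s is the tail
  kernel.\<close>

lemma nn_integral_norm_powr_far:
  assumes "a > 0" "\<rho> > 0"
  shows "(\<integral>\<^sup>+z. ennreal (norm z powr (- (real DIM('a) + a))) * indicator (- ball (0::'a::euclidean_space) \<rho>) z \<partial>lborel) < \<infinity>"
proof (rule nn_integral_norm_powr_annuli[where r = "\<lambda>n. \<rho> * 2 ^ n"])
  fix z :: 'a assume z: "z \<in> - ball 0 \<rho>"
  then have "norm z / \<rho> \<ge> 1" using assms by simp
  from dyadic_floor[OF this] obtain n where "2 ^ n \<le> norm z / \<rho>" "norm z / \<rho> < 2 * 2 ^ n" .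
  then show "\<exists>n. \<rho> * 2 ^ n \<le> norm z \<and> norm z < 2 * (\<rho> * 2 ^ n)"
    using assms by (intro exI[of _ n]) (auto simp: field_simps)
next
  have "(\<rho> * 2 ^ n) powr (- (real DIM('a) + a) + real DIM('a)) = \<rho> powr - a * (2 powr - a) ^ n" for n :: nat
    using assms by (simp add: powr_mult powr_realpow[symmetric] powr_powr mult.commute)
  moreover have "summable (\<lambda>n. \<rho> powr - a * (2 powr - a) ^ n)"
    using assms by (intro summable_mult summable_geometric) (simp add: powr_minus_divide)
  ultimately show "summable (\<lambda>n. (\<rho> * 2 ^ n) powr (- (real DIM('a) + a) + real DIM('a)))" by simp
qed (use assms in auto)

section \<open>Pointwise inequalities for the nonlocal term\<close>

lemma powr_diff_le:
  fixes s t p :: real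
  assumes "0 \<le> s" "s \<le> t" "p > 1"
  shows "t powr p - s powr p \<le> p * t powr (p - 1) * (t - s)"
  using powr_tangent[of s t p] assms by (simp add: algebra_simps)

text \<open>The summands are the constants of the two cases of the estimate that follows: 2^p when
  t2 is at most twice the increment, the other one when t1 \<ge> t2 / 2.\<close>

definition nonlocal_const :: "real \<Rightarrow> real" where
  "nonlocal_const p = 2 powr p + (p * 2 powr p) powr (p - 1) * p"

lemma nonlocal_const_pos: "p > 1 \<Longrightarrow> nonlocal_const p > 0"
  by (auto simp: nonlocal_const_def intro!: add_pos_nonneg)

text \<open>The case \<open>t2 \<le> 2 (t2 - t1)\<close> is trivial; otherwise \<open>t1 \<ge> t2 / 2\<close>, and the assumption
  \<open>a t1^p < b t2^p\<close> makes \<open>a - b\<close> itself of order \<open>a (t2 - t1) / t2\<close>.\<close>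
lemma nonlocal_core:
  fixes a b t1 t2 p :: real
  assumes ab: "0 \<le> b" "b \<le> a" and t: "0 \<le> t1" "0 \<le> t2" and p: "p > 1" and neg: "a * t1 powr p < b * t2 powr p"
  shows "(a - b) powr (p - 1) * (b * t2 powr p - a * t1 powr p) \<le> nonlocal_const p * (a powr p * \<bar>t1 - t2\<bar> powr p)"
proof -
  have b: "b > 0"
  proof (rule ccontr)
    assume "\<not> b > 0"
    then have "b = 0" using ab by simp
    moreover have "0 \<le> a * t1 powr p" using ab by simp
    ultimately show False using neg by simp
  qed
  then have a: "a > 0" using ab by simp
  have t12: "t1 < t2"
  proof (rule ccontr)
    assume "\<not> t1 < t2"
    then have "b * t2 powr p \<le> a * t1 powr p" using ab t p by (intro mult_mono powr_mono2) auto
    then show False using neg by simp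
  qed
  define d where "d = t2 - t1"
  have d: "d > 0" using t12 by (simp add: d_def)
  have ap: "a powr (p - 1) * a = a powr p" using a by (simp add: powr_diff)
  have abp: "(a - b) powr (p - 1) \<le> a powr (p - 1)" using ab b p by (intro powr_mono2) auto
  show ?thesis
  proof (cases "t2 \<le> 2 * d")
    case True
    have "(a - b) powr (p - 1) * (b * t2 powr p - a * t1 powr p) \<le> a powr (p - 1) * (a * (2 * d) powr p)"
    proof (intro mult_mono abp)
      have "b * t2 powr p \<le> a * (2 * d) powr p" using ab t p True by (intro mult_mono powr_mono2) auto
      moreover have "0 \<le> a * t1 powr p" using a by simp
      ultimately show "b * t2 powr p - a * t1 powr p \<le> a * (2 * d) powr p" by linarith
    qed (use neg in auto)
    also have "\<dots> = 2 powr p * (a powr p * d powr p)" using ap d by (simp add: powr_mult mult_ac)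
    also have "\<dots> \<le> nonlocal_const p * (a powr p * d powr p)" using p by (intro mult_right_mono) (auto simp: nonlocal_const_def)
    finally show ?thesis using t12 by (simp add: d_def abs_if)
  next
    case False
    then have t2: "t2 > 0" and t1: "t2 / 2 \<le> t1" using d by (auto simp: d_def)
    have df: "t2 powr p - t1 powr p \<le> p * t2 powr (p - 1) * d" unfolding d_def using t t12 p by (intro powr_diff_le) auto
    have "b * t2 powr p - a * t1 powr p \<le> b * (t2 powr p - t1 powr p)"
      using ab by (simp add: algebra_simps mult_right_mono)
    also have "\<dots> \<le> a * (p * t2 powr (p - 1) * d)" using ab df p d b
      by (intro mult_mono) (auto simp: t12 less_imp_le t powr_mono2)
    finally have 1: "b * t2 powr p - a * t1 powr p \<le> a * (p * t2 powr (p - 1) * d)" .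
    have "(a - b) * t1 powr p \<le> b * (t2 powr p - t1 powr p)" using neg by (simp add: algebra_simps)
    also have "\<dots> \<le> a * (p * t2 powr (p - 1) * d)" using ab df p d b
      by (intro mult_mono) (auto simp: t12 less_imp_le t powr_mono2)
    finally have 2: "(a - b) * t1 powr p \<le> a * (p * t2 powr (p - 1) * d)" .
    have "(a - b) * (t2 / 2) powr p \<le> (a - b) * t1 powr p" using ab t1 t2 p by (intro mult_left_mono powr_mono2) auto
    then have 3: "(a - b) * (t2 / 2) powr p \<le> a * (p * t2 powr (p - 1) * d)" using 2 by linarith
    have t2p: "t2 powr p = t2 powr (p - 1) * t2" using t2 by (simp add: powr_diff)
    have "(a - b) * (t2 powr (p - 1) * t2) \<le> 2 powr p * (a * (p * t2 powr (p - 1) * d))"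
      using 3 by (simp add: powr_divide t2p field_simps)
    then have "t2 powr (p - 1) * ((a - b) * t2) \<le> t2 powr (p - 1) * (2 powr p * (a * (p * d)))" by (simp add: mult_ac)
    then have "(a - b) * t2 \<le> 2 powr p * (a * (p * d))" using t2 by (subst (asm) mult_le_cancel_left_pos) auto
    then have "((a - b) * t2) powr (p - 1) \<le> ((p * 2 powr p) * (a * d)) powr (p - 1)"
      using ab t2 p by (intro powr_mono2) (auto simp: mult_ac)
    then have 4: "(a - b) powr (p - 1) * t2 powr (p - 1) \<le> (p * 2 powr p) powr (p - 1) * (a powr (p - 1) * d powr (p - 1))"
      using ab t2 p a d by (simp add: powr_mult)
    have "(a - b) powr (p - 1) * (b * t2 powr p - a * t1 powr p) \<le> (a - b) powr (p - 1) * (a * (p * t2 powr (p - 1) * d))"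
      using 1 by (intro mult_left_mono) auto
    also have "\<dots> = ((a - b) powr (p - 1) * t2 powr (p - 1)) * (p * a * d)" by (simp add: mult_ac)
    also have "\<dots> \<le> ((p * 2 powr p) powr (p - 1) * (a powr (p - 1) * d powr (p - 1))) * (p * a * d)"
      using 4 p a d by (intro mult_right_mono) auto
    also have "\<dots> = ((p * 2 powr p) powr (p - 1) * p) * ((a powr (p - 1) * a) * (d powr (p - 1) * d))" by (simp add: mult_ac)
    also have "\<dots> = ((p * 2 powr p) powr (p - 1) * p) * (a powr p * d powr p)" using ap d by (simp add: powr_diff)
    also have "\<dots> \<le> nonlocal_const p * (a powr p * d powr p)" by (intro mult_right_mono) (auto simp: nonlocal_const_def)
    finally show ?thesis using t12 by (simp add: d_def abs_if)
  qed
qed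

lemma ppow_neg: "ppow p (- t) = - ppow p t"
  by (simp add: ppow_def)

lemma ppow_pos: "t \<ge> 0 \<Longrightarrow> ppow p t = t powr (p - 1)"
  by (cases "t = 0") (auto simp: ppow_def powr_diff power2_eq_square field_simps)

text \<open>Exchanging the two points allows V \<le> U. With a and b the truncations of U and V, the
  product is then negative only if a t1^p < b t2^p; this forces b > 0, so both values exceed k and U
  - V = a - b, which is the situation of \<open>nonlocal_core\<close>.\<close>

lemma nonlocal_pointwise:
  fixes U V k t1 t2 p :: real
  assumes t: "0 \<le> t1" "0 \<le> t2" and p: "p > 1"
  shows "- (ppow p (U - V) * (max 0 (U - k) * t1 powr p - max 0 (V - k) * t2 powr p))
     \<le> nonlocal_const p * ((max 0 (U - k) powr p + max 0 (V - k) powr p) * \<bar>t1 - t2\<bar> powr p)"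
proof -
  have main: "- (ppow p (U - V) * (max 0 (U - k) * t1 powr p - max 0 (V - k) * t2 powr p))
     \<le> nonlocal_const p * ((max 0 (U - k) powr p + max 0 (V - k) powr p) * \<bar>t1 - t2\<bar> powr p)"
    if UV: "V \<le> U" and t: "0 \<le> t1" "0 \<le> t2" for U V t1 t2 :: real
  proof -
    define a where "a = max 0 (U - k)"
    define b where "b = max 0 (V - k)"
    have ab: "0 \<le> b" "b \<le> a" using UV by (auto simp: a_def b_def)
    have rhs: "0 \<le> nonlocal_const p * ((a powr p + b powr p) * \<bar>t1 - t2\<bar> powr p)" using nonlocal_const_pos[OF p] by simp
    show ?thesis
    proof (cases "a * t1 powr p < b * t2 powr p")
      case True
      have "b > 0"
      proof (rule ccontr)
        assume "\<not> b > 0"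
        then have "b = 0" using ab by simp
        moreover have "0 \<le> a * t1 powr p" using ab by simp
        ultimately show False using True by simp
      qed
      then have "V > k" by (auto simp: b_def max_def split: if_splits)
      then have eq: "U - V = a - b" using UV by (simp add: a_def b_def)
      have "ppow p (U - V) = (a - b) powr (p - 1)" unfolding eq using ab by (intro ppow_pos) simp
      then have "- (ppow p (U - V) * (a * t1 powr p - b * t2 powr p)) = (a - b) powr (p - 1) * (b * t2 powr p - a * t1 powr p)"
        by (simp add: algebra_simps)
      also have "\<dots> \<le> nonlocal_const p * (a powr p * \<bar>t1 - t2\<bar> powr p)" by (rule nonlocal_core[OF ab t p True])
      also have "\<dots> \<le> nonlocal_const p * ((a powr p + b powr p) * \<bar>t1 - t2\<bar> powr p)"
        using nonlocal_const_pos[OF p] by (intro mult_left_mono mult_right_mono) auto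
      finally show ?thesis by (simp add: a_def b_def)
    next
      case False
      have "ppow p (U - V) \<ge> 0" using UV by (subst ppow_pos) auto
      then have "0 \<le> ppow p (U - V) * (a * t1 powr p - b * t2 powr p)" using False by (intro mult_nonneg_nonneg) auto
      then show ?thesis using rhs unfolding a_def b_def by linarith
    qed
  qed
  show ?thesis
  proof (cases "V \<le> U")
    case True then show ?thesis using main t by blast
  next
    case False
    have "ppow p (U - V) = - ppow p (V - U)" using ppow_neg[of p "V - U"] by simp
    then show ?thesis using main[of U V t2 t1] False t by (simp add: algebra_simps abs_minus_commute)
  qed
qed

text \<open>A negative contribution needs k < U < V, and there V - U \<le> V - k.\<close>

lemma nonlocal_pointwise_tail:
  fixes U V k t p :: real
  assumes "0 \<le> t" "t \<le> 1" and p: "p > 1"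
  shows "- (ppow p (U - V) * (max 0 (U - k) * t powr p)) \<le> max 0 (U - k) * max 0 (V - k) powr (p - 1)"
proof (cases "V \<le> U")
  case True
  then have "0 \<le> ppow p (U - V) * (max 0 (U - k) * t powr p)" by (simp add: ppow_pos)
  moreover have "0 \<le> max 0 (U - k) * max 0 (V - k) powr (p - 1)" by simp
  ultimately show ?thesis by linarith
next
  case False
  have t1: "t powr p \<le> 1" using assms by (intro powr_le1) auto
  show ?thesis
  proof (cases "U > k")
    case True
    have "ppow p (U - V) = - ((V - U) powr (p - 1))" using ppow_neg[of p "V - U"] ppow_pos[of "V - U" p] False by simp
    then have "- (ppow p (U - V) * (max 0 (U - k) * t powr p)) = (U - k) * ((V - U) powr (p - 1) * t powr p)"
      using True by simp
    also have "\<dots> \<le> (U - k) * ((V - k) powr (p - 1) * 1)"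
      using True False p t1 by (intro mult_left_mono mult_mono powr_mono2) auto
    finally show ?thesis using True False by simp
  qed simp
qed


section \<open>Cutoff functions and the local estimate\<close>

lemma C1_grad_const: "C1_grad (\<lambda>_. c) (\<lambda>_. 0)"
  by (simp add: C1_grad_def)

lemma C1_grad_compose:
  assumes "C1_grad v Dv" "\<And>t. (F has_real_derivative F' t) (at t)" "continuous_on UNIV F'"
  shows "C1_grad (\<lambda>x. F (v x)) (\<lambda>x. F' (v x) *\<^sub>R Dv x)"
  using C1_grad_chain_mult[OF assms(1) C1_grad_const[of 1] assms(2,3)] by simp

text \<open>Composing with the squared distance keeps the cutoff differentiable at the centre. The
  profile S has slope at most 2 and q has gradient at most 2 \<sigma> / ((\<sigma> - \<rho>)
  (\<sigma> + \<rho>)) on the closed ball of radius \<sigma>; the bound \<sigma> / (\<sigma> +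
  \<rho>) \<le> 1 leaves the factor 4.\<close>

lemma cutoff_exists:
  fixes x0 :: "'a::euclidean_space"
  assumes "0 < \<rho>" "\<rho> < \<sigma>"
  obtains \<eta> D where "C1_grad \<eta> D" "\<And>x. 0 \<le> \<eta> x" "\<And>x. \<eta> x \<le> 1" "\<And>x. x \<in> ball x0 \<rho> \<Longrightarrow> \<eta> x = 1"
    "\<And>x. x \<notin> cball x0 \<sigma> \<Longrightarrow> \<eta> x = 0" "\<And>x. norm (D x) \<le> 4 / (\<sigma> - \<rho>)"
proof -
  define m where "m = \<sigma>\<^sup>2 - \<rho>\<^sup>2"
  have m: "m > 0" "m = (\<sigma> - \<rho>) * (\<sigma> + \<rho>)" using assms by (auto simp: m_def power2_eq_square algebra_simps intro: mult_strict_mono)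
  \<comment> \<open>A quadratic spline: curvature 4 on (0, 1/2), -4 on (1/2, 1), 0 elsewhere, so it
    rises from 0 to 1.\<close>
  define S where "S t = 2 * (max 0 (t - 0))\<^sup>2 - 4 * (max 0 (t - 1/2))\<^sup>2 + 2 * (max 0 (t - 1))\<^sup>2" for t :: real
  define S' where "S' t = 2 * (2 * max 0 (t - 0)) - 4 * (2 * max 0 (t - 1/2)) + 2 * (2 * max 0 (t - 1))" for t :: real
  have Sd: "(S has_real_derivative S' t) (at t)" for t
    unfolding S_def[abs_def] S'_def
    by (intro DERIV_add DERIV_diff DERIV_cmult sq_pos_part_derivative)
  have Sc: "continuous_on UNIV S'" unfolding S'_def[abs_def] by (intro continuous_intros)
  have S01: "0 \<le> S t \<and> S t \<le> 1 \<and> \<bar>S' t\<bar> \<le> 2" for t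
  proof -
    consider "t \<le> 0" | "0 < t" "t \<le> 1/2" | "1/2 < t" "t \<le> 1" | "t > 1" by linarith
    then show ?thesis
    proof cases
      case 2
      have "t\<^sup>2 \<le> (1/2)\<^sup>2" using 2 by (intro power_mono) auto
      then show ?thesis using 2 by (auto simp: S_def S'_def power2_eq_square)
    next
      case 3
      have "S t = 1 - 2 * (1 - t)\<^sup>2" using 3 by (simp add: S_def power2_eq_square algebra_simps)
      moreover have "(1 - t)\<^sup>2 \<le> (1/2)\<^sup>2" using 3 by (intro power_mono) auto
      ultimately show ?thesis using 3 by (auto simp: S'_def power2_eq_square)
    next
      case 4
      have "S t = 1" using 4 by (simp add: S_def power2_eq_square algebra_simps)
      then show ?thesis using 4 by (auto simp: S'_def)
    qed (auto simp: S_def S'_def)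
  qed
  have S1: "S t = 1" if "t \<ge> 1" for t using that by (simp add: S_def power2_eq_square algebra_simps)
  have S0: "S t = 0" if "t \<le> 0" for t using that by (simp add: S_def)
  define q where "q x = (\<sigma>\<^sup>2 - (x - x0) \<bullet> (x - x0)) / m" for x
  define Dq where "Dq x = (- 2 / m) *\<^sub>R (x - x0)" for x
  have qC: "C1_grad q Dq"
    unfolding C1_grad_def
  proof (intro conjI allI)
    fix x
    have "((\<lambda>x. (x - x0) \<bullet> (x - x0)) has_derivative (\<lambda>h. (x - x0) \<bullet> (h - 0) + (h - 0) \<bullet> (x - x0))) (at x)"
      by (intro has_derivative_inner has_derivative_diff has_derivative_ident has_derivative_const)
    from has_derivative_mult_right[OF has_derivative_diff[OF has_derivative_const[of "\<sigma>\<^sup>2"] this], of "1 / m"]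
    show "(q has_derivative (\<lambda>h. Dq x \<bullet> h)) (at x)"
      unfolding q_def[abs_def] Dq_def
      by (simp add: inner_commute[of _ "x - x0"])
    show "continuous_on UNIV Dq" unfolding Dq_def[abs_def] by (intro continuous_intros)
  qed
  define \<eta> where "\<eta> x = S (q x)" for x
  define D where "D x = S' (q x) *\<^sub>R Dq x" for x
  have C: "C1_grad \<eta> D" unfolding \<eta>_def[abs_def] D_def[abs_def] by (rule C1_grad_compose[OF qC Sd Sc])
  have sq: "(x - x0) \<bullet> (x - x0) = (dist x0 x)\<^sup>2" for x by (simp add: dist_norm norm_minus_commute[of x0] power2_norm_eq_inner)
  have out: "\<eta> x = 0" if "x \<notin> cball x0 \<sigma>" for x
  proof -
    have "\<sigma>\<^sup>2 \<le> (dist x0 x)\<^sup>2" using that assms by (intro power_mono) auto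
    then show ?thesis unfolding \<eta>_def q_def sq using m by (intro S0) (simp add: divide_le_0_iff)
  qed
  have one: "\<eta> x = 1" if "x \<in> ball x0 \<rho>" for x
  proof -
    have "(dist x0 x)\<^sup>2 \<le> \<rho>\<^sup>2" using that assms by (intro power_mono) auto
    then show ?thesis unfolding \<eta>_def q_def sq using m(1) by (intro S1) (simp add: m_def)
  qed
  have nD: "norm (D x) \<le> 4 / (\<sigma> - \<rho>)" for x
  proof (cases "x \<in> cball x0 \<sigma>")
    case True
    have "norm (D x) = \<bar>S' (q x)\<bar> * (2 / m * dist x0 x)" using m(1) by (simp add: D_def Dq_def dist_norm norm_minus_commute abs_mult)
    also have "\<dots> \<le> 2 * (2 / m * \<sigma>)" using S01[of "q x"] True m by (intro mult_mono) auto
    also have "\<dots> = 4 * \<sigma> / ((\<sigma> - \<rho>) * (\<sigma> + \<rho>))" unfolding m(2)[symmetric] by simp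
    also have "\<dots> = 4 / (\<sigma> - \<rho>) * (\<sigma> / (\<sigma> + \<rho>))" by simp
    also have "\<dots> \<le> 4 / (\<sigma> - \<rho>) * 1" using assms by (intro mult_left_mono) auto
    finally have "norm (D x) \<le> 4 / (\<sigma> - \<rho>) * 1" .
    then show ?thesis by simp
  next
    case False
    have "D x = 0" by (rule C1_grad_outside_support[OF C, of x0 \<sigma>]) (use out False in auto)
    then show ?thesis using assms by simp
  qed
  show ?thesis by (rule that[OF C _ _ one out nD]) (use S01 in \<open>auto simp: \<eta>_def\<close>)
qed

text \<open>Inserting \<open>max 0\<close> makes the power C^1 on the whole line, as the chain rule
  for \<open>C1_grad\<close> requires; p > 1 makes the slope vanish at 0.\<close>

lemma pos_powr_derivative:
  fixes p t :: real
  assumes "p > 1"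
  shows "((\<lambda>t. max 0 t powr p) has_real_derivative p * max 0 t powr (p - 1)) (at t)"
proof -
  consider "t > 0" | "t < 0" | "t = 0" by linarith
  then show ?thesis
  proof cases
    case 1
    have "((\<lambda>t. t powr p) has_real_derivative p * max 0 t powr (p - 1)) (at t)"
      using has_real_derivative_powr[OF 1, of p] 1 by simp
    then show ?thesis
      by (rule has_field_derivative_transform_within_open[of _ _ _ "{0<..}"]) (use 1 in auto)
  next
    case 2
    have "((\<lambda>t. 0) has_real_derivative p * max 0 t powr (p - 1)) (at t)" using 2 assms by auto
    then show ?thesis
      by (rule has_field_derivative_transform_within_open[of _ _ _ "{..<0}"]) (use 2 in auto)
  next
    case 3
    have "((\<lambda>h. (max 0 (0 + h) powr p - max 0 0 powr p) / h) \<longlongrightarrow> 0) (at 0)"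
    proof (rule Lim_null_comparison[of _ "\<lambda>h. \<bar>h\<bar> powr (p - 1)"])
      show "\<forall>\<^sub>F h in at 0. norm ((max 0 (0 + h) powr p - max 0 0 powr p) / h) \<le> \<bar>h\<bar> powr (p - 1)"
      proof (rule always_eventually, rule allI)
        fix h :: real
        show "norm ((max 0 (0 + h) powr p - max 0 0 powr p) / h) \<le> \<bar>h\<bar> powr (p - 1)"
        proof (cases "h > 0")
          case True then show ?thesis by (simp add: powr_diff)
        next
          case False
          then have "max 0 (0 + h) = 0" by simp
          then show ?thesis by simp
        qed
      qed
      have "((\<lambda>h::real. \<bar>h\<bar> powr (p - 1)) \<longlongrightarrow> \<bar>0\<bar> powr (p - 1)) (at 0)"
        using assms by (intro tendsto_powr' tendsto_intros) auto
      then show "((\<lambda>h::real. \<bar>h\<bar> powr (p - 1)) \<longlongrightarrow> 0) (at 0)" by simp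
    qed
    then have "((\<lambda>t. max 0 t powr p) has_real_derivative 0) (at 0)" by (simp add: DERIV_def)
    then show ?thesis using 3 assms by simp
  qed
qed

lemma C1_grad_powr:
  assumes "C1_grad \<eta> D" "\<And>x. 0 \<le> \<eta> x" "p > 1"
  shows "C1_grad (\<lambda>x. \<eta> x powr p) (\<lambda>x. (p * \<eta> x powr (p - 1)) *\<^sub>R D x)"
proof -
  have c: "continuous_on UNIV (\<lambda>t::real. p * max 0 t powr (p - 1))"
    using assms(3) by (intro continuous_intros continuous_on_powr') auto
  have "max 0 (\<eta> x) = \<eta> x" for x using assms(2)[of x] by simp
  then show ?thesis using C1_grad_compose[OF assms(1) pos_powr_derivative[OF assms(3)] c] by simp
qed

lemma nn_integral_lborel_pair:
  fixes f :: "'a::euclidean_space \<times> 'b::euclidean_space \<Rightarrow> ennreal"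
  assumes "f \<in> borel_measurable borel"
  shows "(\<integral>\<^sup>+z. f z \<partial>lborel) = (\<integral>\<^sup>+x. \<integral>\<^sup>+y. f (x, y) \<partial>lborel \<partial>lborel)"
proof -
  have "f \<in> borel_measurable (lborel \<Otimes>\<^sub>M lborel)" using assms by (simp add: lborel_prod)
  from lborel.nn_integral_fst[OF this] show ?thesis by (simp add: lborel_prod)
qed

text \<open>The exceptional set lies in two strips over a null set, each null in the product. This
  carries the change of representative of u into the double integral.\<close>

lemma AE_lborel_pair:
  fixes P :: "'a::euclidean_space \<Rightarrow> bool"
  assumes "AE x in lborel. P x"
  shows "AE z in lborel. P (fst z) \<and> P (snd z)"
proof -
  obtain N where N: "N \<in> null_sets lborel" "{x. \<not> P x} \<subseteq> N"
    using assms unfolding eventually_ae_filter by auto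
  have N0: "N \<in> sets borel" "emeasure lborel N = 0" using N by auto
  have 1: "N \<times> UNIV \<in> null_sets (lborel \<Otimes>\<^sub>M (lborel :: 'a measure))"
    using N0 lborel.emeasure_pair_measure_Times[of N lborel "UNIV :: 'a set"] by (intro null_setsI) auto
  have 2: "UNIV \<times> N \<in> null_sets ((lborel :: 'a measure) \<Otimes>\<^sub>M lborel)"
    using N0 lborel.emeasure_pair_measure_Times[of "UNIV :: 'a set" lborel N] by (intro null_setsI) auto
  have "N \<times> UNIV \<union> UNIV \<times> N \<in> null_sets (lborel :: ('a \<times> 'a) measure)"
    using null_sets.Un[OF 1 2] by (simp add: lborel_prod)
  then show ?thesis by (rule AE_I') (use N(2) in auto)
qed

section \<open>The local term and the truncated test function\<close>

text \<open>With \<epsilon> = C1 / (2 p C2) one has p C2 \<epsilon> = C1 / 2, so half of the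
  coercive term absorbs the mixed one; p C2 \<epsilon>^(1-p) is the price when absorption
  fails.\<close>

definition young_const :: "real \<Rightarrow> real \<Rightarrow> real \<Rightarrow> real" where
  "young_const p C1 C2 = p * C2 * (C1 / (2 * p * C2)) powr (1 - p)"

text \<open>The vector paired with b is the gradient of w \<eta>^p where u > k. Young's inequality
  is done by hand: with A = t |G| and E = w |d|, the mixed term A^(p-1) E is absorbed by A^p if E
  \<le> \<epsilon> A, and otherwise A \<le> E / \<epsilon> turns it into a multiple of E^p.\<close>

lemma local_young:
  fixes b G d :: "'a::euclidean_space"
  assumes p: "p > 1" and C: "C1 > 0" "C2 > 0" and t: "0 \<le> t" and w: "0 \<le> w"
    and b: "b \<bullet> G \<ge> C1 * norm G powr p" "norm b \<le> C2 * norm G powr (p - 1)"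
  shows "b \<bullet> (t powr p *\<^sub>R G + w *\<^sub>R ((p * t powr (p - 1)) *\<^sub>R d))
     \<ge> C1 / 2 * (t * norm G) powr p - young_const p C1 C2 * (w * norm d) powr p"
proof -
  define A where "A = t * norm G"
  define E where "E = w * norm d"
  have A0: "A \<ge> 0" "E \<ge> 0" using t w by (auto simp: A_def E_def)
  define \<epsilon> where "\<epsilon> = C1 / (2 * p * C2)"
  have \<epsilon>: "\<epsilon> > 0" using p C by (simp add: \<epsilon>_def)
  have 1: "t powr p * (b \<bullet> G) \<ge> C1 * A powr p"
    using mult_left_mono[OF b(1), of "t powr p"] t by (simp add: A_def powr_mult mult_ac)
  have "\<bar>w * (p * t powr (p - 1)) * (b \<bullet> d)\<bar> \<le> w * (p * t powr (p - 1)) * (C2 * norm G powr (p - 1) * norm d)"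
  proof -
    have "\<bar>b \<bullet> d\<bar> \<le> norm b * norm d" by (rule Cauchy_Schwarz_ineq2)
    also have "\<dots> \<le> C2 * norm G powr (p - 1) * norm d" using b(2) by (intro mult_right_mono) auto
    finally show ?thesis using w p by (simp add: abs_mult mult_left_mono)
  qed
  also have "\<dots> = p * C2 * (A powr (p - 1) * E)" using t by (simp add: A_def E_def powr_mult mult_ac)
  also have "\<dots> \<le> C1 / 2 * A powr p + young_const p C1 C2 * E powr p"
  proof (cases "E \<le> \<epsilon> * A")
    case True
    have "p * C2 * (A powr (p - 1) * E) \<le> p * C2 * (A powr (p - 1) * (\<epsilon> * A))"
      using True p C by (intro mult_left_mono) auto
    also have "\<dots> = C1 / 2 * A powr p"
      using p C A0 by (cases "A = 0") (auto simp: \<epsilon>_def powr_diff field_simps)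
    also have "\<dots> \<le> C1 / 2 * A powr p + young_const p C1 C2 * E powr p" using p C by (simp add: young_const_def)
    finally show ?thesis .
  next
    case False
    then have E: "E > 0" using A0 \<epsilon> by (smt (verit) mult_nonneg_nonneg)
    have "A \<le> E / \<epsilon>" using False \<epsilon> by (simp add: field_simps)
    then have "A powr (p - 1) \<le> (E / \<epsilon>) powr (p - 1)" using A0 p by (intro powr_mono2) auto
    also have "\<dots> = E powr (p - 1) * \<epsilon> powr (1 - p)" using E \<epsilon> by (simp add: powr_divide powr_diff field_simps)
    finally have "p * C2 * (A powr (p - 1) * E) \<le> p * C2 * (E powr (p - 1) * \<epsilon> powr (1 - p) * E)"
      using p C A0 by (intro mult_left_mono mult_right_mono) auto
    also have "\<dots> = young_const p C1 C2 * E powr p" using E by (simp add: young_const_def \<epsilon>_def[symmetric] powr_diff)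
    also have "\<dots> \<le> C1 / 2 * A powr p + young_const p C1 C2 * E powr p" using C by simp
    finally show ?thesis .
  qed
  finally have 2: "\<bar>w * (p * t powr (p - 1)) * (b \<bullet> d)\<bar> \<le> C1 / 2 * A powr p + young_const p C1 C2 * E powr p" .
  have "b \<bullet> (t powr p *\<^sub>R G + w *\<^sub>R ((p * t powr (p - 1)) *\<^sub>R d)) = t powr p * (b \<bullet> G) + w * (p * t powr (p - 1)) * (b \<bullet> d)"
    by (simp add: inner_add_right)
  then show ?thesis using 1 2 unfolding A_def[symmetric] E_def[symmetric] by linarith
qed

lemma partial_outside_support:
  assumes "x \<notin> closure {x. \<phi> x \<noteq> 0}"
  shows "\<phi> x = 0" "partial \<phi> i x = 0"
proof -
  show "\<phi> x = 0"
  proof (rule ccontr)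
    assume "\<phi> x \<noteq> 0"
    then show False using assms subsetD[OF closure_subset, of x "{x. \<phi> x \<noteq> 0}"] by simp
  qed
  define S where "S = (\<lambda>t. x + t *\<^sub>R i) -` (- closure {x. \<phi> x \<noteq> 0})"
  have "((\<lambda>t. \<phi> (x + t *\<^sub>R i)) has_real_derivative 0) (at 0)"
  proof (rule has_field_derivative_transform_within_open[of "\<lambda>t. 0" 0 0 S])
    show "open S" unfolding S_def by (rule continuous_open_vimage) (auto intro!: continuous_intros)
    show "0 \<in> S" using assms by (simp add: S_def)
    show "0 = \<phi> (x + t *\<^sub>R i)" if "t \<in> S" for t
    proof (rule ccontr)
      assume "0 \<noteq> \<phi> (x + t *\<^sub>R i)"
      then have "x + t *\<^sub>R i \<in> closure {x. \<phi> x \<noteq> 0}" by (intro subsetD[OF closure_subset]) simp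
      then show False using that by (simp add: S_def)
    qed
  qed simp
  then show "partial \<phi> i x = 0" by (simp add: partial_def DERIV_imp_deriv)
qed

text \<open>Links the Lebesgue data (uo, Go) on \<Omega> with Borel versions. The jump created by
  cutting u and g off at \<open>cball x0 R\<close> is invisible: the weak gradient is only tested
  inside that ball, and \<zeta> lives in a strictly smaller one.\<close>

lemma truncation_in_W1p:
  fixes u uo :: "'a::euclidean_space \<Rightarrow> real"
  assumes W: "W1p_loc \<Omega> p uo Go" and p: "p > 1"
    and u[measurable]: "u \<in> borel_measurable borel" and ae: "AE x in lebesgue. uo x = u x" and M: "\<And>x. \<bar>u x\<bar> \<le> M"
    and g[measurable]: "g \<in> borel_measurable borel" and aeg: "AE x in lebesgue. x \<in> \<Omega> \<longrightarrow> Go x = g x"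
    and z: "C1_grad \<zeta> D\<zeta>" "\<And>x. x \<notin> cball x0 \<sigma> \<Longrightarrow> \<zeta> x = 0" and R: "\<sigma> < R" "cball x0 R \<subseteq> \<Omega>"
  shows "W1p_approx p x0 \<sigma> (\<lambda>x. max 0 (u x - k) * \<zeta> x)
     (\<lambda>x. (of_bool (u x > k) * \<zeta> x) *\<^sub>R g x + max 0 (u x - k) *\<^sub>R D\<zeta> x)"
    and "Lpn p (\<lambda>x. indicat_real (cball x0 R) x *\<^sub>R g x) < \<infinity>"
proof -
  define I where "I = indicat_real (cball x0 R)"
  have Im[measurable]: "I \<in> borel_measurable borel" unfolding I_def by (intro borel_measurable_indicator) auto
  define u1 where "u1 x = I x * u x" for x
  define g1 where "g1 x = I x *\<^sub>R g x" for x
  have m1[measurable]: "u1 \<in> borel_measurable borel" "g1 \<in> borel_measurable borel"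
    unfolding u1_def[abs_def] g1_def[abs_def] by measurable
  have s1: "u1 x = 0" "g1 x = 0" if "x \<notin> cball x0 R" for x using that by (auto simp: u1_def g1_def I_def)
  have i1: "u1 x = u x" "g1 x = g x" if "x \<in> cball x0 R" for x using that by (auto simp: u1_def g1_def I_def)
  have up: "Lpn p u1 < \<infinity>"
  proof (rule le_less_trans)
    show "Lpn p u1 \<le> ennreal (M powr p) * emeasure lborel (cball x0 R)"
    proof (rule Lpn_bound_on)
      show "norm (u1 x) \<le> M" for x using M[of x] abs_ge_zero[of "u x"] by (auto simp: u1_def I_def indicator_def)
    qed (use s1 p in auto)
    show "\<dots> < \<infinity>" using emeasure_lborel_cball_finite[of x0 R] by (simp add: ennreal_mult_less_top)
  qed
  have "set_integrable lebesgue (cball x0 R) (\<lambda>x. norm (Go x) powr p)"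
    using W R(2) unfolding W1p_loc_def by auto
  then have "(\<integral>\<^sup>+x. ennreal (norm (indicator (cball x0 R) x *\<^sub>R (norm (Go x) powr p))) \<partial>lebesgue) < \<infinity>"
    unfolding set_integrable_def integrable_iff_bounded by simp
  also have "(\<integral>\<^sup>+x. ennreal (norm (indicator (cball x0 R) x *\<^sub>R (norm (Go x) powr p))) \<partial>lebesgue) = (\<integral>\<^sup>+x. ennreal (norm (g1 x) powr p) \<partial>lebesgue)"
  proof (rule nn_integral_cong_AE)
    show "AE x in lebesgue. ennreal (norm (indicator (cball x0 R) x *\<^sub>R (norm (Go x) powr p))) = ennreal (norm (g1 x) powr p)"
      using aeg
    proof eventually_elim
      fix x assume "x \<in> \<Omega> \<longrightarrow> Go x = g x"
      then show "ennreal (norm (indicator (cball x0 R) x *\<^sub>R (norm (Go x) powr p))) = ennreal (norm (g1 x) powr p)"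
        using R(2) p by (cases "x \<in> cball x0 R") (auto simp: g1_def I_def)
    qed
  qed
  finally have gp: "Lpn p g1 < \<infinity>" by (simp add: Lpn_def nn_integral_completion)
  then show "Lpn p (\<lambda>x. indicat_real (cball x0 R) x *\<^sub>R g x) < \<infinity>" by (simp add: g1_def[abs_def] I_def)
  have wg: "wgrad_on (ball x0 R) u1 g1"
    unfolding wgrad_on_def
  proof (intro allI impI ballI)
    fix \<phi> and i :: 'a assume t: "test_fun (ball x0 R) \<phi>" and i: "i \<in> Basis"
    have t': "test_fun \<Omega> \<phi>" using t R(2) ball_subset_cball[of x0 R] unfolding test_fun_def by blast
    have s: "smooth_fun \<phi>" using t by (simp add: test_fun_def)
    note c = smooth_funD(1,2)[OF s i]
    note [measurable] = borel_measurable_continuous_onI[OF c(1)] borel_measurable_continuous_onI[OF c(2)]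
    have out: "\<phi> x = 0" "partial \<phi> i x = 0" if "x \<notin> cball x0 R" for x
    proof -
      have "x \<notin> closure {x. \<phi> x \<noteq> 0}" using t that ball_subset_cball[of x0 R] unfolding test_fun_def by blast
      from partial_outside_support[OF this] show "\<phi> x = 0" "partial \<phi> i x = 0" .
    qed
    have w: "set_integrable lebesgue \<Omega> (\<lambda>x. uo x * partial \<phi> i x)" "set_integrable lebesgue \<Omega> (\<lambda>x. (Go x \<bullet> i) * \<phi> x)"
      "(LINT x:\<Omega>|lebesgue. uo x * partial \<phi> i x) = - (LINT x:\<Omega>|lebesgue. (Go x \<bullet> i) * \<phi> x)"
      using W t' i unfolding W1p_loc_def weak_grad_def by blast+
    have e1: "(LINT x:\<Omega>|lebesgue. uo x * partial \<phi> i x) = (\<integral>x. u1 x * partial \<phi> i x \<partial>lborel)"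
    proof -
      have "(LINT x:\<Omega>|lebesgue. uo x * partial \<phi> i x) = (\<integral>x. u1 x * partial \<phi> i x \<partial>lebesgue)"
        unfolding set_lebesgue_integral_def
      proof (rule integral_cong_AE)
        show "(\<lambda>x. indicat_real \<Omega> x *\<^sub>R (uo x * partial \<phi> i x)) \<in> borel_measurable lebesgue"
          using w(1) unfolding set_integrable_def by (rule borel_measurable_integrable)
        show "(\<lambda>x. u1 x * partial \<phi> i x) \<in> borel_measurable lebesgue" by (rule measurable_completion) measurable
        show "AE x in lebesgue. indicat_real \<Omega> x *\<^sub>R (uo x * partial \<phi> i x) = u1 x * partial \<phi> i x"
          using ae
        proof eventually_elim
          fix x assume "uo x = u x"
          then show "indicat_real \<Omega> x *\<^sub>R (uo x * partial \<phi> i x) = u1 x * partial \<phi> i x"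
            using out(2)[of x] i1(1)[of x] R(2) by (cases "x \<in> cball x0 R") auto
        qed
      qed
      also have "\<dots> = (\<integral>x. u1 x * partial \<phi> i x \<partial>lborel)" by (rule integral_completion) measurable
      finally show ?thesis .
    qed
    have e2: "(LINT x:\<Omega>|lebesgue. (Go x \<bullet> i) * \<phi> x) = (\<integral>x. (g1 x \<bullet> i) * \<phi> x \<partial>lborel)"
    proof -
      have "(LINT x:\<Omega>|lebesgue. (Go x \<bullet> i) * \<phi> x) = (\<integral>x. (g1 x \<bullet> i) * \<phi> x \<partial>lebesgue)"
        unfolding set_lebesgue_integral_def
      proof (rule integral_cong_AE)
        show "(\<lambda>x. indicat_real \<Omega> x *\<^sub>R ((Go x \<bullet> i) * \<phi> x)) \<in> borel_measurable lebesgue"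
          using w(2) unfolding set_integrable_def by (rule borel_measurable_integrable)
        show "(\<lambda>x. (g1 x \<bullet> i) * \<phi> x) \<in> borel_measurable lebesgue" by (rule measurable_completion) measurable
        show "AE x in lebesgue. indicat_real \<Omega> x *\<^sub>R ((Go x \<bullet> i) * \<phi> x) = (g1 x \<bullet> i) * \<phi> x"
          using aeg
        proof eventually_elim
          fix x assume "x \<in> \<Omega> \<longrightarrow> Go x = g x"
          then show "indicat_real \<Omega> x *\<^sub>R ((Go x \<bullet> i) * \<phi> x) = (g1 x \<bullet> i) * \<phi> x"
            using out(1)[of x] i1(2)[of x] R(2) by (cases "x \<in> cball x0 R") auto
        qed
      qed
      also have "\<dots> = (\<integral>x. (g1 x \<bullet> i) * \<phi> x \<partial>lborel)" by (rule integral_completion) measurable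
      finally show ?thesis .
    qed
    show "(\<integral>x. u1 x * partial \<phi> i x \<partial>lborel) = - (\<integral>x. (g1 x \<bullet> i) * \<phi> x \<partial>lborel)"
      using w(3) unfolding e1 e2 .
  qed
  have Dzs: "D\<zeta> x = 0" if "x \<notin> cball x0 \<sigma>" for x using C1_grad_outside_support[OF z that] .
  have A: "W1p_approx p x0 \<sigma> (\<lambda>x. max 0 (u1 x - k) * \<zeta> x)
     (\<lambda>x. (of_bool (u1 x > k) * \<zeta> x) *\<^sub>R g1 x + max 0 (u1 x - k) *\<^sub>R D\<zeta> x)"
    by (rule W1p_approx_truncation[OF m1(1) up s1(1) m1(2) gp s1(2) wg p z R(1)])
  have "(\<lambda>x. max 0 (u1 x - k) * \<zeta> x) = (\<lambda>x. max 0 (u x - k) * \<zeta> x)"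
  proof
    fix x show "max 0 (u1 x - k) * \<zeta> x = max 0 (u x - k) * \<zeta> x"
      using z(2)[of x] i1(1)[of x] R(1) by (cases "x \<in> cball x0 \<sigma>") auto
  qed
  moreover have "(\<lambda>x. (of_bool (u1 x > k) * \<zeta> x) *\<^sub>R g1 x + max 0 (u1 x - k) *\<^sub>R D\<zeta> x)
     = (\<lambda>x. (of_bool (u x > k) * \<zeta> x) *\<^sub>R g x + max 0 (u x - k) *\<^sub>R D\<zeta> x)"
  proof
    fix x show "(of_bool (u1 x > k) * \<zeta> x) *\<^sub>R g1 x + max 0 (u1 x - k) *\<^sub>R D\<zeta> x
       = (of_bool (u x > k) * \<zeta> x) *\<^sub>R g x + max 0 (u x - k) *\<^sub>R D\<zeta> x"
      using z(2)[of x] Dzs[of x] i1[of x] R(1) by (cases "x \<in> cball x0 \<sigma>") auto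
  qed
  ultimately show "W1p_approx p x0 \<sigma> (\<lambda>x. max 0 (u x - k) * \<zeta> x)
     (\<lambda>x. (of_bool (u x > k) * \<zeta> x) *\<^sub>R g x + max 0 (u x - k) *\<^sub>R D\<zeta> x)" using A by simp
qed


section \<open>The Caccioppoli inequality\<close>

lemma tail_integrable:
  fixes x0 :: "'a::euclidean_space"
  assumes f[measurable]: "f \<in> borel_measurable borel" and fM: "\<And>y. 0 \<le> f y" "\<And>y. f y \<le> M" and a: "a > 0" "\<rho> > 0"
  shows "integrable lborel (\<lambda>y. indicat_real (- ball x0 \<rho>) y * (f y * dist y x0 powr (- (real DIM('a) + a))))"
proof (rule integrableI_nonneg)
  have IC[measurable]: "indicat_real (- ball x0 \<rho>) \<in> borel_measurable borel" by (intro borel_measurable_indicator) auto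
  show "(\<lambda>y. indicat_real (- ball x0 \<rho>) y * (f y * dist y x0 powr (- (real DIM('a) + a)))) \<in> borel_measurable lborel" by measurable
  show "AE y in lborel. 0 \<le> indicat_real (- ball x0 \<rho>) y * (f y * dist y x0 powr (- (real DIM('a) + a)))" using fM by (intro AE_I2) auto
  define h where "h z = ennreal (norm z powr (- (real DIM('a) + a))) * indicator (- ball (0::'a) \<rho>) z" for z
  have hm[measurable]: "h \<in> borel_measurable borel" unfolding h_def[abs_def]
    by (intro borel_measurable_times_ennreal borel_measurable_indicator) auto
  have "(\<integral>\<^sup>+y. ennreal (indicat_real (- ball x0 \<rho>) y * (f y * dist y x0 powr (- (real DIM('a) + a)))) \<partial>lborel)
      \<le> (\<integral>\<^sup>+y. ennreal M * h (- x0 + y) \<partial>lborel)"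
  proof (rule nn_integral_mono)
    fix y
    show "ennreal (indicat_real (- ball x0 \<rho>) y * (f y * dist y x0 powr (- (real DIM('a) + a)))) \<le> ennreal M * h (- x0 + y)"
    proof (cases "y \<in> ball x0 \<rho>")
      case False
      then have "- x0 + y \<in> - ball 0 \<rho>" by (simp add: dist_norm norm_minus_commute)
      then have "ennreal M * h (- x0 + y) = ennreal M * ennreal (dist y x0 powr (- (real DIM('a) + a)))"
        by (simp add: h_def dist_norm)
      also have "\<dots> = ennreal (M * dist y x0 powr (- (real DIM('a) + a)))"
        using fM(1,2)[of y] by (intro ennreal_mult[symmetric]) auto
      finally show ?thesis using False fM(2)[of y] by (auto intro!: ennreal_leI mult_right_mono)
    qed simp
  qed
  also have "\<dots> = ennreal M * (\<integral>\<^sup>+y. h y \<partial>lborel)"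
    using nn_integral_lborel_shift[of h "- x0"] by (simp add: nn_integral_cmult)
  also have "\<dots> < \<infinity>"
    using nn_integral_norm_powr_far[OF a, where 'a='a] by (simp add: h_def[abs_def] ennreal_mult_less_top)
  finally show "(\<integral>\<^sup>+y. ennreal (indicat_real (- ball x0 \<rho>) y * (f y * dist y x0 powr (- (real DIM('a) + a)))) \<partial>lborel) < \<infinity>" .
qed

lemma ball_integrable:
  fixes f :: "'a::euclidean_space \<Rightarrow> real"
  assumes [measurable]: "f \<in> borel_measurable borel" and "\<And>y. \<bar>f y\<bar> \<le> M"
  shows "integrable lborel (\<lambda>y. indicat_real (ball x0 \<rho>) y * f y)"
proof (rule Bochner_Integration.integrable_bound[of _ "\<lambda>y. M * indicat_real (ball x0 \<rho>) y"])
  have [measurable]: "indicat_real (ball x0 \<rho>) \<in> borel_measurable borel" by (intro borel_measurable_indicator) auto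
  show "(\<lambda>y. indicat_real (ball x0 \<rho>) y * f y) \<in> borel_measurable lborel" by measurable
  have "integrable lborel (indicat_real (ball x0 \<rho>))"
    using emeasure_lborel_ball_finite by (intro integrable_real_indicator) auto
  then show "integrable lborel (\<lambda>y. M * indicat_real (ball x0 \<rho>) y)" by simp
  show "AE y in lborel. norm (indicat_real (ball x0 \<rho>) y * f y) \<le> norm (M * indicat_real (ball x0 \<rho>) y)"
  proof (rule AE_I2)
    fix y show "norm (indicat_real (ball x0 \<rho>) y * f y) \<le> norm (M * indicat_real (ball x0 \<rho>) y)"
      using assms(2)[of y] by (cases "y \<in> ball x0 \<rho>") auto
  qed
qed

text \<open>The integrand F is symmetric and -F has the symmetrised majorant D0(x, y) + D0(y, x),
  whence the factor 2. Integrating D0 in y produces Cn from the near part and the tail integral from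
  the far part.\<close>

lemma nonlocal_lower_bound:
  fixes u uo :: "'a::euclidean_space \<Rightarrow> real" and K :: "'a \<Rightarrow> 'a \<Rightarrow> real"
  assumes p: "p > 1" and s: "0 < s" "s < 1" and Lam: "\<Lambda> \<ge> 1"
    and Ks: "\<And>x y. K x y = K y x"
    and Kb: "\<And>x y. x \<noteq> y \<Longrightarrow> dist x y powr (- (real DIM('a) + p * s)) / \<Lambda> \<le> K x y \<and>
                K x y \<le> \<Lambda> * dist x y powr (- (real DIM('a) + p * s))"
    and u[measurable]: "u \<in> borel_measurable borel" and ae: "AE x in lebesgue. uo x = u x" and M: "\<And>x. \<bar>u x\<bar> \<le> M"
    and \<eta>: "C1_grad \<eta> D\<eta>" "\<And>x. 0 \<le> \<eta> x" "\<And>x. \<eta> x \<le> 1" "\<And>x. x \<notin> cball x0 \<sigma> \<Longrightarrow> \<eta> x = 0" "\<And>x. norm (D\<eta> x) \<le> Lc"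
    and r: "0 < \<sigma>" "\<sigma> < \<rho>" "\<rho> \<le> 1"
    and Cn: "(\<integral>\<^sup>+z. ennreal (norm z powr (p * (1 - s) - real DIM('a))) * indicator (ball (0::'a) 2 - {0}) z \<partial>lborel) = ennreal Cn" "Cn \<ge> 0"
    and w_def: "w = (\<lambda>x. max 0 (u x - k))"
    and int: "integrable lebesgue (\<lambda>(x, y). ppow p (uo x - uo y) * (w x * \<eta> x powr p - w y * \<eta> y powr p) * K x y)"
  shows "(LINT z|lebesgue. (\<lambda>(x, y). ppow p (uo x - uo y) * (w x * \<eta> x powr p - w y * \<eta> y powr p) * K x y) z)
     \<ge> - (2 * (\<Lambda> * nonlocal_const p * Lc powr p * Cn * (\<integral>x. indicat_real (ball x0 \<rho>) x * w x powr p \<partial>lborel)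
        + \<Lambda> * (1 - \<sigma> / \<rho>) powr (- (real DIM('a) + p * s)) * (\<integral>x. indicat_real (ball x0 \<rho>) x * w x \<partial>lborel)
          * (\<integral>y. indicat_real (- ball x0 \<rho>) y * (w y powr (p - 1) * dist y x0 powr (- (real DIM('a) + p * s))) \<partial>lborel)))"
proof -
  define q where "q = real DIM('a) + p * s"
  have q0: "q \<ge> 0" unfolding q_def using p s by (intro add_nonneg_nonneg) auto
  define IB where "IB = indicat_real (ball x0 \<rho>)"
  define IC where "IC = indicat_real (- ball x0 \<rho>)"
  have [measurable]: "IB \<in> borel_measurable borel" "IC \<in> borel_measurable borel"
    unfolding IB_def IC_def by (intro borel_measurable_indicator; auto)+
  have [measurable]: "w \<in> borel_measurable borel" unfolding w_def by measurable
  have w0: "0 \<le> w x" for x by (simp add: w_def)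
  have wM: "w x \<le> M + \<bar>k\<bar>" for x using M[of x] unfolding w_def by (auto simp: max_def)
  have IB0: "0 \<le> IB x" "IB x \<le> 1" "0 \<le> IC x" "IC x \<le> 1" for x by (auto simp: IB_def IC_def)
  have Lc0: "0 \<le> Lc" using \<eta>(5)[of x0] norm_ge_zero[of "D\<eta> x0"] by linarith
  \<comment> \<open>For x in \<open>cball x0 \<sigma>\<close> and y outside
    \<open>ball x0 \<rho>\<close>, |x - y| \<ge> \<kappa> |y - x0|. This moves the pole of the
    kernel from x to the centre, as in the tail integral.\<close>
  define \<kappa> where "\<kappa> = 1 - \<sigma> / \<rho>"
  have \<kappa>: "\<kappa> > 0" using r by (simp add: \<kappa>_def)
  define c1 where "c1 = \<Lambda> * nonlocal_const p * Lc powr p"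
  define c2 where "c2 = \<Lambda> * \<kappa> powr (- q)"
  have c0: "c1 \<ge> 0" "c2 \<ge> 0" using Lam nonlocal_const_pos[OF p] by (auto simp: c1_def c2_def)
  define A where "A = (\<integral>x. IB x * w x powr p \<partial>lborel)"
  define A1 where "A1 = (\<integral>x. IB x * w x \<partial>lborel)"
  define T where "T = (\<integral>y. IC y * (w y powr (p - 1) * dist y x0 powr (- q)) \<partial>lborel)"
  have Ai: "integrable lborel (\<lambda>x. IB x * w x powr p)"
    unfolding IB_def
  proof (rule ball_integrable)
    show "\<bar>w x powr p\<bar> \<le> (M + \<bar>k\<bar>) powr p" for x using w0 wM p by (auto intro!: powr_mono2)
  qed measurable
  have A1i: "integrable lborel (\<lambda>x. IB x * w x)"
    unfolding IB_def by (rule ball_integrable[where M="M + \<bar>k\<bar>"]) (use w0 wM in auto)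
  have Ti: "integrable lborel (\<lambda>y. IC y * (w y powr (p - 1) * dist y x0 powr (- q)))"
    unfolding IC_def q_def
  proof (rule tail_integrable)
    show "w y powr (p - 1) \<le> (M + \<bar>k\<bar>) powr (p - 1)" for y using w0 wM p by (auto intro!: powr_mono2)
  qed (use p s r in auto)
  have A0: "A \<ge> 0" "A1 \<ge> 0" "T \<ge> 0" unfolding A_def A1_def T_def
    using IB0 w0 by (auto intro!: integral_nonneg_AE)
  \<comment> \<open>The c1 part is for two points of the ball: |x - y|^p from the Lipschitz cutoff
    against the kernel exponent q. The c2 part is for y outside, where \<eta> vanishes at y and y
    contributes only to the tail.\<close>
  define D0 where "D0 x y = c1 * (IB x * IB y * (w x powr p * dist x y powr (p - q)))
     + c2 * ((IB x * w x) * (IC y * (w y powr (p - 1) * dist y x0 powr (- q))))" for x y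
  have D0nn: "0 \<le> D0 x y" for x y unfolding D0_def using c0 IB0 w0 by (intro add_nonneg_nonneg mult_nonneg_nonneg) auto
  have etaL: "\<bar>\<eta> x - \<eta> y\<bar> \<le> Lc * dist x y" for x y
  proof -
    obtain t where "\<eta> (x + (y - x)) - \<eta> x = D\<eta> (x + t *\<^sub>R (y - x)) \<bullet> (y - x)" using C1_grad_mean_value[OF \<eta>(1)] by blast
    then have "\<bar>\<eta> y - \<eta> x\<bar> \<le> norm (D\<eta> (x + t *\<^sub>R (y - x))) * norm (y - x)" using Cauchy_Schwarz_ineq2 by simp
    also have "\<dots> \<le> Lc * norm (y - x)" using \<eta>(5) by (intro mult_right_mono) auto
    finally show ?thesis by (simp add: dist_norm norm_minus_commute abs_minus_commute)
  qed
  define F where "F x y = ppow p (u x - u y) * (w x * \<eta> x powr p - w y * \<eta> y powr p) * K x y" for x y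
  have Fsym: "F x y = F y x" for x y
  proof -
    have "ppow p (u x - u y) = - ppow p (u y - u x)" using ppow_neg[of p "u y - u x"] by simp
    then show ?thesis unfolding F_def using Ks[of x y] by (simp add: algebra_simps)
  qed
  have K0: "0 \<le> K x y" "K x y \<le> \<Lambda> * dist x y powr (- q)" if "x \<noteq> y" for x y
  proof -
    have "0 \<le> dist x y powr (- q) / \<Lambda>" using Lam by simp
    also have "\<dots> \<le> K x y" using Kb[OF that] by (simp add: q_def)
    finally show "0 \<le> K x y" .
    show "K x y \<le> \<Lambda> * dist x y powr (- q)" using Kb[OF that] by (simp add: q_def)
  qed
  have eta0: "\<eta> x powr p = 0" if "x \<notin> ball x0 \<rho>" for x using \<eta>(4)[of x] that r p by auto
  have bnd: "- F x y \<le> D0 x y + D0 y x" if x: "x \<in> ball x0 \<rho>" for x y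
  proof (cases "x = y")
    case True then show ?thesis using D0nn[of x y] D0nn[of y x] by (simp add: F_def ppow_def)
  next
    case False
    note Kxy = K0[OF False]
    show ?thesis
    proof (cases "y \<in> ball x0 \<rho>")
      case True
      define Q where "Q = nonlocal_const p * ((w x powr p + w y powr p) * (Lc powr p * dist x y powr p))"
      have Q0: "Q \<ge> 0" using nonlocal_const_pos[OF p] by (simp add: Q_def)
      have "- (ppow p (u x - u y) * (w x * \<eta> x powr p - w y * \<eta> y powr p)) \<le> nonlocal_const p * ((w x powr p + w y powr p) * \<bar>\<eta> x - \<eta> y\<bar> powr p)"
        unfolding w_def by (rule nonlocal_pointwise[OF \<eta>(2) \<eta>(2) p])
      also have "\<dots> \<le> Q"
      proof -
        have "\<bar>\<eta> x - \<eta> y\<bar> powr p \<le> (Lc * dist x y) powr p" using etaL p by (intro powr_mono2) auto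
        also have "\<dots> = Lc powr p * dist x y powr p" using Lc0 by (simp add: powr_mult)
        finally show ?thesis unfolding Q_def using nonlocal_const_pos[OF p] by (intro mult_left_mono) auto
      qed
      finally have "- (ppow p (u x - u y) * (w x * \<eta> x powr p - w y * \<eta> y powr p)) * K x y \<le> Q * K x y"
        using Kxy by (intro mult_right_mono)
      also have "\<dots> \<le> Q * (\<Lambda> * dist x y powr (- q))" using Kxy Q0 by (intro mult_left_mono)
      also have "\<dots> = c1 * (w x powr p * dist x y powr (p - q)) + c1 * (w y powr p * dist x y powr (p - q))"
        using False by (simp add: Q_def c1_def powr_diff powr_minus field_simps)
      also have "\<dots> \<le> D0 x y + D0 y x"
        using x True by (simp add: D0_def IB_def IC_def dist_commute)
      finally show ?thesis by (simp add: F_def)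
    next
      case y: False
      show ?thesis
      proof (cases "\<eta> x = 0")
        case True
        then have "F x y = 0" using eta0[OF y] p by (simp add: F_def)
        then show ?thesis using D0nn[of x y] D0nn[of y x] by simp
      next
        case nz: False
        then have xs: "dist x0 x \<le> \<sigma>" using \<eta>(4)[of x] by auto
        have yr: "dist x0 y \<ge> \<rho>" using y by simp
        have "\<kappa> * dist y x0 = dist y x0 - \<sigma> * (dist y x0 / \<rho>)" using r by (simp add: \<kappa>_def field_simps)
        also have "\<dots> \<le> dist y x0 - \<sigma> * 1" using yr r by (intro diff_left_mono mult_left_mono) (auto simp: dist_commute)
        also have "\<dots> \<le> dist x y" using xs dist_triangle[of y x0 x] by (simp add: dist_commute)
        finally have d: "\<kappa> * dist y x0 \<le> dist x y" .
        have dp: "dist y x0 > 0" using yr r unfolding dist_commute[of y x0] by linarith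
        have "dist x y powr (- q) \<le> (\<kappa> * dist y x0) powr (- q)"
          using d \<kappa> dp q0 by (intro powr_mono2') auto
        also have "\<dots> = \<kappa> powr (- q) * dist y x0 powr (- q)" using \<kappa> by (simp add: powr_mult)
        finally have Kc: "K x y \<le> c2 * dist y x0 powr (- q)"
          using order_trans[OF Kxy(2) mult_left_mono[of _ _ \<Lambda>]] Lam by (simp add: c2_def mult.assoc)
        have "- (ppow p (u x - u y) * (w x * \<eta> x powr p)) \<le> w x * w y powr (p - 1)"
          unfolding w_def by (rule nonlocal_pointwise_tail[OF \<eta>(2) \<eta>(3) p])
        then have "- (ppow p (u x - u y) * (w x * \<eta> x powr p)) * K x y \<le> (w x * w y powr (p - 1)) * K x y"
          using Kxy by (intro mult_right_mono)
        also have "\<dots> \<le> (w x * w y powr (p - 1)) * (c2 * dist y x0 powr (- q))"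
          using Kc w0 by (intro mult_left_mono) auto
        also have "\<dots> = D0 x y" using x y by (simp add: D0_def IB_def IC_def)
        also have "\<dots> \<le> D0 x y + D0 y x" using D0nn[of y x] by simp
        finally show ?thesis using eta0[OF y] by (simp add: F_def)
      qed
    qed
  qed
  \<comment> \<open>Symmetry of F moves a point of the ball into the first slot; if both points lie
    outside, \<eta> vanishes at both and F = 0.\<close>
  have bnd': "- F x y \<le> D0 x y + D0 y x" for x y
  proof (cases "x \<in> ball x0 \<rho>")
    case False
    show ?thesis
    proof (cases "y \<in> ball x0 \<rho>")
      case True then show ?thesis using bnd[OF True, of x] Fsym[of x y] by simp
    next
      case y: False
      then have "F x y = 0" using eta0[OF False] eta0[OF y] by (simp add: F_def)
      then show ?thesis using D0nn[of x y] D0nn[of y x] by simp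
    qed
  qed (use bnd in blast)
  \<comment> \<open>The exponent is p - q = p (1 - s) - DIM, and two points of a ball of radius
    \<rho> \<le> 1 differ by less than 2; hence one constant Cn for all radii.\<close>
  define h where "h z = ennreal (norm z powr (p * (1 - s) - real DIM('a))) * indicator (ball (0::'a) 2 - {0}) z" for z
  have hm[measurable]: "h \<in> borel_measurable borel" unfolding h_def[abs_def]
    by (intro borel_measurable_times_ennreal borel_measurable_indicator) auto
  have hint: "(\<integral>\<^sup>+y. h (x - y) \<partial>lborel) = ennreal Cn" for x
    using nn_integral_lborel_reflect[OF hm, of x] Cn(1) by (simp add: h_def[abs_def])
  have inner: "(\<integral>\<^sup>+y. ennreal (D0 x y) \<partial>lborel) \<le> ennreal (c1 * Cn * (IB x * w x powr p) + c2 * T * (IB x * w x))" for x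
  proof -
    have "(\<integral>\<^sup>+y. ennreal (D0 x y) \<partial>lborel) \<le> (\<integral>\<^sup>+y. ennreal (c1 * (IB x * w x powr p)) * h (x - y)
       + ennreal (c2 * (IB x * w x)) * ennreal (IC y * (w y powr (p - 1) * dist y x0 powr (- q))) \<partial>lborel)"
    proof (rule nn_integral_mono)
      fix y
      have 1: "ennreal (IB x * IB y * dist x y powr (p - q)) \<le> ennreal (IB x) * h (x - y)"
      proof (cases "x \<in> ball x0 \<rho> \<and> y \<in> ball x0 \<rho> \<and> x \<noteq> y")
        case True
        then have "dist x y < 2" using dist_triangle[of x y x0] r by (simp add: dist_commute)
        then have "x - y \<in> ball 0 2 - {0}" using True by (simp add: dist_norm norm_minus_commute)
        moreover have "p - q = p * (1 - s) - real DIM('a)" by (simp add: q_def algebra_simps)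
        ultimately show ?thesis using True by (simp add: h_def IB_def dist_norm)
      next
        case False
        then have "IB x * IB y * dist x y powr (p - q) = 0" by (auto simp: IB_def)
        then show ?thesis by (simp only: ennreal_0 zero_le)
      qed
      have "ennreal (D0 x y) = ennreal (c1 * w x powr p) * ennreal (IB x * IB y * dist x y powr (p - q))
          + ennreal (c2 * (IB x * w x)) * ennreal (IC y * (w y powr (p - 1) * dist y x0 powr (- q)))"
        unfolding D0_def using c0 IB0 w0
        by (subst ennreal_plus, simp, simp) (simp add: ennreal_mult[symmetric] mult_ac)
      also have "\<dots> \<le> ennreal (c1 * w x powr p) * (ennreal (IB x) * h (x - y))
          + ennreal (c2 * (IB x * w x)) * ennreal (IC y * (w y powr (p - 1) * dist y x0 powr (- q)))"
        by (intro add_right_mono mult_left_mono 1) auto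
      also have "ennreal (c1 * w x powr p) * (ennreal (IB x) * h (x - y)) = ennreal (c1 * (IB x * w x powr p)) * h (x - y)"
        using c0 IB0 by (simp add: mult.assoc[symmetric] ennreal_mult[symmetric]) (simp add: mult_ac)
      finally show "ennreal (D0 x y) \<le> ennreal (c1 * (IB x * w x powr p)) * h (x - y)
       + ennreal (c2 * (IB x * w x)) * ennreal (IC y * (w y powr (p - 1) * dist y x0 powr (- q)))" .
    qed
    also have "\<dots> = ennreal (c1 * (IB x * w x powr p)) * (\<integral>\<^sup>+y. h (x - y) \<partial>lborel)
       + ennreal (c2 * (IB x * w x)) * (\<integral>\<^sup>+y. ennreal (IC y * (w y powr (p - 1) * dist y x0 powr (- q))) \<partial>lborel)"
      by (subst nn_integral_add) (simp_all add: nn_integral_cmult)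
    also have "(\<integral>\<^sup>+y. ennreal (IC y * (w y powr (p - 1) * dist y x0 powr (- q))) \<partial>lborel) = ennreal T"
      unfolding T_def by (rule nn_integral_eq_integral[OF Ti]) (use IB0 in auto)
    also have "ennreal (c1 * (IB x * w x powr p)) * (\<integral>\<^sup>+y. h (x - y) \<partial>lborel) + ennreal (c2 * (IB x * w x)) * ennreal T
      = ennreal (c1 * Cn * (IB x * w x powr p) + c2 * T * (IB x * w x))"
      unfolding hint using c0 IB0 w0 A0 Cn(2)
      by (subst ennreal_plus) (auto simp: ennreal_mult[symmetric] mult_ac)
    finally show ?thesis .
  qed
  define S where "S = c1 * Cn * A + c2 * T * A1"
  have S0: "S \<ge> 0" using c0 Cn(2) A0 by (simp add: S_def)
  have D0int: "(\<integral>\<^sup>+x. \<integral>\<^sup>+y. ennreal (D0 x y) \<partial>lborel \<partial>lborel) \<le> ennreal S"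
  proof -
    have "(\<integral>\<^sup>+x. \<integral>\<^sup>+y. ennreal (D0 x y) \<partial>lborel \<partial>lborel) \<le> (\<integral>\<^sup>+x. ennreal (c1 * Cn * (IB x * w x powr p) + c2 * T * (IB x * w x)) \<partial>lborel)"
      by (intro nn_integral_mono inner)
    also have "\<dots> = ennreal (\<integral>x. c1 * Cn * (IB x * w x powr p) + c2 * T * (IB x * w x) \<partial>lborel)"
      using Ai A1i c0 Cn(2) A0 IB0 w0 by (intro nn_integral_eq_integral AE_I2) auto
    also have "(\<integral>x. c1 * Cn * (IB x * w x powr p) + c2 * T * (IB x * w x) \<partial>lborel) = S"
      using Ai A1i by (simp add: S_def A_def A1_def)
    finally show ?thesis .
  qed
  have D0m[measurable]: "(\<lambda>z. ennreal (D0 (fst z) (snd z))) \<in> borel_measurable borel"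
    unfolding D0_def borel_prod[symmetric] by measurable
  have D0m'[measurable]: "(\<lambda>z. ennreal (D0 (snd z) (fst z))) \<in> borel_measurable borel"
    unfolding D0_def borel_prod[symmetric] by measurable
  have D0m2: "(\<lambda>(x, y). ennreal (D0 x y)) \<in> borel_measurable (lborel \<Otimes>\<^sub>M lborel)"
    using D0m by (simp add: lborel_prod split_beta')
  let ?Fo = "\<lambda>(x, y). ppow p (uo x - uo y) * (w x * \<eta> x powr p - w y * \<eta> y powr p) * K x y"
  have ae2: "AE z in lebesgue. - ?Fo z \<le> D0 (fst z) (snd z) + D0 (snd z) (fst z)"
  proof -
    have "AE x in lborel. uo x = u x" using ae by (simp add: AE_completion_iff)
    from AE_lborel_pair[OF this] have "AE z in lborel. uo (fst z) = u (fst z) \<and> uo (snd z) = u (snd z)" .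
    then have "AE z in lborel. - ?Fo z \<le> D0 (fst z) (snd z) + D0 (snd z) (fst z)"
    proof eventually_elim
      fix z assume "uo (fst z) = u (fst z) \<and> uo (snd z) = u (snd z)"
      then have "?Fo z = F (fst z) (snd z)" by (simp add: F_def split_beta')
      then show "- ?Fo z \<le> D0 (fst z) (snd z) + D0 (snd z) (fst z)" using bnd' by simp
    qed
    then show ?thesis by (simp add: AE_completion_iff)
  qed
  \<comment> \<open>Only the negative part of the integrand has to be controlled:
    \<open>ennreal\<close> sends negative reals to 0, so the integral of the negated integrand is
    below its nonnegative integral.\<close>
  have "ennreal (- (LINT z|lebesgue. ?Fo z)) = ennreal (LINT z|lebesgue. - ?Fo z)" by simp
  also have "\<dots> \<le> (\<integral>\<^sup>+z. ennreal (- ?Fo z) \<partial>lebesgue)"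
  proof -
    have "(LINT z|lebesgue. - ?Fo z) \<le> (LINT z|lebesgue. max 0 (- ?Fo z))"
      using int by (intro integral_mono) auto
    then have "ennreal (LINT z|lebesgue. - ?Fo z) \<le> ennreal (LINT z|lebesgue. max 0 (- ?Fo z))" by (rule ennreal_leI)
    also have "\<dots> = (\<integral>\<^sup>+z. ennreal (max 0 (- ?Fo z)) \<partial>lebesgue)"
      using int by (intro nn_integral_eq_integral[symmetric]) auto
    also have "\<dots> = (\<integral>\<^sup>+z. ennreal (- ?Fo z) \<partial>lebesgue)" by (intro nn_integral_cong) (auto simp: max_def ennreal_neg)
    finally show ?thesis .
  qed
  also have "\<dots> \<le> (\<integral>\<^sup>+z. ennreal (D0 (fst z) (snd z)) + ennreal (D0 (snd z) (fst z)) \<partial>lebesgue)"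
  proof (rule nn_integral_mono_AE)
    show "AE z in lebesgue. ennreal (- ?Fo z) \<le> ennreal (D0 (fst z) (snd z)) + ennreal (D0 (snd z) (fst z))"
      using ae2
    proof eventually_elim
      fix z assume "- ?Fo z \<le> D0 (fst z) (snd z) + D0 (snd z) (fst z)"
      then have "ennreal (- ?Fo z) \<le> ennreal (D0 (fst z) (snd z) + D0 (snd z) (fst z))" by (rule ennreal_leI)
      then show "ennreal (- ?Fo z) \<le> ennreal (D0 (fst z) (snd z)) + ennreal (D0 (snd z) (fst z))"
        using D0nn by simp
    qed
  qed
  also have "\<dots> = (\<integral>\<^sup>+z. ennreal (D0 (fst z) (snd z)) \<partial>lborel) + (\<integral>\<^sup>+z. ennreal (D0 (snd z) (fst z)) \<partial>lborel)"
    unfolding nn_integral_completion by (rule nn_integral_add) (simp_all add: D0m D0m')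
  also have "(\<integral>\<^sup>+z. ennreal (D0 (fst z) (snd z)) \<partial>lborel) = (\<integral>\<^sup>+x. \<integral>\<^sup>+y. ennreal (D0 x y) \<partial>lborel \<partial>lborel)"
    by (simp add: nn_integral_lborel_pair[OF D0m])
  also have "(\<integral>\<^sup>+z. ennreal (D0 (snd z) (fst z)) \<partial>lborel) = (\<integral>\<^sup>+x. \<integral>\<^sup>+y. ennreal (D0 y x) \<partial>lborel \<partial>lborel)"
    by (simp add: nn_integral_lborel_pair[OF D0m'])
  also have "(\<integral>\<^sup>+x. \<integral>\<^sup>+y. ennreal (D0 y x) \<partial>lborel \<partial>lborel) = (\<integral>\<^sup>+x. \<integral>\<^sup>+y. ennreal (D0 x y) \<partial>lborel \<partial>lborel)"
    using lborel_pair.Fubini'[OF D0m2] by simp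
  also have "(\<integral>\<^sup>+x. \<integral>\<^sup>+y. ennreal (D0 x y) \<partial>lborel \<partial>lborel) + (\<integral>\<^sup>+x. \<integral>\<^sup>+y. ennreal (D0 x y) \<partial>lborel \<partial>lborel) \<le> ennreal S + ennreal S"
    by (intro add_mono D0int)
  also have "\<dots> = ennreal (2 * S)" using S0 by (subst ennreal_plus[symmetric]) auto
  finally have "- (LINT z|lebesgue. ?Fo z) \<le> 2 * S" using S0 by (subst (asm) ennreal_le_iff) auto
  moreover have "2 * S = 2 * (\<Lambda> * nonlocal_const p * Lc powr p * Cn * A + \<Lambda> * (1 - \<sigma> / \<rho>) powr (- q) * A1 * T)"
    by (simp add: S_def c1_def c2_def \<kappa>_def mult_ac)
  ultimately show ?thesis
    unfolding A_def A1_def T_def IB_def IC_def q_def by linarith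
qed


text \<open>The test function is w \<eta>^p. Where u > k the local integrand is at least half of the
  coercive energy minus a cutoff term; where u \<le> k it vanishes. Together with the nonlocal lower
  bound, the weak inequality leaves the energy alone on one side.\<close>

lemma energy_estimate:
  fixes u uo :: "'a::euclidean_space \<Rightarrow> real" and K :: "'a \<Rightarrow> 'a \<Rightarrow> real" and B :: "'a \<Rightarrow> real \<Rightarrow> 'a \<Rightarrow> 'a"
  assumes p: "p > 1" and s: "0 < s" "s < 1" and Lam: "\<Lambda> \<ge> 1" and C: "C1 > 0" "C2 > 0"
    and H1: "AE x in lebesgue. x \<in> \<Omega> \<longrightarrow> (\<forall>v \<zeta>. B x v \<zeta> \<bullet> \<zeta> \<ge> C1 * norm \<zeta> powr p \<and> norm (B x v \<zeta>) \<le> C2 * norm \<zeta> powr (p - 1))"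
    and Ks: "\<And>x y. K x y = K y x"
    and Kb: "\<And>x y. x \<noteq> y \<Longrightarrow> dist x y powr (- (real DIM('a) + p * s)) / \<Lambda> \<le> K x y \<and>
                K x y \<le> \<Lambda> * dist x y powr (- (real DIM('a) + p * s))"
    and W: "W1p_loc \<Omega> p uo Go"
    and sub: "\<And>\<Omega>' \<phi> G\<phi>. open \<Omega>' \<and> compact (closure \<Omega>') \<and> closure \<Omega>' \<subseteq> \<Omega> \<and> W01p \<Omega>' p \<phi> G\<phi> \<and> (AE x in lebesgue. 0 \<le> \<phi> x) \<longrightarrow>
          set_integrable lebesgue \<Omega>' (\<lambda>x. B x (uo x) (Go x) \<bullet> G\<phi> x) \<and>
          integrable lebesgue (\<lambda>(x,y). ppow p (uo x - uo y) * (\<phi> x - \<phi> y) * K x y) \<and>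
          (LINT x:\<Omega>'|lebesgue. B x (uo x) (Go x) \<bullet> G\<phi> x)
            + (LINT z|lebesgue. (\<lambda>(x,y). ppow p (uo x - uo y) * (\<phi> x - \<phi> y) * K x y) z) \<le> 0"
    and u[measurable]: "u \<in> borel_measurable borel" and ae: "AE x in lebesgue. uo x = u x" and M: "\<And>x. \<bar>u x\<bar> \<le> M"
    and g[measurable]: "g \<in> borel_measurable borel" and aeg: "AE x in lebesgue. x \<in> \<Omega> \<longrightarrow> Go x = g x"
    and \<eta>: "C1_grad \<eta> D\<eta>" "\<And>x. 0 \<le> \<eta> x" "\<And>x. \<eta> x \<le> 1" "\<And>x. x \<notin> cball x0 \<sigma> \<Longrightarrow> \<eta> x = 0" "\<And>x. norm (D\<eta> x) \<le> Lc"
    and r: "0 < \<sigma>" "\<sigma> < \<rho>" "\<rho> \<le> 1" "ball x0 \<rho> \<subseteq> \<Omega>"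
    and Cn: "(\<integral>\<^sup>+z. ennreal (norm z powr (p * (1 - s) - real DIM('a))) * indicator (ball (0::'a) 2 - {0}) z \<partial>lborel) = ennreal Cn" "Cn \<ge> 0"
    and w_def: "w = (\<lambda>x. max 0 (u x - k))"
  shows "Lpn p (\<lambda>x. (of_bool (u x > k) * \<eta> x) *\<^sub>R g x) \<le> ennreal (2 / C1 * (
       young_const p C1 C2 * Lc powr p * (\<integral>x. indicat_real (ball x0 \<rho>) x * w x powr p \<partial>lborel) +
       2 * (\<Lambda> * nonlocal_const p * Lc powr p * Cn * (\<integral>x. indicat_real (ball x0 \<rho>) x * w x powr p \<partial>lborel)
        + \<Lambda> * (1 - \<sigma> / \<rho>) powr (- (real DIM('a) + p * s)) * (\<integral>x. indicat_real (ball x0 \<rho>) x * w x \<partial>lborel)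
          * (\<integral>y. indicat_real (- ball x0 \<rho>) y * (w y powr (p - 1) * dist y x0 powr (- (real DIM('a) + p * s))) \<partial>lborel))))"
proof -
  \<comment> \<open>Nested radii \<sigma> < \<tau> < R < \<rho>: \<eta> lives in radius \<sigma>,
    the test domain has radius \<tau>, \<open>cball x0 R\<close> is a compact subset of \<Omega>,
    and \<rho> is the radius of the right side.\<close>
  define \<tau> where "\<tau> = (\<sigma> + \<rho>) / 2"
  define R where "R = (\<tau> + \<rho>) / 2"
  have tR: "\<sigma> < \<tau>" "\<tau> < R" "R < \<rho>" "0 < \<tau>" using r by (auto simp: \<tau>_def R_def)
  have RO: "cball x0 R \<subseteq> \<Omega>" using tR r(4) by (auto simp: subset_iff)
  define \<zeta> where "\<zeta> x = \<eta> x powr p" for x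
  define D\<zeta> where "D\<zeta> x = (p * \<eta> x powr (p - 1)) *\<^sub>R D\<eta> x" for x
  have zC: "C1_grad \<zeta> D\<zeta>" unfolding \<zeta>_def[abs_def] D\<zeta>_def[abs_def] by (rule C1_grad_powr[OF \<eta>(1,2) p])
  have zs: "\<zeta> x = 0" if "x \<notin> cball x0 \<sigma>" for x using \<eta>(4)[OF that] p by (simp add: \<zeta>_def)
  have D\<eta>s: "D\<eta> x = 0" if "x \<notin> cball x0 \<sigma>" for x using C1_grad_outside_support[OF \<eta>(1) \<eta>(4) that] .
  define \<phi> where "\<phi> x = w x * \<zeta> x" for x
  define G where "G x = (of_bool (u x > k) * \<zeta> x) *\<^sub>R g x + w x *\<^sub>R D\<zeta> x" for x
  note TW = truncation_in_W1p[OF W p u ae M g aeg]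
  have WA: "W1p_approx p x0 \<sigma> \<phi> G"
    unfolding \<phi>_def[abs_def] G_def[abs_def] w_def
    by (rule TW(1)[OF zC zs _ RO]) (use tR in auto)
  have out: "\<phi> x = 0" "G x = 0" if "x \<notin> cball x0 \<sigma>" for x
    using zs[OF that] D\<eta>s[OF that] by (auto simp: \<phi>_def G_def D\<zeta>_def)
  have W0: "W01p (ball x0 \<tau>) p \<phi> G" by (rule W1p_approx_W01p[OF WA p tR(1) out])
  have w0: "w x \<ge> 0" for x by (simp add: w_def)
  have \<phi>0: "\<phi> x \<ge> 0" for x using w0 by (simp add: \<phi>_def \<zeta>_def)
  have clo: "closure (ball x0 \<tau>) = cball x0 \<tau>" using tR by simp
  have clO: "cball x0 \<tau> \<subseteq> \<Omega>" using RO tR by (auto simp: subset_iff)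
  have S: "set_integrable lebesgue (ball x0 \<tau>) (\<lambda>x. B x (uo x) (Go x) \<bullet> G x)"
     "integrable lebesgue (\<lambda>(x,y). ppow p (uo x - uo y) * (\<phi> x - \<phi> y) * K x y)"
     "(LINT x:ball x0 \<tau>|lebesgue. B x (uo x) (Go x) \<bullet> G x)
            + (LINT z|lebesgue. (\<lambda>(x,y). ppow p (uo x - uo y) * (\<phi> x - \<phi> y) * K x y) z) \<le> 0"
    using sub[rule_format, of "ball x0 \<tau>" \<phi> G] W0 \<phi>0 clo clO by auto
  define IB where "IB = indicat_real (ball x0 \<rho>)"
  have [measurable]: "IB \<in> borel_measurable borel" unfolding IB_def by (intro borel_measurable_indicator) auto
  have [measurable]: "w \<in> borel_measurable borel" unfolding w_def by measurable
  have wM: "w x \<le> M + \<bar>k\<bar>" for x using M[of x] unfolding w_def by (auto simp: max_def)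
  define A where "A = (\<integral>x. IB x * w x powr p \<partial>lborel)"
  have Ai: "integrable lborel (\<lambda>x. IB x * w x powr p)"
    unfolding IB_def
  proof (rule ball_integrable)
    show "\<bar>w x powr p\<bar> \<le> (M + \<bar>k\<bar>) powr p" for x using w0 wM p by (auto intro!: powr_mono2)
  qed measurable
  define H where "H x = (of_bool (u x > k) * \<eta> x) *\<^sub>R g x" for x
  have [measurable]: "\<eta> \<in> borel_measurable borel" using C1_grad_measurable[OF \<eta>(1)] by simp
  have [measurable]: "(\<lambda>x. of_bool (u x > k) :: real) \<in> borel_measurable borel" by measurable
  have Hm[measurable]: "H \<in> borel_measurable borel" unfolding H_def[abs_def] by measurable
  \<comment> \<open>Local p-integrability of the gradient makes the energy finite, which has to be
    known before it is treated as a real number X and solved for.\<close>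
  have "Lpn p H \<le> Lpn p (\<lambda>x. indicat_real (cball x0 R) x *\<^sub>R g x)"
  proof (rule Lpn_mono)
    fix x
    show "norm (H x) \<le> norm (indicat_real (cball x0 R) x *\<^sub>R g x)"
      using \<eta>(2,3)[of x] \<eta>(4)[of x] tR by (cases "x \<in> cball x0 \<sigma>") (auto simp: H_def mult_left_le_one_le)
  qed (use p in auto)
  also have "\<dots> < \<infinity>" by (rule TW(2)[OF zC zs _ RO]) (use tR in auto)
  finally have Hf: "Lpn p H < \<infinity>" .
  have Hi: "integrable lborel (\<lambda>x. norm (H x) powr p)"
    using Hf by (intro integrableI_nonneg) (auto simp: Lpn_def)
  define X where "X = (\<integral>x. norm (H x) powr p \<partial>lborel)"
  have X: "Lpn p H = ennreal X" unfolding Lpn_def X_def by (rule nn_integral_eq_integral[OF Hi]) auto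
  define Yc where "Yc = young_const p C1 C2"
  have Yc0: "Yc \<ge> 0" using p C by (simp add: Yc_def young_const_def)
  have Lc0: "0 \<le> Lc" using \<eta>(5)[of x0] norm_ge_zero[of "D\<eta> x0"] by linarith
  have loc: "(LINT x:ball x0 \<tau>|lebesgue. B x (uo x) (Go x) \<bullet> G x) \<ge> C1 / 2 * X - Yc * Lc powr p * A"
  proof -
    let ?h = "\<lambda>x. C1 / 2 * norm (H x) powr p - Yc * Lc powr p * (IB x * w x powr p)"
    have hm: "?h \<in> borel_measurable lborel" by measurable
    have hi: "integrable lborel ?h" using Hi Ai by simp
    have "C1 / 2 * X - Yc * Lc powr p * A = (\<integral>x. ?h x \<partial>lborel)" using Hi Ai by (simp add: X_def A_def)
    also have "\<dots> = (\<integral>x. ?h x \<partial>lebesgue)" by (rule integral_completion[OF hm, symmetric])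
    also have "\<dots> \<le> (LINT x:ball x0 \<tau>|lebesgue. B x (uo x) (Go x) \<bullet> G x)"
      unfolding set_lebesgue_integral_def
    proof (rule integral_mono_AE)
      show "integrable lebesgue ?h" using hi integrable_completion[OF hm] by simp
      show "integrable lebesgue (\<lambda>x. indicat_real (ball x0 \<tau>) x *\<^sub>R (B x (uo x) (Go x) \<bullet> G x))"
        using S(1) unfolding set_integrable_def .
      show "AE x in lebesgue. ?h x \<le> indicat_real (ball x0 \<tau>) x *\<^sub>R (B x (uo x) (Go x) \<bullet> G x)"
        using H1 aeg
      proof eventually_elim
        fix x
        assume h1: "x \<in> \<Omega> \<longrightarrow> (\<forall>v \<zeta>. B x v \<zeta> \<bullet> \<zeta> \<ge> C1 * norm \<zeta> powr p \<and> norm (B x v \<zeta>) \<le> C2 * norm \<zeta> powr (p - 1))"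
          and gg: "x \<in> \<Omega> \<longrightarrow> Go x = g x"
        have Aterm: "0 \<le> Yc * Lc powr p * (IB x * w x powr p)" using Yc0 by (simp add: IB_def)
        show "?h x \<le> indicat_real (ball x0 \<tau>) x *\<^sub>R (B x (uo x) (Go x) \<bullet> G x)"
        proof (cases "x \<in> cball x0 \<sigma>")
          case False
          then have "G x = 0" "H x = 0" using out \<eta>(4)[OF False] by (auto simp: H_def)
          then show ?thesis using Aterm p by simp
        next
          case True
          then have xO: "x \<in> \<Omega>" and xt: "x \<in> ball x0 \<tau>" and xr: "IB x = 1" using clO tR r by (auto simp: subset_iff IB_def)
          show ?thesis
          proof (cases "u x > k")
            case False
            then have "w x = 0" "H x = 0" "G x = 0" by (auto simp: w_def H_def G_def)
            then show ?thesis using p by simp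
          next
            case uk: True
            let ?b = "B x (uo x) (g x)"
            have b: "?b \<bullet> g x \<ge> C1 * norm (g x) powr p" "norm ?b \<le> C2 * norm (g x) powr (p - 1)" using h1 xO by blast+
            have "C1 / 2 * (\<eta> x * norm (g x)) powr p - young_const p C1 C2 * (w x * norm (D\<eta> x)) powr p
               \<le> ?b \<bullet> (\<eta> x powr p *\<^sub>R g x + w x *\<^sub>R ((p * \<eta> x powr (p - 1)) *\<^sub>R D\<eta> x))"
              by (rule local_young[OF p C \<eta>(2) w0 b])
            also have "\<eta> x powr p *\<^sub>R g x + w x *\<^sub>R ((p * \<eta> x powr (p - 1)) *\<^sub>R D\<eta> x) = G x"
              using uk by (simp add: G_def \<zeta>_def D\<zeta>_def)
            finally have 1: "C1 / 2 * (\<eta> x * norm (g x)) powr p - Yc * (w x * norm (D\<eta> x)) powr p \<le> ?b \<bullet> G x"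
              by (simp add: Yc_def)
            have 2: "norm (H x) = \<eta> x * norm (g x)" using uk \<eta>(2)[of x] by (simp add: H_def)
            have "(w x * norm (D\<eta> x)) powr p \<le> (w x * Lc) powr p"
              using w0[of x] \<eta>(5)[of x] p by (intro powr_mono2 mult_left_mono) auto
            also have "\<dots> = Lc powr p * (IB x * w x powr p)" using xr w0[of x] Lc0 by (simp add: powr_mult mult.commute)
            finally have "Yc * (w x * norm (D\<eta> x)) powr p \<le> Yc * (Lc powr p * (IB x * w x powr p))"
              using Yc0 by (intro mult_left_mono)
            then have "?h x \<le> ?b \<bullet> G x" using 1 unfolding 2 by (simp add: mult.assoc)
            then show ?thesis using xt gg xO by simp
          qed
        qed
      qed
    qed
    finally show ?thesis .
  qed
  have int: "integrable lebesgue (\<lambda>(x, y). ppow p (uo x - uo y) * (w x * \<eta> x powr p - w y * \<eta> y powr p) * K x y)"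
    using S(2) by (simp add: \<phi>_def \<zeta>_def)

  let ?D = "\<Lambda> * nonlocal_const p * Lc powr p * Cn * (\<integral>x. indicat_real (ball x0 \<rho>) x * w x powr p \<partial>lborel)
        + \<Lambda> * (1 - \<sigma> / \<rho>) powr (- (real DIM('a) + p * s)) * (\<integral>x. indicat_real (ball x0 \<rho>) x * w x \<partial>lborel)
          * (\<integral>y. indicat_real (- ball x0 \<rho>) y * (w y powr (p - 1) * dist y x0 powr (- (real DIM('a) + p * s))) \<partial>lborel)"
  have nl: "(LINT z|lebesgue. (\<lambda>(x, y). ppow p (uo x - uo y) * (w x * \<eta> x powr p - w y * \<eta> y powr p) * K x y) z) \<ge> - (2 * ?D)"
    by (rule nonlocal_lower_bound[OF p s Lam Ks Kb u ae M \<eta> r(1,2,3) Cn w_def int])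
  have "C1 / 2 * X - Yc * Lc powr p * A - 2 * ?D \<le> 0"
    using loc nl S(3) unfolding \<phi>_def \<zeta>_def by linarith
  then have "X \<le> 2 / C1 * (Yc * Lc powr p * A + 2 * ?D)" using C by (simp add: field_simps)
  then have "Lpn p H \<le> ennreal (2 / C1 * (Yc * Lc powr p * A + 2 * ?D))" unfolding X by (rule ennreal_leI)
  then show ?thesis unfolding H_def[abs_def] Yc_def A_def IB_def .
qed

section \<open>One step of the iteration\<close>

text \<open>The cutoff falls from 1 to 0 between \<rho>1 and the midpoint \<sigma>, which gives the
  slope bound 8 / (\<rho> - \<rho>1) and leaves half of the gap for the tail. The function w \<eta>
  vanishes off the superlevel set, so Faber--Krahn applies at radius rr; 16 is its 8 times the 2
  from splitting the gradient into two terms.\<close>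

lemma De_Giorgi_step:
  fixes u uo :: "'a::euclidean_space \<Rightarrow> real" and K :: "'a \<Rightarrow> 'a \<Rightarrow> real" and B :: "'a \<Rightarrow> real \<Rightarrow> 'a \<Rightarrow> 'a"
  assumes p: "p > 1" and s: "0 < s" "s < 1" and Lam: "\<Lambda> \<ge> 1" and C: "C1 > 0" "C2 > 0"
    and H1: "AE x in lebesgue. x \<in> \<Omega> \<longrightarrow> (\<forall>v \<zeta>. B x v \<zeta> \<bullet> \<zeta> \<ge> C1 * norm \<zeta> powr p \<and> norm (B x v \<zeta>) \<le> C2 * norm \<zeta> powr (p - 1))"
    and Ks: "\<And>x y. K x y = K y x"
    and Kb: "\<And>x y. x \<noteq> y \<Longrightarrow> dist x y powr (- (real DIM('a) + p * s)) / \<Lambda> \<le> K x y \<and>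
                K x y \<le> \<Lambda> * dist x y powr (- (real DIM('a) + p * s))"
    and W: "W1p_loc \<Omega> p uo Go"
    and sub: "\<And>\<Omega>' \<phi> G\<phi>. open \<Omega>' \<and> compact (closure \<Omega>') \<and> closure \<Omega>' \<subseteq> \<Omega> \<and> W01p \<Omega>' p \<phi> G\<phi> \<and> (AE x in lebesgue. 0 \<le> \<phi> x) \<longrightarrow>
          set_integrable lebesgue \<Omega>' (\<lambda>x. B x (uo x) (Go x) \<bullet> G\<phi> x) \<and>
          integrable lebesgue (\<lambda>(x,y). ppow p (uo x - uo y) * (\<phi> x - \<phi> y) * K x y) \<and>
          (LINT x:\<Omega>'|lebesgue. B x (uo x) (Go x) \<bullet> G\<phi> x)
            + (LINT z|lebesgue. (\<lambda>(x,y). ppow p (uo x - uo y) * (\<phi> x - \<phi> y) * K x y) z) \<le> 0"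
    and u[measurable]: "u \<in> borel_measurable borel" and ae: "AE x in lebesgue. uo x = u x" and M: "\<And>x. \<bar>u x\<bar> \<le> M"
    and g[measurable]: "g \<in> borel_measurable borel" and aeg: "AE x in lebesgue. x \<in> \<Omega> \<longrightarrow> Go x = g x"
    and r: "0 < \<rho>1" "\<rho>1 < \<rho>" "\<rho> \<le> 1" "ball x0 \<rho> \<subseteq> \<Omega>"
    and Cn: "(\<integral>\<^sup>+z. ennreal (norm z powr (p * (1 - s) - real DIM('a))) * indicator (ball (0::'a) 2 - {0}) z \<partial>lborel) = ennreal Cn" "Cn \<ge> 0"
    and w_def: "w = (\<lambda>x. max 0 (u x - k))"
    and rr: "rr > 0" "2 * measure lborel {x \<in> ball x0 \<rho>. u x > k} \<le> measure lborel (ball (0::'a) rr)"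
  shows "(\<integral>x. indicat_real (ball x0 \<rho>1) x * w x powr p \<partial>lborel) \<le> 2 * (16 * rr) powr p * (
       (8 / (\<rho> - \<rho>1)) powr p * (1 + 2 / C1 * (young_const p C1 C2 + 2 * \<Lambda> * nonlocal_const p * Cn)) * (\<integral>x. indicat_real (ball x0 \<rho>) x * w x powr p \<partial>lborel)
       + 4 * \<Lambda> / C1 * ((\<rho> - \<rho>1) / (2 * \<rho>)) powr (- (real DIM('a) + p * s)) * (\<integral>x. indicat_real (ball x0 \<rho>) x * w x \<partial>lborel)
          * (\<integral>y. indicat_real (- ball x0 \<rho>) y * (w y powr (p - 1) * dist y x0 powr (- (real DIM('a) + p * s))) \<partial>lborel))"
proof -
  define \<sigma> where "\<sigma> = (\<rho>1 + \<rho>) / 2"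
  have sr: "\<rho>1 < \<sigma>" "\<sigma> < \<rho>" "0 < \<sigma>" using r by (auto simp: \<sigma>_def)
  define Lc where "Lc = 8 / (\<rho> - \<rho>1)"
  have Lc0: "Lc > 0" using r by (simp add: Lc_def)
  have Lc: "4 / (\<sigma> - \<rho>1) = Lc" using r by (simp add: \<sigma>_def Lc_def field_simps)
  have \<kappa>: "1 - \<sigma> / \<rho> = (\<rho> - \<rho>1) / (2 * \<rho>)" using r by (simp add: \<sigma>_def field_simps)
  obtain \<eta> D\<eta> where \<eta>: "C1_grad \<eta> D\<eta>" "\<And>x. 0 \<le> \<eta> x" "\<And>x. \<eta> x \<le> 1" "\<And>x. x \<in> ball x0 \<rho>1 \<Longrightarrow> \<eta> x = 1"
    "\<And>x. x \<notin> cball x0 \<sigma> \<Longrightarrow> \<eta> x = 0" "\<And>x. norm (D\<eta> x) \<le> Lc"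
    using cutoff_exists[OF r(1) sr(1), of x0] unfolding Lc by blast
  define IB where "IB = indicat_real (ball x0 \<rho>)"
  have [measurable]: "IB \<in> borel_measurable borel" unfolding IB_def by (intro borel_measurable_indicator) auto
  have [measurable]: "w \<in> borel_measurable borel" unfolding w_def by measurable
  have w0: "w x \<ge> 0" for x by (simp add: w_def)
  have wM: "w x \<le> M + \<bar>k\<bar>" for x using M[of x] unfolding w_def by (auto simp: max_def)
  define A where "A = (\<integral>x. IB x * w x powr p \<partial>lborel)"
  have Ai: "integrable lborel (\<lambda>x. indicat_real (ball x0 \<rho>') x * w x powr p)" for \<rho>'
  proof (rule ball_integrable)
    show "\<bar>w x powr p\<bar> \<le> (M + \<bar>k\<bar>) powr p" for x using w0 wM p by (auto intro!: powr_mono2)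
  qed measurable
  have A0: "A \<ge> 0" unfolding A_def by (intro integral_nonneg_AE AE_I2) (simp add: IB_def)
  define D where "D = 4 * \<Lambda> / C1 * (1 - \<sigma> / \<rho>) powr (- (real DIM('a) + p * s)) * (\<integral>x. indicat_real (ball x0 \<rho>) x * w x \<partial>lborel)
          * (\<integral>y. indicat_real (- ball x0 \<rho>) y * (w y powr (p - 1) * dist y x0 powr (- (real DIM('a) + p * s))) \<partial>lborel)"
  define cE where "cE = 2 / C1 * (young_const p C1 C2 + 2 * \<Lambda> * nonlocal_const p * Cn)"
  define H where "H x = (of_bool (u x > k) * \<eta> x) *\<^sub>R g x" for x
  have HE: "Lpn p H \<le> ennreal (Lc powr p * cE * A + D)"
  proof -
    note en = energy_estimate[OF p s Lam C H1 Ks Kb W sub u ae M g aeg \<eta>(1,2,3,5,6) sr(3,2) r(3,4) Cn w_def]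
    have "2 / C1 * (
       young_const p C1 C2 * Lc powr p * (\<integral>x. indicat_real (ball x0 \<rho>) x * w x powr p \<partial>lborel) +
       2 * (\<Lambda> * nonlocal_const p * Lc powr p * Cn * (\<integral>x. indicat_real (ball x0 \<rho>) x * w x powr p \<partial>lborel)
        + \<Lambda> * (1 - \<sigma> / \<rho>) powr (- (real DIM('a) + p * s)) * (\<integral>x. indicat_real (ball x0 \<rho>) x * w x \<partial>lborel)
          * (\<integral>y. indicat_real (- ball x0 \<rho>) y * (w y powr (p - 1) * dist y x0 powr (- (real DIM('a) + p * s))) \<partial>lborel)))
       = Lc powr p * cE * A + D"
      unfolding D_def cE_def A_def IB_def using C by (simp add: field_simps)
    then show ?thesis using en unfolding H_def[abs_def] by simp
  qed
  have D0: "D \<ge> 0" unfolding D_def using Lam C w0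
    by (intro mult_nonneg_nonneg integral_nonneg_AE AE_I2) auto
  have cE0: "cE \<ge> 0" unfolding cE_def young_const_def using C p Lam Cn(2) nonlocal_const_pos[OF p] by (intro mult_nonneg_nonneg add_nonneg_nonneg) auto
  define R where "R = (\<sigma> + \<rho>) / 2"
  have RO: "\<sigma> < R" "cball x0 R \<subseteq> \<Omega>" using sr r(4) by (auto simp: R_def subset_iff)
  define v where "v x = w x * \<eta> x" for x
  define G where "G x = (of_bool (u x > k) * \<eta> x) *\<^sub>R g x + w x *\<^sub>R D\<eta> x" for x
  have WA: "W1p_approx p x0 \<sigma> v G"
    unfolding v_def[abs_def] G_def[abs_def] w_def
    by (rule truncation_in_W1p(1)[OF W p u ae M g aeg \<eta>(1,5) RO])
  define E where "E = {x \<in> ball x0 \<rho>. u x > k}"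
  have Em: "E \<in> sets borel"
  proof -
    have "E = ball x0 \<rho> \<inter> {x \<in> space borel. u x > k}" by (auto simp: E_def)
    moreover have "{x \<in> space borel. u x > k} \<in> sets borel" by measurable
    ultimately show ?thesis by auto
  qed
  have Es: "v x = 0" if "x \<notin> E" for x
  proof (cases "x \<in> cball x0 \<sigma>")
    case True
    then have "x \<in> ball x0 \<rho>" using sr by auto
    then have "u x \<le> k" using that by (auto simp: E_def)
    then show ?thesis by (simp add: v_def w_def)
  qed (use \<eta>(5) in \<open>auto simp: v_def\<close>)
  have Ef: "emeasure lborel E = ennreal (measure lborel E)"
  proof (rule emeasure_eq_ennreal_measure)
    have "emeasure lborel E \<le> emeasure lborel (ball x0 \<rho>)" by (intro emeasure_mono) (auto simp: E_def)
    then show "emeasure lborel E \<noteq> top" using emeasure_lborel_ball_finite[of x0 \<rho>] by auto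
  qed
  have Bf: "emeasure lborel (ball (0::'a) rr) = ennreal (measure lborel (ball (0::'a) rr))"
    by (rule emeasure_eq_ennreal_measure) (use emeasure_lborel_ball_finite[of "0::'a" rr] in auto)
  have mE: "2 * emeasure lborel E \<le> emeasure lborel (ball (0::'a) rr)"
  proof -
    have "2 * emeasure lborel E = ennreal (2 * measure lborel E)" unfolding Ef by (simp add: ennreal_mult')
    also have "\<dots> \<le> ennreal (measure lborel (ball (0::'a) rr))" using rr(2) unfolding E_def by (rule ennreal_leI)
    finally show ?thesis unfolding Bf .
  qed
  have FK: "Lpn p v \<le> ennreal (2 * (8 * rr) powr p) * Lpn p G"
    by (rule Faber_Krahn[OF WA p Em Es rr(1) mE])
  have [measurable]: "\<eta> \<in> borel_measurable borel" "D\<eta> \<in> borel_measurable borel" using C1_grad_measurable[OF \<eta>(1)] by auto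
  have [measurable]: "(\<lambda>x. of_bool (u x > k) :: real) \<in> borel_measurable borel" by measurable
  have Hm[measurable]: "H \<in> borel_measurable borel" unfolding H_def[abs_def] by measurable
  have D\<eta>s: "D\<eta> x = 0" if "x \<notin> cball x0 \<sigma>" for x using C1_grad_outside_support[OF \<eta>(1) \<eta>(5) that] .
  have wD: "Lpn p (\<lambda>x. w x *\<^sub>R D\<eta> x) \<le> ennreal (Lc powr p * A)"
  proof -
    have "Lpn p (\<lambda>x. w x *\<^sub>R D\<eta> x) \<le> (\<integral>\<^sup>+x. ennreal (Lc powr p * (IB x * w x powr p)) \<partial>lborel)"
      unfolding Lpn_def
    proof (intro nn_integral_mono ennreal_leI)
      fix x
      show "norm (w x *\<^sub>R D\<eta> x) powr p \<le> Lc powr p * (IB x * w x powr p)"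
      proof (cases "x \<in> cball x0 \<sigma>")
        case True
        then have "IB x = 1" using sr by (auto simp: IB_def)
        moreover have "norm (w x *\<^sub>R D\<eta> x) powr p \<le> (w x * Lc) powr p"
          using w0[of x] \<eta>(6)[of x] p by (intro powr_mono2) (auto intro: mult_left_mono)
        ultimately show ?thesis using w0[of x] Lc0 by (simp add: powr_mult mult.commute)
      next
        case False
        then show ?thesis using D\<eta>s[OF False] p by (simp add: IB_def)
      qed
    qed
    also have "\<dots> = ennreal (\<integral>x. Lc powr p * (IB x * w x powr p) \<partial>lborel)"
      using Ai[of \<rho>] by (intro nn_integral_eq_integral AE_I2) (auto simp: IB_def)
    finally show ?thesis using Ai[of \<rho>] by (simp add: A_def IB_def)
  qed
  \<comment> \<open>The 1 added to cE is the contribution of the term in which the derivative falls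
    on \<eta>.\<close>
  have LG: "Lpn p G \<le> ennreal (2 powr p * (Lc powr p * (1 + cE) * A + D))"
  proof -
    have "Lpn p G = Lpn p (\<lambda>x. H x + w x *\<^sub>R D\<eta> x)" by (simp add: G_def[abs_def] H_def)
    also have "\<dots> \<le> ennreal (2 powr p) * (Lpn p H + Lpn p (\<lambda>x. w x *\<^sub>R D\<eta> x))" using p by (intro Lpn_add) auto
    also have "\<dots> \<le> ennreal (2 powr p) * (ennreal (Lc powr p * cE * A + D) + ennreal (Lc powr p * A))"
      using HE wD by (intro mult_left_mono add_mono) auto
    also have "\<dots> = ennreal (2 powr p * (Lc powr p * cE * A + D + Lc powr p * A))"
      using A0 D0 cE0 by (subst ennreal_plus[symmetric]) (auto simp: ennreal_mult')
    also have "2 powr p * (Lc powr p * cE * A + D + Lc powr p * A) = 2 powr p * (Lc powr p * (1 + cE) * A + D)"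
      by (simp add: algebra_simps)
    finally show ?thesis .
  qed
  have "ennreal (\<integral>x. indicat_real (ball x0 \<rho>1) x * w x powr p \<partial>lborel) = (\<integral>\<^sup>+x. ennreal (indicat_real (ball x0 \<rho>1) x * w x powr p) \<partial>lborel)"
    using Ai[of \<rho>1] by (intro nn_integral_eq_integral[symmetric] AE_I2) auto
  also have "\<dots> \<le> Lpn p v"
    unfolding Lpn_def
  proof (intro nn_integral_mono ennreal_leI)
    fix x show "indicat_real (ball x0 \<rho>1) x * w x powr p \<le> norm (v x) powr p"
      using \<eta>(4)[of x] w0[of x] by (cases "x \<in> ball x0 \<rho>1") (auto simp: v_def)
  qed
  also have "\<dots> \<le> ennreal (2 * (8 * rr) powr p) * ennreal (2 powr p * (Lc powr p * (1 + cE) * A + D))"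
    using FK mult_left_mono[OF LG, of "ennreal (2 * (8 * rr) powr p)"] by (meson order_trans zero_le)
  also have "\<dots> = ennreal (2 * (8 * rr) powr p * (2 powr p * (Lc powr p * (1 + cE) * A + D)))"
    by (rule ennreal_mult[symmetric]) (use A0 D0 cE0 in auto)
  also have "2 * (8 * rr) powr p * (2 powr p * (Lc powr p * (1 + cE) * A + D)) = 2 * (16 * rr) powr p * (Lc powr p * (1 + cE) * A + D)"
    using powr_mult[of 2 "8 * rr" p] rr(1) by (simp add: mult_ac)
  finally have "ennreal (\<integral>x. indicat_real (ball x0 \<rho>1) x * w x powr p \<partial>lborel) \<le> ennreal (2 * (16 * rr) powr p * (Lc powr p * (1 + cE) * A + D))" .
  then have "(\<integral>x. indicat_real (ball x0 \<rho>1) x * w x powr p \<partial>lborel) \<le> 2 * (16 * rr) powr p * (Lc powr p * (1 + cE) * A + D)"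
    by (subst (asm) ennreal_le_iff) (use A0 D0 cE0 in auto)
  then show ?thesis unfolding D_def \<kappa> Lc_def cE_def A_def IB_def .
qed


section \<open>De Giorgi iteration\<close>

text \<open>\<theta> = b^(-1/\<beta>) solves b \<theta>^\<beta> = 1, so the ansatz y_j \<le> y_0
  \<theta>^j cancels the growth b^j exactly, and the starting threshold is what makes D y_0^\<beta>
  \<le> \<theta>. It also gives y_0 \<le> 1, so the step, assumed only for values up to 1, is
  available throughout.\<close>

lemma fast_geometric_convergence:
  fixes y :: "nat \<Rightarrow> real"
  assumes nn: "\<And>j. 0 \<le> y j" and step: "\<And>j. y j \<le> 1 \<Longrightarrow> y (Suc j) \<le> D * b ^ j * (y j * y j powr \<beta>)"
    and b: "b > 1" and D: "D \<ge> 1" and \<beta>: "\<beta> > 0" and start: "y 0 \<le> D powr (- 1 / \<beta>) * b powr (- 1 / \<beta>\<^sup>2)"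
  shows "y \<longlonglongrightarrow> 0"
proof -
  define \<theta> where "\<theta> = b powr (- 1 / \<beta>)"
  have \<theta>: "0 < \<theta>" "\<theta> < 1"
  proof -
    have "b powr (- 1 / \<beta>) < b powr 0" using b \<beta> by (intro powr_less_mono) (auto simp: divide_neg_pos)
    then show "\<theta> < 1" using b by (simp add: \<theta>_def)
    show "0 < \<theta>" using b by (simp add: \<theta>_def)
  qed
  have "\<theta> powr \<beta> = b powr (- 1)" unfolding \<theta>_def powr_powr using \<beta> by simp
  then have \<theta>\<beta>: "\<theta> powr \<beta> = 1 / b" using b by (simp add: powr_minus_divide)
  have y01: "y 0 \<le> 1"
  proof -
    have 1: "D powr (- 1 / \<beta>) \<le> D powr 0" using D \<beta> by (intro powr_mono) (auto simp: divide_nonpos_pos)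
    have 2: "b powr (- 1 / \<beta>\<^sup>2) \<le> b powr 0" using b \<beta> by (intro powr_mono) (auto simp: divide_nonpos_pos)
    have "D powr (- 1 / \<beta>) * b powr (- 1 / \<beta>\<^sup>2) \<le> 1 * 1" using 1 2 b D by (intro mult_mono) auto
    then show ?thesis using start by linarith
  qed
  have Dy: "D * y 0 powr \<beta> \<le> \<theta>"
  proof -
    have "y 0 powr \<beta> \<le> (D powr (- 1 / \<beta>) * b powr (- 1 / \<beta>\<^sup>2)) powr \<beta>" using start nn \<beta> by (intro powr_mono2) auto
    also have "\<dots> = D powr (- 1) * \<theta>" using \<beta> by (simp add: powr_mult powr_powr \<theta>_def power2_eq_square)
    finally have "D * y 0 powr \<beta> \<le> D * (D powr (- 1) * \<theta>)" using D by (intro mult_left_mono) auto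
    then show ?thesis using D by (simp add: powr_minus_divide)
  qed
  have main: "y j \<le> y 0 * \<theta> ^ j" for j
  proof (induction j)
    case (Suc j)
    have tj: "\<theta> ^ j \<le> 1" "0 \<le> \<theta> ^ j" using \<theta> by (auto intro: power_le_one)
    have "y 0 * \<theta> ^ j \<le> 1 * 1" using y01 tj nn by (intro mult_mono) auto
    then have "y (Suc j) \<le> D * b ^ j * (y j * y j powr \<beta>)" using step Suc.IH by simp
    also have "\<dots> \<le> D * b ^ j * ((y 0 * \<theta> ^ j) * (y 0 * \<theta> ^ j) powr \<beta>)"
      using Suc.IH nn[of j] nn[of 0] D b \<beta> tj by (intro mult_left_mono mult_mono powr_mono2) auto
    also have "(y 0 * \<theta> ^ j) powr \<beta> = y 0 powr \<beta> * (1 / b) ^ j"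
    proof -
      have "(\<theta> ^ j) powr \<beta> = (\<theta> powr \<beta>) ^ j" using \<theta> by (simp add: powr_realpow[symmetric] powr_powr mult.commute)
      then show ?thesis using nn[of 0] tj by (simp add: powr_mult \<theta>\<beta>)
    qed
    also have "D * b ^ j * ((y 0 * \<theta> ^ j) * (y 0 powr \<beta> * (1 / b) ^ j)) = (D * y 0 powr \<beta>) * (y 0 * \<theta> ^ j)"
      using b by (simp add: power_one_over)
    also have "\<dots> \<le> \<theta> * (y 0 * \<theta> ^ j)" using Dy nn[of 0] tj by (intro mult_right_mono) auto
    finally show ?case by (simp add: mult_ac)
  qed simp
  have "(\<lambda>j. y 0 * \<theta> ^ j) \<longlonglongrightarrow> y 0 * 0" using \<theta> by (intro tendsto_mult tendsto_const LIMSEQ_realpow_zero) auto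
  then have lim: "(\<lambda>j. y 0 * \<theta> ^ j) \<longlonglongrightarrow> 0" by simp
  show ?thesis
    by (rule tendsto_sandwich[OF _ _ tendsto_const lim]) (use nn main in \<open>auto intro!: always_eventually\<close>)
qed

text \<open>Collected constants of one step: 2 and 16^p from \<open>De_Giorgi_step\<close>; 2^(p/N)
  and 2^(p p/N) from the p-th power of the Faber--Krahn radius; 2^(5p) from (32 t / r)^p; 2^(3q)
  from (8 t)^q; 2^(2p) from the Chebyshev and tail factors.\<close>

definition step_const :: "real \<Rightarrow> real \<Rightarrow> real \<Rightarrow> real \<Rightarrow> real \<Rightarrow> real" where
  "step_const p N q ca cb = 2 * 16 powr p * (2 powr (p / N) * 2 powr (p * p / N)) * (2 powr (5 * p) * ca + cb * 2 powr (3 * q + 2 * p))"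

text \<open>Here t stands for 2^j. The factor r^p of the Faber--Krahn radius cancels each r^(-p),
  and y \<le> 1 allows y^(p/N) to be weakened to y^\<beta>.\<close>

lemma step_algebra:
  fixes p N q t r k y Y \<delta> :: real
  assumes p: "p > 1" and N: "N > 0" and q: "q \<ge> 0" and t: "t \<ge> 1" and r: "r > 0" and k: "k > 0" and y: "0 < y" "y \<le> 1"
    and Y: "Y \<ge> 0" and \<delta>: "0 < \<delta>" "\<delta> \<le> 1" and c: "ca \<ge> 0" "cb \<ge> 0" and \<beta>: "\<beta> \<le> p / N"
    and \<theta>: "\<theta> \<ge> 0" "\<delta> * \<theta> \<le> k"
    and A: "A \<le> Y" and A1: "0 \<le> A1" "A1 \<le> (2 * t / k) powr (p - 1) * Y" and X: "0 \<le> X" "X \<le> (8 * t) powr q"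
    and T: "0 \<le> T" "T \<le> (2 / r) powr p * \<theta> powr (p - 1)"
    and est: "Y' \<le> 2 * (16 * (r * (2 * (2 * t) powr p * y) powr (1 / N))) powr p * ((8 / (r / (4 * t))) powr p * ca * A + cb * X * A1 * T)"
  shows "Y' \<le> step_const p N q ca cb * \<delta> powr (1 - p) * t powr (p * p / N + 2 * p + q) * (y powr \<beta> * Y)"
proof -
  have rp: "r powr p > 0" using r by simp
  have d1: "1 \<le> \<delta> powr (1 - p)"
  proof -
    have "\<delta> powr 0 \<le> \<delta> powr (1 - p)" using \<delta> p by (intro powr_mono') auto
    then show ?thesis using \<delta> by simp
  qed
  \<comment> \<open>A1 carries k^(1-p) and T carries \<theta>^(p-1); \<theta> / k \<le> 1 / \<delta>
    is the place where \<delta> enters. Since 2 t \<ge> 1, the exponent p - 1 of 2 t may be raised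
    to p.\<close>
  have tk: "A1 * T \<le> Y * (2 powr p * t powr p) * (2 powr p / r powr p) * \<delta> powr (1 - p)"
  proof -
    have "A1 * T \<le> ((2 * t / k) powr (p - 1) * Y) * ((2 / r) powr p * \<theta> powr (p - 1))"
      using A1 T Y by (intro mult_mono) auto
    also have "\<dots> = Y * (2 * t) powr (p - 1) * (2 / r) powr p * (\<theta> / k) powr (p - 1)"
      using t k \<theta> by (simp add: powr_divide powr_mult mult_ac)
    also have "\<dots> \<le> Y * (2 powr p * t powr p) * (2 powr p / r powr p) * \<delta> powr (1 - p)"
    proof (intro mult_mono)
      have "(2 * t) powr (p - 1) \<le> (2 * t) powr p" using t by (intro powr_mono) auto
      then show "(2 * t) powr (p - 1) \<le> 2 powr p * t powr p" using t by (simp add: powr_mult)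
      show "(2 / r) powr p \<le> 2 powr p / r powr p" using r by (simp add: powr_divide)
      have "(\<theta> / k) powr (p - 1) \<le> (1 / \<delta>) powr (p - 1)"
        using \<theta> k \<delta> p by (intro powr_mono2) (auto simp: field_simps)
      also have "\<dots> = \<delta> powr (1 - p)" using \<delta> by (simp add: powr_divide powr_diff)
      finally show "(\<theta> / k) powr (p - 1) \<le> \<delta> powr (1 - p)" .
    qed (use Y in auto)
    finally show ?thesis .
  qed
  \<comment> \<open>Both t^p and t^(p+q) are raised to t^(2p+q), so that one power of t covers the
    two terms.\<close>
  have t1: "t powr p \<le> t powr (2 * p + q)" using t p q by (intro powr_mono) auto
  have t2: "t powr q * t powr p \<le> t powr (2 * p + q)"
    using t p q unfolding powr_add[symmetric] by (intro powr_mono) auto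
  define Z where "Z = Y / r powr p * \<delta> powr (1 - p) * t powr (2 * p + q)"
  have Z0: "Z \<ge> 0" using Y by (simp add: Z_def)
  have B1: "(8 / (r / (4 * t))) powr p * ca * A \<le> 2 powr (5 * p) * ca * Z"
  proof -
    have "(8 / (r / (4 * t))) powr p = 32 powr p * t powr p / r powr p"
      using r t powr_mult[of 32 t p] powr_divide[of "32 * t" r p] by (simp add: field_simps)
    also have "(32::real) powr p = 2 powr (5 * p)" using powr_powr[of 2 5 p] by simp
    finally have eq: "(8 / (r / (4 * t))) powr p = 2 powr (5 * p) * t powr p / r powr p" .
    have "(8 / (r / (4 * t))) powr p * ca * A \<le> (8 / (r / (4 * t))) powr p * ca * Y" using A c by (intro mult_left_mono) auto
    also have "\<dots> = 2 powr (5 * p) * ca * (Y / r powr p * 1 * t powr p)" unfolding eq by simp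
    also have "\<dots> \<le> 2 powr (5 * p) * ca * Z"
      unfolding Z_def using d1 t1 Y c by (intro mult_left_mono mult_mono) auto
    finally show ?thesis .
  qed
  have B2: "cb * X * A1 * T \<le> cb * 2 powr (3 * q + 2 * p) * Z"
  proof -
    have "(8 * t) powr q = 2 powr (3 * q) * t powr q"
      using t powr_mult[of 8 t q] powr_powr[of 2 3 q] by simp
    then have X2: "X \<le> 2 powr (3 * q) * t powr q" using X by simp
    have e: "(2::real) powr (3 * q + 2 * p) = 2 powr (3 * q) * (2 powr p * 2 powr p)"
      by (simp flip: powr_add)
    have "cb * X * A1 * T = cb * (X * (A1 * T))" by simp
    also have "\<dots> \<le> cb * ((2 powr (3 * q) * t powr q) * (Y * (2 powr p * t powr p) * (2 powr p / r powr p) * \<delta> powr (1 - p)))"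
      using c X A1 T by (intro mult_left_mono mult_mono[OF X2 tk]) auto
    also have "\<dots> = cb * 2 powr (3 * q + 2 * p) * (Y / r powr p * \<delta> powr (1 - p) * (t powr q * t powr p))"
      unfolding e by (simp add: field_simps)
    also have "\<dots> \<le> cb * 2 powr (3 * q + 2 * p) * Z"
      unfolding Z_def using t2 Y c by (intro mult_left_mono) auto
    finally show ?thesis .
  qed
  have pre: "(16 * (r * (2 * (2 * t) powr p * y) powr (1 / N))) powr p
      = 16 powr p * r powr p * (2 powr (p / N) * 2 powr (p * p / N)) * t powr (p * p / N) * y powr (p / N)"
    using r t y p N by (simp add: powr_mult powr_powr)
  have yb: "y powr (p / N) \<le> y powr \<beta>" using y \<beta> by (intro powr_mono') auto
  have "Y' \<le> 2 * (16 * (r * (2 * (2 * t) powr p * y) powr (1 / N))) powr p * (2 powr (5 * p) * ca * Z + cb * 2 powr (3 * q + 2 * p) * Z)"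
    using B1 B2 by (intro order_trans[OF est] mult_left_mono add_mono) auto
  also have "\<dots> = 2 * 16 powr p * (2 powr (p / N) * 2 powr (p * p / N)) * (2 powr (5 * p) * ca + cb * 2 powr (3 * q + 2 * p))
      * (\<delta> powr (1 - p) * (t powr (p * p / N) * t powr (2 * p + q)) * Y) * y powr (p / N)"
    unfolding pre Z_def using rp by (simp add: field_simps)
  also have "\<dots> \<le> 2 * 16 powr p * (2 powr (p / N) * 2 powr (p * p / N)) * (2 powr (5 * p) * ca + cb * 2 powr (3 * q + 2 * p))
      * (\<delta> powr (1 - p) * (t powr (p * p / N) * t powr (2 * p + q)) * Y) * y powr \<beta>"
    using yb Y c by (intro mult_left_mono) auto
  also have "t powr (p * p / N) * t powr (2 * p + q) = t powr (p * p / N + 2 * p + q)"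
    by (simp add: powr_add[symmetric] add.assoc)
  finally show ?thesis by (simp add: step_const_def mult_ac)
qed

text \<open>Serves the requirement D \<ge> 1 of the convergence lemma; every factor is at least
  1.\<close>

lemma step_const_ge_1:
  assumes "p > 1" "N > 0" "ca \<ge> 1" "cb \<ge> 0"
  shows "step_const p N q ca cb \<ge> 1"
proof -
  have 1: "1 \<le> (16::real) powr p" "1 \<le> (2::real) powr (p / N)" "1 \<le> (2::real) powr (p * p / N)" "1 \<le> (2::real) powr (5 * p)"
    using assms by (auto intro!: ge_one_powr_ge_zero)
  have 2: "1 \<le> 2 powr (5 * p) * ca + cb * 2 powr (3 * q + 2 * p)"
  proof -
    have "1 * 1 \<le> 2 powr (5 * p) * ca" using 1 assms by (intro mult_mono) auto
    moreover have "0 \<le> cb * 2 powr (3 * q + 2 * p)" using assms by simp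
    ultimately show ?thesis by linarith
  qed
  have "1 * 1 * (1 * 1) * 1 \<le> 2 * 16 powr p * (2 powr (p / N) * 2 powr (p * p / N)) * (2 powr (5 * p) * ca + cb * 2 powr (3 * q + 2 * p))"
    using 1 2 by (intro mult_mono) auto
  then show ?thesis by (simp add: step_const_def)
qed

text \<open>The level k is fixed and the iteration moves from level 0 on radius r to level k on
  radius r / 2. Dividing by k^p |B_r| makes the recursion scale-free, and the assumption on the
  initial mean is the threshold of \<open>fast_geometric_convergence\<close>.\<close>

lemma level_bound:
  fixes u uo :: "'a::euclidean_space \<Rightarrow> real" and K :: "'a \<Rightarrow> 'a \<Rightarrow> real" and B :: "'a \<Rightarrow> real \<Rightarrow> 'a \<Rightarrow> 'a"
  assumes p: "p > 1" and s: "0 < s" "s < 1" and Lam: "\<Lambda> \<ge> 1" and C: "C1 > 0" "C2 > 0"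
    and H1: "AE x in lebesgue. x \<in> \<Omega> \<longrightarrow> (\<forall>v \<zeta>. B x v \<zeta> \<bullet> \<zeta> \<ge> C1 * norm \<zeta> powr p \<and> norm (B x v \<zeta>) \<le> C2 * norm \<zeta> powr (p - 1))"
    and Ks: "\<And>x y. K x y = K y x"
    and Kb: "\<And>x y. x \<noteq> y \<Longrightarrow> dist x y powr (- (real DIM('a) + p * s)) / \<Lambda> \<le> K x y \<and>
                K x y \<le> \<Lambda> * dist x y powr (- (real DIM('a) + p * s))"
    and W: "W1p_loc \<Omega> p uo Go"
    and sub: "\<And>\<Omega>' \<phi> G\<phi>. open \<Omega>' \<and> compact (closure \<Omega>') \<and> closure \<Omega>' \<subseteq> \<Omega> \<and> W01p \<Omega>' p \<phi> G\<phi> \<and> (AE x in lebesgue. 0 \<le> \<phi> x) \<longrightarrow>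
          set_integrable lebesgue \<Omega>' (\<lambda>x. B x (uo x) (Go x) \<bullet> G\<phi> x) \<and>
          integrable lebesgue (\<lambda>(x,y). ppow p (uo x - uo y) * (\<phi> x - \<phi> y) * K x y) \<and>
          (LINT x:\<Omega>'|lebesgue. B x (uo x) (Go x) \<bullet> G\<phi> x)
            + (LINT z|lebesgue. (\<lambda>(x,y). ppow p (uo x - uo y) * (\<phi> x - \<phi> y) * K x y) z) \<le> 0"
    and u[measurable]: "u \<in> borel_measurable borel" and ae: "AE x in lebesgue. uo x = u x" and M: "\<And>x. \<bar>u x\<bar> \<le> M"
    and g[measurable]: "g \<in> borel_measurable borel" and aeg: "AE x in lebesgue. x \<in> \<Omega> \<longrightarrow> Go x = g x"
    and Cn: "(\<integral>\<^sup>+z. ennreal (norm z powr (p * (1 - s) - real DIM('a))) * indicator (ball (0::'a) 2 - {0}) z \<partial>lborel) = ennreal Cn" "Cn \<ge> 0"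
    and r: "0 < r" "r \<le> 1" "ball x0 r \<subseteq> \<Omega>" and k: "k > 0" and \<delta>: "0 < \<delta>" "\<delta> \<le> 1"
    and \<theta>: "\<theta> \<ge> 0" "\<delta> * \<theta> \<le> k"
      "(\<integral>y. indicat_real (- ball x0 (r / 2)) y * (max 0 (u y) powr (p - 1) * dist y x0 powr (- (real DIM('a) + p * s))) \<partial>lborel)
        \<le> (2 / r) powr p * \<theta> powr (p - 1)"
    and \<beta>: "0 < \<beta>" "\<beta> \<le> p / real DIM('a)"
    and ca: "ca = 1 + 2 / C1 * (young_const p C1 C2 + 2 * \<Lambda> * nonlocal_const p * Cn)" and cb: "cb = 4 * \<Lambda> / C1"
    and start: "(\<integral>x. indicat_real (ball x0 r) x * max 0 (u x) powr p \<partial>lborel) / (k powr p * measure lborel (ball x0 r))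
       \<le> (step_const p (real DIM('a)) (real DIM('a) + p * s) ca cb * \<delta> powr (1 - p)) powr (- 1 / \<beta>)
          * (2 powr (p * p / real DIM('a) + 2 * p + (real DIM('a) + p * s))) powr (- 1 / \<beta>\<^sup>2)"
  shows "AE x in lborel. x \<in> ball x0 (r / 2) \<longrightarrow> u x \<le> k"
proof -
  define N where "N = real DIM('a)"
  have N: "N > 0" by (simp add: N_def)
  define q where "q = N + p * s"
  have q0: "q > 0" using N p s by (simp add: q_def add_pos_pos)
  define V where "V = measure lborel (ball x0 r)"
  have V: "V > 0" unfolding V_def using r by (simp add: content_ball_pos)
  \<comment> \<open>The increments k / (2 t) of the level and r / (4 t) of the radius, with t = 2^j,
    produce all powers of t in the recursion.\<close>
  define kk where "kk j = k * (1 - 1 / 2 ^ j)" for j :: nat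
  define rh where "rh j = r / 2 * (1 + 1 / 2 ^ j)" for j :: nat
  define w where "w j x = max 0 (u x - kk j)" for j x
  define Y where "Y j = (\<integral>x. indicat_real (ball x0 (rh j)) x * w j x powr p \<partial>lborel)" for j
  define y where "y j = Y j / (k powr p * V)" for j
  have kp: "k powr p > 0" using k by simp
  have wm[measurable]: "w j \<in> borel_measurable borel" for j unfolding w_def[abs_def] by measurable
  have w0: "0 \<le> w j x" for j x by (simp add: w_def)
  have kk0: "0 \<le> kk j" "kk j \<le> k" for j using k by (auto simp: kk_def)
  have wM: "w j x \<le> M" for j x using M[of x] kk0[of j] by (auto simp: w_def)
  have wp: "integrable lborel (\<lambda>x. indicat_real (ball x0 \<rho>) x * w j x powr p)" for \<rho> j
  proof (rule ball_integrable)
    show "\<bar>w j x powr p\<bar> \<le> M powr p" for x using w0 wM p by (auto intro!: powr_mono2)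
  qed measurable
  have w1: "integrable lborel (\<lambda>x. indicat_real (ball x0 \<rho>) x * w j x)" for \<rho> j
    by (rule ball_integrable[where M=M]) (use w0 wM in auto)
  have Y0: "0 \<le> Y j" for j unfolding Y_def by (intro integral_nonneg_AE AE_I2) auto
  have ynn: "0 \<le> y j" for j using Y0 kp V by (simp add: y_def)
  define bb where "bb = 2 powr (p * p / N + 2 * p + q)"
  define D where "D = step_const p N q ca cb * \<delta> powr (1 - p)"
  have ca1: "ca \<ge> 1" unfolding ca young_const_def using C p Lam Cn(2) nonlocal_const_pos[OF p] by simp
  have cb0: "cb \<ge> 0" unfolding cb using C Lam by simp
  have d1: "1 \<le> \<delta> powr (1 - p)"
  proof -
    have "\<delta> powr 0 \<le> \<delta> powr (1 - p)" using \<delta> p by (intro powr_mono') auto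
    then show ?thesis using \<delta> by simp
  qed
  have D1: "D \<ge> 1" unfolding D_def using step_const_ge_1[OF p N ca1 cb0, of q] d1 mult_mono[of 1 "step_const p N q ca cb" 1 "\<delta> powr (1 - p)"] by simp
  have bb1: "bb > 1" unfolding bb_def using p N q0 by (intro gr_one_powr) (auto intro!: add_pos_pos)
  have step: "y (Suc j) \<le> D * bb ^ j * (y j * y j powr \<beta>)" if yj: "y j \<le> 1" for j
  proof -
    define t :: real where "t = 2 ^ j"
    have t: "t \<ge> 1" by (simp add: t_def)
    have rhj: "rh j = r / 2 * (1 + 1 / t)" "rh (Suc j) = r / 2 * (1 + 1 / (2 * t))" by (auto simp: rh_def t_def)
    have kkj: "kk j = k * (1 - 1 / t)" "kk (Suc j) = k * (1 - 1 / (2 * t))" by (auto simp: kk_def t_def)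
    have rdiff: "rh j - rh (Suc j) = r / (4 * t)" using t unfolding rhj by (simp add: field_simps)
    have kdiff: "kk (Suc j) - kk j = k / (2 * t)" using t unfolding kkj by (simp add: field_simps)
    have rpos: "0 < rh (Suc j)" "rh (Suc j) < rh j" "rh j \<le> r" "r / 2 \<le> rh j"
    proof -
      show "0 < rh (Suc j)" using r t unfolding rhj by (simp add: add_pos_pos)
      have "rh j - rh (Suc j) > 0" unfolding rdiff using r t by simp
      then show "rh (Suc j) < rh j" by simp
      have "1 / t \<le> 1" using t by simp
      then have "r / 2 * (1 + 1 / t) \<le> r / 2 * 2" using r by (intro mult_left_mono) auto
      then show "rh j \<le> r" unfolding rhj by simp
      have "r / 2 * 1 \<le> r / 2 * (1 + 1 / t)" using r t by (intro mult_left_mono) auto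
      then show "r / 2 \<le> rh j" unfolding rhj by simp
    qed
    define IB where "IB = indicat_real (ball x0 (rh j))"
    have IB0: "0 \<le> IB x" "IB x \<le> 1" for x by (auto simp: IB_def)
    have wle: "w (Suc j) x \<le> w j x" for x
    proof -
      have "kk j \<le> kk (Suc j)" using kdiff k t by (smt (verit) divide_pos_pos)
      then show ?thesis by (auto simp: w_def)
    qed
    \<comment> \<open>Where u exceeds the next level, w_j is at least the level gap k / (2 t). This
      Chebyshev bound gives both the measure of E and the passage from w to w^p.\<close>
    have wbig: "1 \<le> (2 * t / k) * w j x" if "u x > kk (Suc j)" for x
    proof -
      have "w j x \<ge> k / (2 * t)" using that kdiff by (auto simp: w_def)
      then have "(2 * t / k) * (k / (2 * t)) \<le> (2 * t / k) * w j x" using k t by (intro mult_left_mono) auto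
      then show ?thesis using k t by simp
    qed
    define A where "A = (\<integral>x. IB x * w (Suc j) x powr p \<partial>lborel)"
    define A1 where "A1 = (\<integral>x. IB x * w (Suc j) x \<partial>lborel)"
    define T where "T = (\<integral>z. indicat_real (- ball x0 (rh j)) z * (w (Suc j) z powr (p - 1) * dist z x0 powr (- q)) \<partial>lborel)"
    define E where "E = {x \<in> ball x0 (rh j). u x > kk (Suc j)}"
    have YI: "Y j = (\<integral>x. IB x * w j x powr p \<partial>lborel)" by (simp add: Y_def IB_def)
    have IBi: "integrable lborel (\<lambda>x. IB x * w i x powr p)" "integrable lborel (\<lambda>x. IB x * w i x)" for i
      using wp w1 by (auto simp: IB_def)
    have AY: "A \<le> Y j" unfolding A_def YI
    proof (rule integral_mono[OF IBi(1) IBi(1)])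
      fix x show "IB x * w (Suc j) x powr p \<le> IB x * w j x powr p"
        using IB0 w0 wle p by (intro mult_left_mono powr_mono2) auto
    qed
    \<comment> \<open>Where w_(j+1) > 0, the factor ((2 t / k) w_j)^(p-1) is at least 1, so w_(j+1)
      \<le> w_j may be multiplied by it.\<close>
    have A1Y: "A1 \<le> (2 * t / k) powr (p - 1) * Y j"
    proof -
      have "A1 \<le> (\<integral>x. (2 * t / k) powr (p - 1) * (IB x * w j x powr p) \<partial>lborel)"
        unfolding A1_def
      proof (rule integral_mono)
        fix x
        have "w (Suc j) x \<le> (2 * t / k) powr (p - 1) * w j x powr p"
        proof (cases "u x > kk (Suc j)")
          case True
          have b1: "1 \<le> (2 * t / k) * w j x" by (rule wbig[OF True])
          have wp0: "w j x > 0" using b1 w0[of j x] by (cases "w j x = 0") auto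
          have "1 \<le> ((2 * t / k) * w j x) powr (p - 1)" using b1 p by (intro ge_one_powr_ge_zero) auto
          also have "\<dots> = (2 * t / k) powr (p - 1) * w j x powr (p - 1)" using t k w0 by (subst powr_mult) auto
          finally have "w j x * 1 \<le> w j x * ((2 * t / k) powr (p - 1) * w j x powr (p - 1))"
            using w0 by (intro mult_left_mono) auto
          also have "\<dots> = (2 * t / k) powr (p - 1) * w j x powr p" using wp0 by (simp add: powr_diff)
          finally show ?thesis using wle[of x] by simp
        next
          case False
          then have "w (Suc j) x = 0" by (simp add: w_def)
          then show ?thesis by simp
        qed
        then have "IB x * w (Suc j) x \<le> IB x * ((2 * t / k) powr (p - 1) * w j x powr p)"
          using IB0 by (intro mult_left_mono)
        then show "IB x * w (Suc j) x \<le> (2 * t / k) powr (p - 1) * (IB x * w j x powr p)" by (simp add: mult_ac)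
      qed (use IBi in auto)
      then show ?thesis using IBi by (simp add: YI)
    qed
    have A10: "0 \<le> A1" unfolding A1_def using IB0 w0 by (intro integral_nonneg_AE AE_I2) auto
    have Em: "E \<in> sets borel"
    proof -
      have "E = ball x0 (rh j) \<inter> {x \<in> space borel. u x > kk (Suc j)}" by (auto simp: E_def)
      moreover have "{x \<in> space borel. u x > kk (Suc j)} \<in> sets borel" by measurable
      ultimately show ?thesis by auto
    qed
    have Efin: "emeasure lborel E < \<infinity>"
    proof -
      have "emeasure lborel E \<le> emeasure lborel (ball x0 (rh j))" by (intro emeasure_mono) (auto simp: E_def)
      then show ?thesis using emeasure_lborel_ball_finite[of x0 "rh j"] by (rule le_less_trans)
    qed
    have EY: "measure lborel E \<le> (2 * t / k) powr p * Y j"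
    proof -
      have Ei: "integrable lborel (indicat_real E)" using Em Efin by (intro integrable_real_indicator) auto
      have "measure lborel E = (\<integral>x. indicat_real E x \<partial>lborel)" using Em by simp
      also have "\<dots> \<le> (\<integral>x. (2 * t / k) powr p * (IB x * w j x powr p) \<partial>lborel)"
      proof (rule integral_mono[OF Ei])
        fix x
        show "indicat_real E x \<le> (2 * t / k) powr p * (IB x * w j x powr p)"
        proof (cases "x \<in> E")
          case True
          then have b1: "1 \<le> (2 * t / k) * w j x" by (intro wbig) (simp add: E_def)
          have I1: "IB x = 1" using True by (simp add: E_def IB_def)
          have "1 \<le> ((2 * t / k) * w j x) powr p" using b1 p by (intro ge_one_powr_ge_zero) auto
          also have "\<dots> = (2 * t / k) powr p * w j x powr p" using t k w0 by (subst powr_mult) auto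
          finally show ?thesis using True I1 by simp
        next
          case False then show ?thesis using IB0[of x] by simp
        qed
      qed (use IBi in auto)
      finally show ?thesis using IBi by (simp add: YI)
    qed
    have T0: "0 \<le> T" unfolding T_def by (intro integral_nonneg_AE AE_I2) auto
    have TT: "T \<le> (2 / r) powr p * \<theta> powr (p - 1)"
    proof -
      have "T \<le> (\<integral>z. indicat_real (- ball x0 (r / 2)) z * (max 0 (u z) powr (p - 1) * dist z x0 powr (- q)) \<partial>lborel)"
        unfolding T_def
      proof (rule integral_mono)
        show "integrable lborel (\<lambda>z. indicat_real (- ball x0 (rh j)) z * (w (Suc j) z powr (p - 1) * dist z x0 powr (- q)))"
          unfolding q_def N_def
        proof (rule tail_integrable)
          show "w (Suc j) z powr (p - 1) \<le> M powr (p - 1)" for z using w0 wM p by (intro powr_mono2) auto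
        qed (use p s rpos r in auto)
        show "integrable lborel (\<lambda>z. indicat_real (- ball x0 (r / 2)) z * (max 0 (u z) powr (p - 1) * dist z x0 powr (- q)))"
          unfolding q_def N_def
        proof (rule tail_integrable)
          show "max 0 (u z) powr (p - 1) \<le> M powr (p - 1)" for z
            using M[of z] p by (intro powr_mono2) auto
        qed (use p s r in auto)
        fix z
        show "indicat_real (- ball x0 (rh j)) z * (w (Suc j) z powr (p - 1) * dist z x0 powr (- q))
          \<le> indicat_real (- ball x0 (r / 2)) z * (max 0 (u z) powr (p - 1) * dist z x0 powr (- q))"
        proof (intro mult_mono)
          show "indicat_real (- ball x0 (rh j)) z \<le> indicat_real (- ball x0 (r / 2)) z"
            using rpos(4) by (auto simp: indicator_def)
          show "w (Suc j) z powr (p - 1) \<le> max 0 (u z) powr (p - 1)"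
            using kk0[of "Suc j"] p by (intro powr_mono2) (auto simp: w_def)
        qed auto
      qed
      then show ?thesis using \<theta>(3) unfolding q_def N_def by linarith
    qed
    have main: "Y (Suc j) \<le> D * bb ^ j * (y j powr \<beta> * Y j)"
    \<comment> \<open>For Y_j = 0 the radius rr below would be 0, which Faber--Krahn excludes; here
      monotonicity in ball and level is enough.\<close>
    proof (cases "Y j = 0")
      case True
      have "Y (Suc j) \<le> A" unfolding Y_def A_def
      proof (rule integral_mono[OF wp IBi(1)])
        fix x show "indicat_real (ball x0 (rh (Suc j))) x * w (Suc j) x powr p \<le> IB x * w (Suc j) x powr p"
          unfolding IB_def using rpos(2) by (intro mult_right_mono) (auto simp: indicator_def)
      qed
      then show ?thesis using AY True by simp
    next
      case False
      then have Yp: "Y j > 0" using Y0[of j] by simp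
      then have yp: "y j > 0" using kp V by (simp add: y_def)
      \<comment> \<open>Chosen so that the ball of radius rr has exactly twice the volume of the
        Chebyshev bound for |E|. The N-th root is the source of the gain y_j^(p/N).\<close>
      define rr where "rr = r * (2 * (2 * t) powr p * y j) powr (1 / N)"
      have rr0: "rr > 0" unfolding rr_def using r t yp by simp
      have "measure lborel (ball (0::'a) rr) = unit_ball_vol N * rr ^ DIM('a)"
        using content_ball[of rr "0::'a"] rr0 unfolding N_def by simp
      also have "rr ^ DIM('a) = rr powr N" using rr0 by (simp add: N_def powr_realpow)
      also have "\<dots> = r powr N * (2 * (2 * t) powr p * y j)"
        unfolding rr_def using r t yp N by (simp add: powr_mult powr_powr)
      also have "r powr N = r ^ DIM('a)" using r by (simp add: N_def powr_realpow)
      finally have m1: "measure lborel (ball (0::'a) rr) = (unit_ball_vol N * r ^ DIM('a)) * (2 * (2 * t) powr p * y j)" by simp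
      have V2: "unit_ball_vol N * r ^ DIM('a) = V"
        using content_ball[of r x0] r unfolding N_def V_def by simp
      have m2: "measure lborel (ball (0::'a) rr) = 2 * ((2 * t / k) powr p * Y j)"
      proof -
        have "(2 * t / k) powr p = (2 * t) powr p / k powr p" using t k by (subst powr_divide) auto
        then show ?thesis unfolding m1 V2 y_def using V by simp
      qed
      have rE: "2 * measure lborel {x \<in> ball x0 (rh j). u x > kk (Suc j)} \<le> measure lborel (ball (0::'a) rr)"
        using EY unfolding m2 E_def by simp
      have bO: "ball x0 (rh j) \<subseteq> \<Omega>" using rpos(3) r(3) by (auto simp: subset_iff)
      have r1: "rh j \<le> 1" using rpos(3) r by simp
      have "Y (Suc j) \<le> 2 * (16 * rr) powr p * ((8 / (rh j - rh (Suc j))) powr p * ca * A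
          + cb * ((rh j - rh (Suc j)) / (2 * rh j)) powr (- q) * A1 * T)"
        unfolding Y_def A_def A1_def T_def IB_def ca cb q_def N_def
        by (rule De_Giorgi_step[OF p s Lam C H1 Ks Kb W sub u ae M g aeg rpos(1,2) r1 bO Cn _ rr0 rE]) (auto simp: w_def)
      then have est: "Y (Suc j) \<le> 2 * (16 * (r * (2 * (2 * t) powr p * y j) powr (1 / N))) powr p * ((8 / (r / (4 * t))) powr p * ca * A
          + cb * ((r / (4 * t)) / (2 * rh j)) powr (- q) * A1 * T)"
        unfolding rdiff rr_def .
      \<comment> \<open>Since rh_j \<le> r, the relative gap of the radii is at least 1 / (8 t), and
        the power is decreasing.\<close>
      have X: "((r / (4 * t)) / (2 * rh j)) powr (- q) \<le> (8 * t) powr q"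
      proof -
        have "1 / (8 * t) \<le> (r / (4 * t)) / (2 * rh j)" using rpos r t by (simp add: field_simps)
        then have "((r / (4 * t)) / (2 * rh j)) powr (- q) \<le> (1 / (8 * t)) powr (- q)"
          using t q0 by (intro powr_mono2') auto
        also have "\<dots> = (8 * t) powr q" using t by (simp add: powr_divide powr_minus_divide)
        finally show ?thesis .
      qed
      have "Y (Suc j) \<le> step_const p N q ca cb * \<delta> powr (1 - p) * t powr (p * p / N + 2 * p + q) * (y j powr \<beta> * Y j)"
        by (rule step_algebra[OF p N _ t r(1) k yp yj Y0 \<delta> _ cb0 _ \<theta>(1,2) AY A10 A1Y _ X T0 TT est])
           (use q0 ca1 \<beta> in \<open>auto simp: N_def\<close>)
      moreover have "bb ^ j = t powr (p * p / N + 2 * p + q)"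
        unfolding bb_def t_def by (simp add: powr_realpow[symmetric] powr_powr mult.commute)
      ultimately show ?thesis by (simp add: D_def mult_ac)
    qed
    have "y (Suc j) \<le> D * bb ^ j * (y j powr \<beta> * Y j) / (k powr p * V)"
      unfolding y_def[of "Suc j"] using main kp V by (intro divide_right_mono) auto
    also have "\<dots> = D * bb ^ j * (y j * y j powr \<beta>)" by (simp add: y_def)
    finally show ?thesis .
  qed
  have st: "y 0 \<le> D powr (- 1 / \<beta>) * bb powr (- 1 / \<beta>\<^sup>2)"
  proof -
    have "y 0 = (\<integral>x. indicat_real (ball x0 r) x * max 0 (u x) powr p \<partial>lborel) / (k powr p * V)"
      by (simp add: y_def Y_def rh_def w_def kk_def)
    then show ?thesis using start unfolding D_def bb_def N_def q_def V_def by simp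
  qed
  have lim: "y \<longlonglongrightarrow> 0" by (rule fast_geometric_convergence[OF ynn step bb1 D1 \<beta>(1) st])
  define Z where "Z = (\<integral>x. indicat_real (ball x0 (r / 2)) x * max 0 (u x - k) powr p \<partial>lborel)"
  have Zi: "integrable lborel (\<lambda>x. indicat_real (ball x0 (r / 2)) x * max 0 (u x - k) powr p)"
  proof (rule ball_integrable)
    show "\<bar>max 0 (u x - k) powr p\<bar> \<le> M powr p" for x using M[of x] k p by (auto intro!: powr_mono2)
  qed measurable
  \<comment> \<open>The limiting energy uses the smallest ball and the highest level, so after
    normalisation it lies below every y_j and hence below their limit 0.\<close>
  have ZY: "Z / (k powr p * V) \<le> y j" for j
  proof -
    have "Z \<le> Y j" unfolding Z_def Y_def
    proof (rule integral_mono[OF Zi wp])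
      fix x
      show "indicat_real (ball x0 (r / 2)) x * max 0 (u x - k) powr p \<le> indicat_real (ball x0 (rh j)) x * w j x powr p"
      proof (intro mult_mono)
        have "r / 2 * 1 \<le> rh j" unfolding rh_def using r by (intro mult_left_mono) auto
        then show "indicat_real (ball x0 (r / 2)) x \<le> indicat_real (ball x0 (rh j)) x"
          by (auto simp: indicator_def)
        show "max 0 (u x - k) powr p \<le> w j x powr p" using kk0[of j] p by (intro powr_mono2) (auto simp: w_def)
      qed auto
    qed
    then show ?thesis unfolding y_def using kp V by (intro divide_right_mono) auto
  qed
  have "Z / (k powr p * V) \<le> 0" by (rule LIMSEQ_le_const[OF lim]) (use ZY in auto)
  then have "Z \<le> 0" using mult_pos_pos[OF kp V] by (auto simp: divide_le_0_iff)
  moreover have "0 \<le> Z" unfolding Z_def by (intro integral_nonneg_AE AE_I2) auto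
  ultimately have "Z = 0" by simp
  then have "AE x in lborel. indicat_real (ball x0 (r / 2)) x * max 0 (u x - k) powr p = 0"
    unfolding Z_def using integral_nonneg_eq_0_iff_AE[OF Zi] by simp
  then show ?thesis
  proof eventually_elim
    fix x assume "indicat_real (ball x0 (r / 2)) x * max 0 (u x - k) powr p = 0"
    then show "x \<in> ball x0 (r / 2) \<longrightarrow> u x \<le> k" by (auto simp: max_def split: if_splits)
  qed
qed


section \<open>Borel representatives and the final estimate\<close>

lemma borel_version_euclidean:
  fixes f :: "'a::euclidean_space \<Rightarrow> 'b::euclidean_space"
  assumes "f \<in> borel_measurable lebesgue"
  obtains f' where "f' \<in> borel_measurable borel" "AE x in lebesgue. f x = f' x"
proof -
  have "\<exists>h\<in>borel_measurable lborel. AE x in lborel. f x \<bullet> i = h x" for i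
    using assms by (intro completion_ex_borel_measurable_real) simp
  then obtain h where h: "\<And>i. h i \<in> borel_measurable lborel" "\<And>i. AE x in lborel. f x \<bullet> i = h i x" by metis
  define f' where "f' x = (\<Sum>i\<in>Basis. h i x *\<^sub>R i)" for x
  have "AE x in lborel. \<forall>i\<in>Basis. f x \<bullet> i = h i x" using h(2) by (intro eventually_ball_finite) auto
  then have "AE x in lborel. f x = f' x"
  proof eventually_elim
    fix x assume a: "\<forall>i\<in>Basis. f x \<bullet> i = h i x"
    have "f x = (\<Sum>i\<in>Basis. (f x \<bullet> i) *\<^sub>R i)" by (simp add: euclidean_representation)
    also have "\<dots> = f' x" unfolding f'_def using a by (intro sum.cong) auto
    finally show "f x = f' x" .
  qed
  moreover have "f' \<in> borel_measurable borel" unfolding f'_def[abs_def] using h(1) by auto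
  ultimately show ?thesis using that by (simp add: AE_completion_iff)
qed

theorem mainTheorem6:
  fixes p s \<Lambda> C\<^sub>1 C\<^sub>2 :: real
  assumes "DIM('a::euclidean_space) \<ge> 2"
    and "1 < p" and "0 < s" and "s < 1" and "\<Lambda> \<ge> 1" and "C\<^sub>1 > 0" and "C\<^sub>2 > 0"
  shows "\<exists>c>0. \<forall>(\<Omega>::'a set) (\<B>::'a \<Rightarrow> real \<Rightarrow> 'a \<Rightarrow> 'a) (K::'a \<Rightarrow> 'a \<Rightarrow> real) u x0 r \<delta>.
     smooth_bounded_domain \<Omega> \<and>
     (\<forall>v \<zeta>. set_borel_measurable lebesgue \<Omega> (\<lambda>x. \<B> x v \<zeta>)) \<and>
     (\<forall>x\<in>\<Omega>. continuous_on UNIV (\<lambda>(v, \<zeta>). \<B> x v \<zeta>)) \<and>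
     (AE x in lebesgue. x \<in> \<Omega> \<longrightarrow> (\<forall>v \<zeta>. \<B> x v \<zeta> \<bullet> \<zeta> \<ge> C\<^sub>1 * norm \<zeta> powr p \<and>
                                           norm (\<B> x v \<zeta>) \<le> C\<^sub>2 * norm \<zeta> powr (p - 1))) \<and>
     (\<lambda>z. K (fst z) (snd z)) \<in> borel_measurable lebesgue \<and>
     (\<forall>x y. K x y = K y x) \<and>
     (\<forall>x y. x \<noteq> y \<longrightarrow> dist x y powr (- (real DIM('a) + p * s)) / \<Lambda> \<le> K x y \<and>
                         K x y \<le> \<Lambda> * dist x y powr (- (real DIM('a) + p * s))) \<and>
     weak_subsolution \<Omega> p \<B> K u \<and>
     ball x0 r \<subseteq> \<Omega> \<and> 0 < r \<and> r \<le> 1 \<and> 0 < \<delta> \<and> \<delta> \<le> 1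
     \<longrightarrow> esssup (restrict_space lebesgue (ball x0 (r / 2))) (\<lambda>x. ereal (u x))
         \<le> ereal (\<delta> * Tail p s (\<lambda>x. max (u x) 0) x0 (r / 2)
             + c * \<delta> powr (- ((p - 1) * kappa DIM('a) p / (p * (kappa DIM('a) p - 1))))
               * ((1 / measure lebesgue (ball x0 r)) *
                  (LINT x:ball x0 r|lebesgue. max (u x) 0 powr p)) powr (1 / p))"
proof -
  note p = assms(2) and s = assms(3,4) and Lam = assms(5) and C = assms(6,7)
  define N where "N = real DIM('a)"
  have N: "N \<ge> 2" using assms(1) by (simp add: N_def)
  define q where "q = N + p * s"
  \<comment> \<open>Only p, s and the dimension enter this integral, so c may depend on its
    value.\<close>
  obtain Cn where Cn: "(\<integral>\<^sup>+z. ennreal (norm z powr (p * (1 - s) - real DIM('a))) * indicator (ball (0::'a) 2 - {0}) z \<partial>lborel) = ennreal Cn" "Cn \<ge> 0"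
  proof -
    define I where "I = (\<integral>\<^sup>+z. ennreal (norm z powr (p * (1 - s) - real DIM('a))) * indicator (ball (0::'a) 2 - {0}) z \<partial>lborel)"
    have "I < \<infinity>" unfolding I_def using p s by (intro nn_integral_norm_powr_near) auto
    then have "I = ennreal (enn2real I)" by simp
    then show ?thesis by (rule that[of "enn2real I", unfolded I_def[symmetric]]) simp
  qed
  define ca where "ca = 1 + 2 / C\<^sub>1 * (young_const p C\<^sub>1 C\<^sub>2 + 2 * \<Lambda> * nonlocal_const p * Cn)"
  define cb where "cb = 4 * \<Lambda> / C\<^sub>1"
  have ca1: "ca \<ge> 1" unfolding ca_def young_const_def using C p Lam Cn(2) nonlocal_const_pos[OF p] by simp
  have cb0: "cb \<ge> 0" unfolding cb_def using C Lam by simp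
  define C0 where "C0 = step_const p N q ca cb"
  have C01: "C0 \<ge> 1" unfolding C0_def using N by (intro step_const_ge_1 p ca1 cb0) auto
  define bb where "bb = 2 powr (p * p / N + 2 * p + q)"
  have bb0: "bb > 0" by (simp add: bb_def)
  define \<kappa> where "\<kappa> = kappa DIM('a) p"
  \<comment> \<open>This is 1 - 1/\<kappa>. For p < N it equals p / N, the full gain; for p \<ge> N
    it is 1/2, below p / N \<ge> 1.\<close>
  define \<beta> where "\<beta> = (\<kappa> - 1) / \<kappa>"
  have \<kappa>1: "\<kappa> > 1" using p N by (auto simp: \<kappa>_def kappa_def N_def[symmetric])
  have \<beta>0: "\<beta> > 0" using \<kappa>1 by (simp add: \<beta>_def)
  have \<beta>N: "\<beta> \<le> p / N"
  proof (cases "p < N")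
    case True
    then have "\<kappa> = N / (N - p)" by (simp add: \<kappa>_def kappa_def N_def)
    then have "\<beta> = p / N" using True N p \<kappa>1 by (simp add: \<beta>_def field_simps)
    then show ?thesis by simp
  next
    case False
    then have "\<kappa> = 2" by (simp add: \<kappa>_def kappa_def N_def)
    then have "\<beta> = 1 / 2" by (simp add: \<beta>_def)
    moreover have "1 \<le> p / N" using False N by simp
    ultimately show ?thesis by linarith
  qed
  \<comment> \<open>c^p is the reciprocal of the \<delta>-free part of the starting threshold
    D^(-1/\<beta>) bb^(-1/\<beta>^2), where D = C0 \<delta>^(1-p).\<close>
  define c where "c = (C0 powr (1 / \<beta>) * bb powr (1 / \<beta>\<^sup>2)) powr (1 / p)"
  have c0: "c > 0" unfolding c_def using C01 bb0 by simp
  \<comment> \<open>The number -ex * p equals (1 - p) / \<beta>, the power of \<delta> in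
    D^(1/\<beta>).\<close>
  define ex where "ex = (p - 1) * \<kappa> / (p * (\<kappa> - 1))"
  have ex\<beta>: "ex = (p - 1) / (p * \<beta>)" using \<kappa>1 p by (simp add: ex_def \<beta>_def)
  show ?thesis
  proof (rule exI[of _ c], intro conjI allI impI c0, elim conjE)
    fix \<Omega> :: "'a set" and B :: "'a \<Rightarrow> real \<Rightarrow> 'a \<Rightarrow> 'a" and K :: "'a \<Rightarrow> 'a \<Rightarrow> real" and uo x0 and r \<delta> :: real
    assume H1: "AE x in lebesgue. x \<in> \<Omega> \<longrightarrow> (\<forall>v \<zeta>. B x v \<zeta> \<bullet> \<zeta> \<ge> C\<^sub>1 * norm \<zeta> powr p \<and> norm (B x v \<zeta>) \<le> C\<^sub>2 * norm \<zeta> powr (p - 1))"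
      and Ks: "\<forall>x y. K x y = K y x"
      and Kb: "\<forall>x y. x \<noteq> y \<longrightarrow> dist x y powr (- (real DIM('a) + p * s)) / \<Lambda> \<le> K x y \<and> K x y \<le> \<Lambda> * dist x y powr (- (real DIM('a) + p * s))"
      and ws: "weak_subsolution \<Omega> p B K uo"
      and bO: "ball x0 r \<subseteq> \<Omega>" and r: "0 < r" "r \<le> 1" and \<delta>: "0 < \<delta>" "\<delta> \<le> 1"
    have uom: "uo \<in> borel_measurable lebesgue" using ws by (simp add: weak_subsolution_def)
    obtain M0 where M0: "AE x in lebesgue. \<bar>uo x\<bar> \<le> M0" using ws by (auto simp: weak_subsolution_def)
    obtain Go where W: "W1p_loc \<Omega> p uo Go" and
      sub: "\<forall>\<Omega>' \<phi> G\<phi>. open \<Omega>' \<and> compact (closure \<Omega>') \<and> closure \<Omega>' \<subseteq> \<Omega> \<and> W01p \<Omega>' p \<phi> G\<phi> \<and> (AE x in lebesgue. 0 \<le> \<phi> x) \<longrightarrow>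
          set_integrable lebesgue \<Omega>' (\<lambda>x. B x (uo x) (Go x) \<bullet> G\<phi> x) \<and>
          integrable lebesgue (\<lambda>(x,y). ppow p (uo x - uo y) * (\<phi> x - \<phi> y) * K x y) \<and>
          (LINT x:\<Omega>'|lebesgue. B x (uo x) (Go x) \<bullet> G\<phi> x)
            + (LINT z|lebesgue. (\<lambda>(x,y). ppow p (uo x - uo y) * (\<phi> x - \<phi> y) * K x y) z) \<le> 0"
      using ws unfolding weak_subsolution_def by blast
    define M where "M = max 0 M0"
    obtain u1 where u1: "u1 \<in> borel_measurable borel" "AE x in lebesgue. uo x = u1 x"
      using borel_version_euclidean[OF uom] by blast
    \<comment> \<open>Clamping the Borel version turns the a.e. bound into one valid at every point,
      and changes it only on a null set.\<close>
    define u where "u x = max (- M) (min M (u1 x))" for x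
    have u[measurable]: "u \<in> borel_measurable borel" unfolding u_def[abs_def] using u1(1) by measurable
    have M: "\<bar>u x\<bar> \<le> M" for x by (auto simp: u_def M_def)
    have ae: "AE x in lebesgue. uo x = u x"
      using u1(2) M0 by eventually_elim (auto simp: u_def M_def)
    have "(\<lambda>x. indicator \<Omega> x *\<^sub>R Go x) \<in> borel_measurable lebesgue"
      using W by (simp add: W1p_loc_def set_borel_measurable_def)
    then obtain g where g: "g \<in> borel_measurable borel" "AE x in lebesgue. indicator \<Omega> x *\<^sub>R Go x = g x"
      using borel_version_euclidean by blast
    have aeg: "AE x in lebesgue. x \<in> \<Omega> \<longrightarrow> Go x = g x" using g(2) by eventually_elim auto
    define T0 where "T0 = (\<integral>y. indicat_real (- ball x0 (r / 2)) y * (max 0 (u y) powr (p - 1) * dist y x0 powr (- (real DIM('a) + p * s))) \<partial>lborel)"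
    define \<theta> where "\<theta> = Tail p s (\<lambda>x. max (uo x) 0) x0 (r / 2)"
    have T00: "T0 \<ge> 0" unfolding T0_def by (intro integral_nonneg_AE AE_I2) auto
    have Teq: "(LINT y:(UNIV - ball x0 (r / 2))|lebesgue. \<bar>max (uo y) 0\<bar> powr (p - 1) / dist y x0 powr (real DIM('a) + p * s)) = T0"
    proof -
      let ?f = "\<lambda>y. indicat_real (- ball x0 (r / 2)) y * (max 0 (u y) powr (p - 1) * dist y x0 powr (- (real DIM('a) + p * s)))"
      have [measurable]: "indicat_real (- ball x0 (r / 2)) \<in> borel_measurable borel" by (intro borel_measurable_indicator) auto
      have fm: "?f \<in> borel_measurable lborel" by measurable
      have "AE y in lebesgue. indicat_real (UNIV - ball x0 (r / 2)) y *\<^sub>R (\<bar>max (uo y) 0\<bar> powr (p - 1) / dist y x0 powr (real DIM('a) + p * s)) = ?f y"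
        using ae
      proof eventually_elim
        fix y assume "uo y = u y"
        then show "indicat_real (UNIV - ball x0 (r / 2)) y *\<^sub>R (\<bar>max (uo y) 0\<bar> powr (p - 1) / dist y x0 powr (real DIM('a) + p * s)) = ?f y"
          unfolding powr_minus_divide[of "dist y x0"] by (auto simp: indicator_def max.commute)
      qed
      then have "(LINT y:(UNIV - ball x0 (r / 2))|lebesgue. \<bar>max (uo y) 0\<bar> powr (p - 1) / dist y x0 powr (real DIM('a) + p * s)) = (\<integral>y. ?f y \<partial>lebesgue)"
        unfolding set_lebesgue_integral_def
      proof (intro integral_cong_AE)
        have [measurable]: "(\<lambda>y. dist y x0) \<in> borel_measurable lebesgue" by (rule measurable_completion) simp
        have [measurable]: "indicat_real (UNIV - ball x0 (r / 2)) \<in> borel_measurable lebesgue"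
          by (rule measurable_completion, intro borel_measurable_indicator) auto
        show "(\<lambda>y. indicat_real (UNIV - ball x0 (r / 2)) y *\<^sub>R (\<bar>max (uo y) 0\<bar> powr (p - 1) / dist y x0 powr (real DIM('a) + p * s))) \<in> borel_measurable lebesgue"
          using uom by measurable
        show "?f \<in> borel_measurable lebesgue" by (rule measurable_completion[OF fm])
      qed
      also have "\<dots> = T0" unfolding T0_def by (rule integral_completion[OF fm])
      finally show ?thesis .
    qed
    have \<theta>0: "\<theta> \<ge> 0" by (simp add: \<theta>_def Tail_def)
    \<comment> \<open>Inverts the definition of \<open>Tail\<close> at radius r / 2; its prefactor
      (r / 2)^p is the origin of (2 / r)^p.\<close>
    have \<theta>T: "T0 = (2 / r) powr p * \<theta> powr (p - 1)"
    proof -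
      have "\<theta> powr (p - 1) = (r / 2) powr p * T0"
        unfolding \<theta>_def Tail_def Teq using p T00 by (simp add: powr_powr)
      moreover have "(2 / r) powr p * (r / 2) powr p = 1" using r by (subst powr_mult[symmetric]) auto
      ultimately show ?thesis by (simp add: mult.assoc[symmetric])
    qed
    define V where "V = measure lborel (ball x0 r)"
    have V: "V > 0" unfolding V_def using r by (simp add: content_ball_pos)
    define a where "a = (1 / measure lebesgue (ball x0 r)) * (LINT x:ball x0 r|lebesgue. max (uo x) 0 powr p)"
    define Y where "Y = (\<integral>x. indicat_real (ball x0 r) x * max 0 (u x) powr p \<partial>lborel)"
    have Y0: "Y \<ge> 0" unfolding Y_def by (intro integral_nonneg_AE AE_I2) auto
    have aY: "a = Y / V"
    proof -
      let ?f = "\<lambda>x. indicat_real (ball x0 r) x * max 0 (u x) powr p"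
      have [measurable]: "indicat_real (ball x0 r) \<in> borel_measurable borel" by (intro borel_measurable_indicator) auto
      have fm: "?f \<in> borel_measurable lborel" by measurable
      have "AE x in lebesgue. indicat_real (ball x0 r) x *\<^sub>R (max (uo x) 0 powr p) = ?f x"
        using ae by eventually_elim (auto simp: max.commute)
      then have "(LINT x:ball x0 r|lebesgue. max (uo x) 0 powr p) = (\<integral>x. ?f x \<partial>lebesgue)"
        unfolding set_lebesgue_integral_def
      proof (intro integral_cong_AE)
        have [measurable]: "indicat_real (ball x0 r) \<in> borel_measurable lebesgue"
          by (rule measurable_completion, intro borel_measurable_indicator) auto
        show "(\<lambda>x. indicat_real (ball x0 r) x *\<^sub>R (max (uo x) 0 powr p)) \<in> borel_measurable lebesgue"
          using uom by measurable
        show "?f \<in> borel_measurable lebesgue" by (rule measurable_completion[OF fm])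
      qed
      also have "\<dots> = Y" unfolding Y_def by (rule integral_completion[OF fm])
      finally show ?thesis unfolding a_def V_def by simp
    qed
    have a0: "a \<ge> 0" using aY Y0 V by simp
    define k0 where "k0 = \<delta> * \<theta> + c * \<delta> powr (- ex) * a powr (1 / p)"
    have k00: "k0 \<ge> 0" unfolding k0_def using \<delta> \<theta>0 c0 by simp
    \<comment> \<open>The iteration divides by k^p, while k0 may be 0. The bound is therefore proved
      for positive k, applied at k0 + 1/(n+1), and passed to the limit over countably many
      n.\<close>
    have bound: "AE x in lborel. x \<in> ball x0 (r / 2) \<longrightarrow> u x \<le> k" if k: "k > 0" "k \<ge> k0" for k
    proof -
      have k1: "\<delta> * \<theta> \<le> k" using k(2) c0 unfolding k0_def by (smt (verit) mult_nonneg_nonneg powr_ge_zero)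
      have k2: "c * \<delta> powr (- ex) * a powr (1 / p) \<le> k" using k(2) \<delta> \<theta>0 unfolding k0_def by (smt (verit) mult_nonneg_nonneg)
      define D where "D = C0 * \<delta> powr (1 - p)"
      have D0: "D > 0" unfolding D_def using C01 \<delta> by simp
      have "(c * \<delta> powr (- ex) * a powr (1 / p)) powr p \<le> k powr p"
        using k2 c0 p by (intro powr_mono2) auto
      also have "(c * \<delta> powr (- ex) * a powr (1 / p)) powr p = (D powr (1 / \<beta>) * bb powr (1 / \<beta>\<^sup>2)) * a"
      proof -
        have "(c * \<delta> powr (- ex) * a powr (1 / p)) powr p = c powr p * (\<delta> powr (- ex)) powr p * (a powr (1 / p)) powr p"
          using c0 by (simp add: powr_mult)
        also have "c powr p = C0 powr (1 / \<beta>) * bb powr (1 / \<beta>\<^sup>2)" unfolding c_def using p by (simp add: powr_powr)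
        also have "(a powr (1 / p)) powr p = a" using a0 p by (simp add: powr_powr)
        also have "(\<delta> powr (- ex)) powr p = (\<delta> powr (1 - p)) powr (1 / \<beta>)"
        proof -
          have "- ex * p = (1 - p) * (1 / \<beta>)" unfolding ex\<beta> using p \<beta>0 by (simp add: field_simps)
          then show ?thesis by (simp only: powr_powr)
        qed
        also have "C0 powr (1 / \<beta>) * bb powr (1 / \<beta>\<^sup>2) * (\<delta> powr (1 - p)) powr (1 / \<beta>) * a
           = (D powr (1 / \<beta>) * bb powr (1 / \<beta>\<^sup>2)) * a"
          unfolding D_def using C01 by (simp add: powr_mult)
        finally show ?thesis .
      qed
      finally have main: "(D powr (1 / \<beta>) * bb powr (1 / \<beta>\<^sup>2)) * a \<le> k powr p" .
      have st: "Y / (k powr p * V) \<le> D powr (- 1 / \<beta>) * bb powr (- 1 / \<beta>\<^sup>2)"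
      proof -
        have "Y / (k powr p * V) = a / k powr p" unfolding aY by simp
        also have "\<dots> \<le> 1 / (D powr (1 / \<beta>) * bb powr (1 / \<beta>\<^sup>2))"
          using main k D0 bb0 by (simp add: field_simps)
        also have "\<dots> = D powr (- 1 / \<beta>) * bb powr (- 1 / \<beta>\<^sup>2)"
          using D0 bb0 powr_minus_divide[of D "1 / \<beta>"] powr_minus_divide[of bb "1 / \<beta>\<^sup>2"] by simp
        finally show ?thesis .
      qed
      show ?thesis
      proof (rule level_bound[where uo = uo and Go = Go and ca = ca and cb = cb and \<beta> = \<beta> and \<theta> = \<theta> and \<delta> = \<delta> and B = B and K = K
            and \<Omega> = \<Omega> and Cn = Cn and s = s and p = p and \<Lambda> = \<Lambda> and g = g and M = M and ?C1.0 = "C\<^sub>1" and ?C2.0 = "C\<^sub>2"])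
        show "(\<integral>x. indicat_real (ball x0 r) x * max 0 (u x) powr p \<partial>lborel) / (k powr p * measure lborel (ball x0 r))
          \<le> (step_const p (real DIM('a)) (real DIM('a) + p * s) ca cb * \<delta> powr (1 - p)) powr (- 1 / \<beta>)
          * (2 powr (p * p / real DIM('a) + 2 * p + (real DIM('a) + p * s))) powr (- 1 / \<beta>\<^sup>2)"
          using st unfolding D_def C0_def bb_def N_def q_def V_def Y_def .
        show "(\<integral>y. indicat_real (- ball x0 (r / 2)) y * (max 0 (u y) powr (p - 1) * dist y x0 powr (- (real DIM('a) + p * s))) \<partial>lborel)
          \<le> (2 / r) powr p * \<theta> powr (p - 1)" using \<theta>T unfolding T0_def by simp
        fix \<Omega>' \<phi> G\<phi>
        show "open \<Omega>' \<and> compact (closure \<Omega>') \<and> closure \<Omega>' \<subseteq> \<Omega> \<and> W01p \<Omega>' p \<phi> G\<phi> \<and> (AE x in lebesgue. 0 \<le> \<phi> x) \<longrightarrow>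
          set_integrable lebesgue \<Omega>' (\<lambda>x. B x (uo x) (Go x) \<bullet> G\<phi> x) \<and>
          integrable lebesgue (\<lambda>(x,y). ppow p (uo x - uo y) * (\<phi> x - \<phi> y) * K x y) \<and>
          (LINT x:\<Omega>'|lebesgue. B x (uo x) (Go x) \<bullet> G\<phi> x)
            + (LINT z|lebesgue. (\<lambda>(x,y). ppow p (uo x - uo y) * (\<phi> x - \<phi> y) * K x y) z) \<le> 0"
          using sub by (elim allE)
      qed (use p s Lam C H1 Ks Kb W ae M g aeg Cn r bO k \<delta> \<theta>0 k1 \<beta>0 \<beta>N in \<open>auto simp: ca_def cb_def N_def\<close>)
    qed
    have "AE x in lborel. \<forall>n::nat. x \<in> ball x0 (r / 2) \<longrightarrow> u x \<le> k0 + 1 / (real n + 1)"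
      using k00 by (subst AE_all_countable, intro allI bound) (auto intro!: add_nonneg_pos)
    then have "AE x in lborel. x \<in> ball x0 (r / 2) \<longrightarrow> u x \<le> k0"
    proof eventually_elim
      fix x assume h: "\<forall>n::nat. x \<in> ball x0 (r / 2) \<longrightarrow> u x \<le> k0 + 1 / (real n + 1)"
      show "x \<in> ball x0 (r / 2) \<longrightarrow> u x \<le> k0"
      proof
        assume x: "x \<in> ball x0 (r / 2)"
        show "u x \<le> k0"
        proof (rule field_le_epsilon)
          fix e :: real assume "e > 0"
          then obtain n where "1 / (real n + 1) < e" using nat_approx_posE[of e] by (auto simp: add.commute)
          moreover have "u x \<le> k0 + 1 / (real n + 1)" using h x by blast
          ultimately show "u x \<le> k0 + e" by linarith
        qed
      qed
    qed
    then have "AE x in lebesgue. x \<in> ball x0 (r / 2) \<longrightarrow> u x \<le> k0" by (simp add: AE_completion_iff)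
    with ae have "AE x in lebesgue. x \<in> ball x0 (r / 2) \<longrightarrow> uo x \<le> k0" by eventually_elim simp
    then have "AE x in restrict_space lebesgue (ball x0 (r / 2)). ereal (uo x) \<le> ereal k0"
      by (subst AE_restrict_space_iff) auto
    moreover have "(\<lambda>x. ereal (uo x)) \<in> borel_measurable (restrict_space lebesgue (ball x0 (r / 2)))"
      using uom by (intro measurable_restrict_space1) measurable
    ultimately have "esssup (restrict_space lebesgue (ball x0 (r / 2))) (\<lambda>x. ereal (uo x)) \<le> ereal k0"
      by (intro esssup_I)
    then show "esssup (restrict_space lebesgue (ball x0 (r / 2))) (\<lambda>x. ereal (uo x))
         \<le> ereal (\<delta> * Tail p s (\<lambda>x. max (uo x) 0) x0 (r / 2)
             + c * \<delta> powr (- ((p - 1) * kappa DIM('a) p / (p * (kappa DIM('a) p - 1))))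
               * ((1 / measure lebesgue (ball x0 r)) *
                  (LINT x:ball x0 r|lebesgue. max (uo x) 0 powr p)) powr (1 / p))"
      unfolding k0_def \<theta>_def a_def ex_def \<kappa>_def .
  qed
qed

end
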